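(* Let (A2)--(A3) (stated in the context) hold. Then for any $\alpha>0$ and any choice of data $h^\delta\in L^2(0,T)$, the problem $$J_\alpha^\delta(a):=\|F(a)-h^\delta\|_{L^2(0,T)}^2+\alpha\,\|a-a^*\|_{H^2(\underline u,\overline u)}^2\to\min_{a\in D(F)}$$ has a minimizer $a_\alpha^\delta\in D(F)$.
   Context: Fix $T>0$ and positive constants $a_0,a_1,a_2,a_3$. Consider the condition (A1) $a\in W^{3,\infty}_{loc}(\mathbb R)$ with $a(0)=0$, $a_0\le a'(\cdot)\le a_1$, $|a''(\cdot)|\le a_2$, $|a'''(\cdot)|\le a_3$. The assumptions on the data are: (A2) $u_0=0$ and $p_0=c$ with $c\in\mathbb R$; (A3) $g_0,g_1\in C^4([0,T])$, $g_0(0)=g_1(0)=0$, $g_0'(0)=g_1'(0)=0$. The data are fixed. State system: for $a$ satisfying (A1), $(p,u)\in C^1([0,T];L^2(0,1)^2)\cap C([0,T];H^1(0,1)^2)$ denotes the unique classical solution of $\partial_t p+\partial_x u=0$, $\partial_t u+\partial_x p+a(u)=0$ on $(0,1)\times(0,T)$ with $u(0,t)=g_0(t)$, $u(1,t)=g_1(t)$, $p(\cdot,0)=p_0$, $u(\cdot,0)=u_0$. There are constants $\underline u<\overline u$, independent of $a$, such that $\underline u\le u(x,t)\le\overline u$ for all $x\in[0,1]$, $t\in[0,T]$ and every $a$ satisfying (A1); fix such constants. Parameters are restricted to $[\underline u,\overline u]$ (the solution only depends on this restriction), and $D(F)=\{a\in H^2(\underline u,\overline u): \text{(A1) holds}\}$,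 i.e. the (nonempty) set of restrictions to $[\underline u,\overline u]$ of functions satisfying (A1) with the fixed constants. The forward operator is $F:D(F)\to L^2(0,T)$, $F(a)=\triangle p:=p(0,\cdot)-p(1,\cdot)$, where $(p,u)$ is the solution for the parameter $a$. Here $a^*\in H^2(\underline u,\overline u)$ is a fixed a-priori guess. The constants $a_0\le a_1$ are such that $D(F)\ne\emptyset$. *)

theory Defs
  imports "HOL-Analysis.Analysis"
begin

text \<open>Elements of these spaces are represented by functions on the whole line, of which only the
  values on the underlying set \<^term>\<open>S\<close> (for the Sobolev notions: an open set) matter.\<close>

definition L2 :: "real set \<Rightarrow> (real \<Rightarrow> real) set" where
  "L2 S = {f. set_borel_measurable lebesgue S f \<and> set_integrable lebesgue S (\<lambda>x. (f x)\<^sup>2)}"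

definition norm_L2 :: "real set \<Rightarrow> (real \<Rightarrow> real) \<Rightarrow> real" where
  "norm_L2 S f = sqrt (LINT x:S|lebesgue. (f x)\<^sup>2)"

definition Linf_loc :: "real set \<Rightarrow> (real \<Rightarrow> real) set" where
  "Linf_loc S = {f. \<forall>K. compact K \<and> K \<subseteq> S \<longrightarrow>
     set_borel_measurable lebesgue K f \<and> (\<exists>M. AE x in lebesgue. x \<in> K \<longrightarrow> \<bar>f x\<bar> \<le> M)}"

definition L1_loc :: "real set \<Rightarrow> (real \<Rightarrow> real) set" where
  "L1_loc S = {f. \<forall>K. compact K \<and> K \<subseteq> S \<longrightarrow> set_integrable lebesgue K f}"

definition test_functions :: "real set \<Rightarrow> (real \<Rightarrow> real) set" where
  "test_functions S = {\<phi>. (\<forall>k x. (deriv ^^ k) \<phi> differentiable (at x)) \<and>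
     compact (closure {x. \<phi> x \<noteq> 0}) \<and> closure {x. \<phi> x \<noteq> 0} \<subseteq> S}"

definition weak_deriv :: "real set \<Rightarrow> nat \<Rightarrow> (real \<Rightarrow> real) \<Rightarrow> (real \<Rightarrow> real) \<Rightarrow> bool" where
  "weak_deriv S k f g \<longleftrightarrow> f \<in> L1_loc S \<and> g \<in> L1_loc S \<and>
     (\<forall>\<phi>\<in>test_functions S.
        (LINT x:S|lebesgue. f x * (deriv ^^ k) \<phi> x) = (-1) ^ k * (LINT x:S|lebesgue. g x * \<phi> x))"

text \<open>The weak derivative is unique up to null sets; the choice of representative is irrelevant
  below, where it only occurs in integrals and almost-everywhere statements.\<close>

definition wderiv :: "real set \<Rightarrow> nat \<Rightarrow> (real \<Rightarrow> real) \<Rightarrow> real \<Rightarrow> real" where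
  "wderiv S k f = (SOME g. weak_deriv S k f g)"

definition sobolev_H :: "nat \<Rightarrow> real set \<Rightarrow> (real \<Rightarrow> real) set" where
  "sobolev_H k S = {f \<in> L2 S. \<forall>i\<le>k. \<exists>g\<in>L2 S. weak_deriv S i f g}"

definition norm_H :: "nat \<Rightarrow> real set \<Rightarrow> (real \<Rightarrow> real) \<Rightarrow> real" where
  "norm_H k S f = sqrt (\<Sum>i\<le>k. (norm_L2 S (wderiv S i f))\<^sup>2)"

definition sobolev_Winf_loc :: "nat \<Rightarrow> real set \<Rightarrow> (real \<Rightarrow> real) set" where
  "sobolev_Winf_loc k S = {f \<in> Linf_loc S. \<forall>i\<le>k. \<exists>g\<in>Linf_loc S. weak_deriv S i f g}"

definition C_k_on :: "nat \<Rightarrow> real \<Rightarrow> (real \<Rightarrow> real) \<Rightarrow> bool" where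
  "C_k_on k T g \<longleftrightarrow> (\<exists>D :: nat \<Rightarrow> real \<Rightarrow> real. D 0 = g \<and>
     (\<forall>i<k. \<forall>t\<in>{0..T}. (D i has_real_derivative D (Suc i) t) (at t within {0..T})) \<and>
     (\<forall>i\<le>k. continuous_on {0..T} (D i)))"

text \<open>A function of space and time is represented by the curve \<^term>\<open>v :: real \<Rightarrow> real \<Rightarrow> real\<close>
  for which \<^term>\<open>v t x\<close> is the value at the point \<^term>\<open>x\<close> at time \<^term>\<open>t\<close>.\<close>

definition curve_C_L2 :: "real \<Rightarrow> (real \<Rightarrow> real \<Rightarrow> real) \<Rightarrow> bool" where
  "curve_C_L2 T v \<longleftrightarrow> (\<forall>t\<in>{0..T}. v t \<in> L2 {0<..<1} \<and>
     ((\<lambda>s. norm_L2 {0<..<1} (\<lambda>x. v s x - v t x)) \<longlongrightarrow> 0) (at t within {0..T}))"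

definition curve_C_H1 :: "real \<Rightarrow> (real \<Rightarrow> real \<Rightarrow> real) \<Rightarrow> bool" where
  "curve_C_H1 T v \<longleftrightarrow> (\<forall>t\<in>{0..T}. v t \<in> sobolev_H 1 {0<..<1} \<and>
     ((\<lambda>s. norm_H 1 {0<..<1} (\<lambda>x. v s x - v t x)) \<longlongrightarrow> 0) (at t within {0..T}))"

definition curve_C1_L2 :: "real \<Rightarrow> (real \<Rightarrow> real \<Rightarrow> real) \<Rightarrow> (real \<Rightarrow> real \<Rightarrow> real) \<Rightarrow> bool" where
  "curve_C1_L2 T v v' \<longleftrightarrow> curve_C_L2 T v \<and> curve_C_L2 T v' \<and>
     (\<forall>t\<in>{0..T}. ((\<lambda>s. norm_L2 {0<..<1} (\<lambda>x. (v s x - v t x) / (s - t) - v' t x)) \<longlongrightarrow> 0)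
        (at t within {0..T}))"

text \<open>Pointwise values of \<^term>\<open>a\<close> are those of the continuous representative; the bounds on the
  derivatives hold almost everywhere.\<close>

definition A1 :: "real \<Rightarrow> real \<Rightarrow> real \<Rightarrow> real \<Rightarrow> (real \<Rightarrow> real) \<Rightarrow> bool" where
  "A1 a0 a1 a2 a3 a \<longleftrightarrow> a \<in> sobolev_Winf_loc 3 UNIV \<and> continuous_on UNIV a \<and> a 0 = 0 \<and>
     (AE y in lebesgue. a0 \<le> wderiv UNIV 1 a y \<and> wderiv UNIV 1 a y \<le> a1) \<and>
     (AE y in lebesgue. \<bar>wderiv UNIV 2 a y\<bar> \<le> a2) \<and>
     (AE y in lebesgue. \<bar>wderiv UNIV 3 a y\<bar> \<le> a3)"

text \<open>The continuity in space selects the continuous representative of the H1-function at each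
  time, so that its values at the end points are its traces.\<close>

definition classical_solution ::
  "real \<Rightarrow> real \<Rightarrow> (real \<Rightarrow> real) \<Rightarrow> (real \<Rightarrow> real) \<Rightarrow> (real \<Rightarrow> real) \<Rightarrow>
     (real \<Rightarrow> real \<Rightarrow> real) \<Rightarrow> (real \<Rightarrow> real \<Rightarrow> real) \<Rightarrow> bool" where
  "classical_solution T c g0 g1 a p u \<longleftrightarrow>
     curve_C_H1 T p \<and> curve_C_H1 T u \<and>
     (\<forall>t\<in>{0..T}. continuous_on {0..1} (p t) \<and> continuous_on {0..1} (u t)) \<and>
     (\<exists>p' u'. curve_C1_L2 T p p' \<and> curve_C1_L2 T u u' \<and>
        (\<forall>t\<in>{0<..<T}. AE x in lebesgue. x \<in> {0<..<1} \<longrightarrow>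
           p' t x + wderiv {0<..<1} 1 (u t) x = 0 \<and>
           u' t x + wderiv {0<..<1} 1 (p t) x + a (u t x) = 0)) \<and>
     (\<forall>t\<in>{0..T}. u t 0 = g0 t \<and> u t 1 = g1 t) \<and>
     (\<forall>x\<in>{0..1}. p 0 x = c \<and> u 0 x = 0)"

text \<open>Parameters are functions on \<^term>\<open>{ul..uh}\<close> only, and the state for a parameter is the one
  obtained from any extension satisfying the structural condition on the whole line.\<close>

definition extends_param ::
  "real \<Rightarrow> real \<Rightarrow> real \<Rightarrow> real \<Rightarrow> real \<Rightarrow> real \<Rightarrow> (real \<Rightarrow> real) \<Rightarrow> (real \<Rightarrow> real) \<Rightarrow> bool" where
  "extends_param a0 a1 a2 a3 ul uh a b \<longleftrightarrow> A1 a0 a1 a2 a3 b \<and> (\<forall>y\<in>{ul..uh}. b y = a y)"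

definition param_domain ::
  "real \<Rightarrow> real \<Rightarrow> real \<Rightarrow> real \<Rightarrow> real \<Rightarrow> real \<Rightarrow> (real \<Rightarrow> real) set" where
  "param_domain a0 a1 a2 a3 ul uh =
     {a \<in> sobolev_H 2 {ul<..<uh}. \<exists>b. extends_param a0 a1 a2 a3 ul uh a b}"

definition forward_op ::
  "real \<Rightarrow> real \<Rightarrow> real \<Rightarrow> real \<Rightarrow> real \<Rightarrow> real \<Rightarrow>
     real \<Rightarrow> real \<Rightarrow> (real \<Rightarrow> real) \<Rightarrow> (real \<Rightarrow> real) \<Rightarrow> (real \<Rightarrow> real) \<Rightarrow> real \<Rightarrow> real" where
  "forward_op a0 a1 a2 a3 ul uh T c g0 g1 a =
     (THE d. \<exists>b p u. extends_param a0 a1 a2 a3 ul uh a b \<and> classical_solution T c g0 g1 b p u \<and>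
        d = restrict (\<lambda>t. p t 0 - p t 1) {0..T})"

definition tikhonov ::
  "((real \<Rightarrow> real) \<Rightarrow> real \<Rightarrow> real) \<Rightarrow> real \<Rightarrow> real \<Rightarrow> real \<Rightarrow> real \<Rightarrow>
     (real \<Rightarrow> real) \<Rightarrow> (real \<Rightarrow> real) \<Rightarrow> (real \<Rightarrow> real) \<Rightarrow> real" where
  "tikhonov F T ul uh \<alpha> h as a =
     (norm_L2 {0<..<T} (\<lambda>t. F a t - h t))\<^sup>2 + \<alpha> * (norm_H 2 {ul<..<uh} (\<lambda>y. a y - as y))\<^sup>2"

end

theory Submission
  imports Defs "HOL-Complex_Analysis.Great_Picard" "HOL-Real_Asymp.Real_Asymp"
begin

text \<open>Condition (A1) bounds a minimizing sequence of parameters together with its first two derivatives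
  and makes all three equi-Lipschitz. By compactness a subsequence converges, with these derivatives,
  locally uniformly, hence in \<open>H\<^sup>2\<close>, and its limit satisfies (A1) again because a Lipschitz second
  derivative has a bounded weak derivative. It remains to see that \<open>F\<close> is well defined and continuous.

  The difference of two states solves a linear wave system whose zero-order term is monotone up to
  the uniform distance \<open>\<epsilon>\<close> of the parameters. The energy identity bounds the energy by \<open>\<epsilon>\<^sup>2\<close>, and
  the multiplier \<open>2 x - 1\<close> then bounds the traces of the pressure in \<open>L\<^sup>2(0, T)\<close>. This gives uniqueness
  and the continuity of \<open>F\<close>.

  For the existence of a state the boundary data are subtracted; reflecting \<open>p\<close> evenly and \<open>u\<close> oddly
  then turns the system into a single transport equation on the line, with a nonlocal source, which
  is solved by Picard iteration for the space derivative.\<close>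

subsection \<open>Smooth bumps\<close>

text \<open>The forward operator is a definite description over all extensions of a parameter and
  all classical solutions. It denotes the intended trace only once a solution is known to exist and
  the extension is known not to matter. The latter uses that every state takes values in
  [\<open>ul\<close>, \<open>uh\<close>], where extensions agree. The L2 energy suffices for
  uniqueness but does not control boundary values, so the traces need an identity of their own.
  Traces continuous in time come with the solutions constructed here, and well-definedness of
  \<open>F\<close> allows one to compute with these solutions only. As the parameters converge
  strongly, the functional itself converges along the subsequence and weak lower semicontinuity is
  not involved. That a Lipschitz function has a bounded weak derivative is obtained from
  Radon-Nikodym, not from differentiation almost everywhere. In the existence proof the boundary
  conditions turn into symmetry: oddness makes the velocity vanish at 0, and oddness with period two
  makes it vanish at 1.\<close>

lemma poly_exp_decay:
  fixes Q :: "real poly"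
  assumes "\<epsilon> > 0"
  shows "((\<lambda>y. poly Q y * exp (- \<epsilon> * y)) \<longlongrightarrow> 0) at_top"
  using assms
proof (induction Q arbitrary: \<epsilon>)
  case (pCons a Q)
  \<comment> \<open>Half of the exponent is spent on the factor y and the other half on the
    induction hypothesis, which is why \<epsilon> is arbitrary in the induction.\<close>
  have "((\<lambda>y. a * exp (- \<epsilon> * y) + (y * exp (- (\<epsilon>/2) * y)) * (poly Q y * exp (- (\<epsilon>/2) * y)))
      \<longlongrightarrow> a * 0 + 0 * 0) at_top"
  proof (intro tendsto_intros pCons.IH)
    show "((\<lambda>y. exp (- \<epsilon> * y)) \<longlongrightarrow> 0) at_top" using pCons.prems by real_asymp
    show "((\<lambda>y. y * exp (- (\<epsilon>/2) * y)) \<longlongrightarrow> 0) at_top" using pCons.prems by real_asymp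
  qed (use pCons.prems in auto)
  moreover have "a * exp (- \<epsilon> * y) + (y * exp (- (\<epsilon>/2) * y)) * (poly Q y * exp (- (\<epsilon>/2) * y))
      = poly (pCons a Q) y * exp (- \<epsilon> * y)" for y
    by (simp add: algebra_simps flip: exp_add)
  ultimately show ?case by simp
qed simp

text \<open>Derivatives of \<open>exp (- \<epsilon> / x)\<close> are this exponential times
  polynomials in 1/x, so the family is closed under differentiation. Letting \<epsilon> tend to 0
  turns bumps into indicators.\<close>

definition half_bump :: "real \<Rightarrow> real poly \<Rightarrow> real \<Rightarrow> real" where
  "half_bump \<epsilon> P x = (if x > 0 then poly P (1/x) * exp (- \<epsilon> / x) else 0)"

lemma half_bump_deriv:
  assumes "\<epsilon> > 0"
  shows "(half_bump \<epsilon> P has_real_derivative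
    half_bump \<epsilon> (monom 1 2 * (smult \<epsilon> P - pderiv P)) x) (at x)"
proof -
  consider "x < 0" | "x = 0" | "x > 0" by linarith
  then show ?thesis
  proof cases
    case 1
    have "((\<lambda>x. 0::real) has_real_derivative 0) (at x)" by simp
    then have "(half_bump \<epsilon> P has_real_derivative 0) (at x)"
      by (rule has_field_derivative_transform_within[where d = "- x"]) (use 1 in \<open>auto simp: half_bump_def dist_real_def\<close>)
    then show ?thesis using 1 by (simp add: half_bump_def)
  next
    case 3
    have "((\<lambda>x. poly P (1/x) * exp (- \<epsilon> / x)) has_real_derivative
        poly (monom 1 2 * (smult \<epsilon> P - pderiv P)) (1/x) * exp (- \<epsilon> / x)) (at x)"
      using 3 by (auto intro!: derivative_eq_intros
          simp: poly_monom field_simps power2_eq_square)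
    then have "(half_bump \<epsilon> P has_real_derivative
        poly (monom 1 2 * (smult \<epsilon> P - pderiv P)) (1/x) * exp (- \<epsilon> / x)) (at x)"
      by (rule has_field_derivative_transform_within[where d = x]) (use 3 in \<open>auto simp: half_bump_def dist_real_def\<close>)
    then show ?thesis using 3 by (simp add: half_bump_def)
  next
    case 2
    \<comment> \<open>The difference quotient at 0 from the right carries an extra factor 1/h, which
      \<open>pCons 0 P\<close> absorbs; then 1/h tends to infinity.\<close>
    have "((\<lambda>h. poly (pCons 0 P) (1/h) * exp (- \<epsilon> * (1/h))) \<longlongrightarrow> 0) (at_right 0)"
      by (rule filterlim_compose[OF poly_exp_decay[OF assms]])
        (simp add: filterlim_inverse_at_top_right flip: inverse_eq_divide)
    then have "((\<lambda>h. (half_bump \<epsilon> P (0 + h) - half_bump \<epsilon> P 0) / h) \<longlongrightarrow> 0) (at_right 0)"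
      by (rule Lim_transform_eventually)
        (auto simp: eventually_at half_bump_def intro!: exI[of _ 1])
    moreover have "((\<lambda>h. (half_bump \<epsilon> P (0 + h) - half_bump \<epsilon> P 0) / h) \<longlongrightarrow> 0) (at_left 0)"
      by (rule Lim_transform_eventually[OF tendsto_const])
        (auto simp: eventually_at half_bump_def intro!: exI[of _ 1])
    ultimately have "(half_bump \<epsilon> P has_real_derivative 0) (at 0)"
      unfolding DERIV_def by (simp add: filterlim_split_at)
    then show ?thesis using 2 by (simp add: half_bump_def)
  qed
qed

text \<open>Closed under the product rule, hence under all iterated derivatives. The sign from
  differentiating in \<beta> - x is absorbed into the polynomial.\<close>

inductive_set bumps :: "real \<Rightarrow> real \<Rightarrow> real \<Rightarrow> (real \<Rightarrow> real) set" for \<epsilon> \<alpha> \<beta> where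
  prod: "(\<lambda>x. half_bump \<epsilon> P (x - \<alpha>) * half_bump \<epsilon> Q (\<beta> - x)) \<in> bumps \<epsilon> \<alpha> \<beta>"
| sum: "f \<in> bumps \<epsilon> \<alpha> \<beta> \<Longrightarrow> g \<in> bumps \<epsilon> \<alpha> \<beta> \<Longrightarrow> (\<lambda>x. f x + g x) \<in> bumps \<epsilon> \<alpha> \<beta>"

lemma bumps_deriv:
  assumes "f \<in> bumps \<epsilon> \<alpha> \<beta>" "\<epsilon> > 0"
  shows "\<exists>f'\<in>bumps \<epsilon> \<alpha> \<beta>. \<forall>x. (f has_real_derivative f' x) (at x)"
  using assms
proof (induction rule: bumps.induct)
  case (prod P Q)
  let ?d = "\<lambda>P. monom 1 2 * (smult \<epsilon> P - pderiv P)"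
  have neg: "- half_bump \<epsilon> R y = half_bump \<epsilon> (smult (-1) R) y" for R y
    by (simp add: half_bump_def)
  have "((\<lambda>x. half_bump \<epsilon> P (x - \<alpha>) * half_bump \<epsilon> Q (\<beta> - x)) has_real_derivative
     half_bump \<epsilon> (?d P) (x - \<alpha>) * half_bump \<epsilon> Q (\<beta> - x)
      + half_bump \<epsilon> P (x - \<alpha>) * half_bump \<epsilon> (smult (-1) (?d Q)) (\<beta> - x)) (at x)" for x
    unfolding neg[symmetric]
    by (rule derivative_eq_intros DERIV_chain2[OF half_bump_deriv] prod refl)+
      (simp add: algebra_simps)
  then show ?case
    by (intro bexI[OF _ bumps.sum[OF bumps.prod bumps.prod]]) blast
next
  case (sum f g)
  then obtain f' g' where "f' \<in> bumps \<epsilon> \<alpha> \<beta>" "g' \<in> bumps \<epsilon> \<alpha> \<beta>"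
    "\<And>x. (f has_real_derivative f' x) (at x)" "\<And>x. (g has_real_derivative g' x) (at x)"
    by metis
  then show ?case
    by (intro bexI[OF _ bumps.sum[of f' _ _ _ g']]) (auto intro: DERIV_add)
qed

lemma bumps_funpow_deriv:
  assumes "f \<in> bumps \<epsilon> \<alpha> \<beta>" "\<epsilon> > 0"
  shows "(deriv ^^ k) f \<in> bumps \<epsilon> \<alpha> \<beta>"
proof (induction k)
  case (Suc k)
  then obtain f' where f': "f' \<in> bumps \<epsilon> \<alpha> \<beta>"
    "\<And>x. ((deriv ^^ k) f has_real_derivative f' x) (at x)"
    using bumps_deriv assms by blast
  then have "deriv ((deriv ^^ k) f) = f'" by (auto simp: DERIV_imp_deriv)
  then show ?case using f' by simp
qed (use assms in simp)

lemma bumps_outside: "f \<in> bumps \<epsilon> \<alpha> \<beta> \<Longrightarrow> x \<notin> {\<alpha><..<\<beta>} \<Longrightarrow> f x = 0"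
  by (induction rule: bumps.induct) (auto simp: half_bump_def)

definition bump :: "nat \<Rightarrow> real \<Rightarrow> real \<Rightarrow> real \<Rightarrow> real" where
  "bump n \<alpha> \<beta> x = half_bump (1 / Suc n) 1 (x - \<alpha>) * half_bump (1 / Suc n) 1 (\<beta> - x)"

lemma test_functionsI:
  fixes \<phi> :: "real \<Rightarrow> real"
  assumes "\<And>k x. (deriv ^^ k) \<phi> differentiable (at x)" "\<And>x. x \<notin> {p..q} \<Longrightarrow> \<phi> x = 0" "{p..q} \<subseteq> S"
  shows "\<phi> \<in> test_functions S"
proof -
  have "closure {x. \<phi> x \<noteq> 0} \<subseteq> {p..q}"
    by (rule closure_minimal) (use assms(2) in blast, simp)
  moreover from this have "compact (closure {x. \<phi> x \<noteq> 0})"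
    by (meson bounded_closed_interval bounded_subset closed_closure compact_eq_bounded_closed)
  ultimately show ?thesis using assms(1,3) unfolding test_functions_def by blast
qed

lemma bump_test:
  assumes "{\<alpha>..\<beta>} \<subseteq> S"
  shows "bump n \<alpha> \<beta> \<in> test_functions S"
proof (rule test_functionsI[OF _ _ assms])
  have b: "bump n \<alpha> \<beta> \<in> bumps (1 / Suc n) \<alpha> \<beta>"
    unfolding bump_def[abs_def] by (rule bumps.prod)
  show "(deriv ^^ k) (bump n \<alpha> \<beta>) differentiable (at x)" for k x
    using bumps_deriv[OF bumps_funpow_deriv[OF b]] by (auto simp: real_differentiable_def)
  show "bump n \<alpha> \<beta> x = 0" if "x \<notin> {\<alpha>..\<beta>}" for x
    by (rule bumps_outside[OF b]) (use that in auto)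
qed

lemma bump_bounds: "0 \<le> bump n \<alpha> \<beta> x" "bump n \<alpha> \<beta> x \<le> 1"
  by (auto simp: bump_def half_bump_def intro!: mult_le_one)

lemma bump_pos: "x \<in> {\<alpha><..<\<beta>} \<Longrightarrow> bump n \<alpha> \<beta> x > 0"
  by (auto simp: bump_def half_bump_def)

lemma bump_outside: "x \<notin> {\<alpha><..<\<beta>} \<Longrightarrow> bump n \<alpha> \<beta> x = 0"
  by (auto simp: bump_def half_bump_def)

lemma bump_tendsto: "(\<lambda>n. bump n \<alpha> \<beta> x) \<longlonglongrightarrow> indicator {\<alpha><..<\<beta>} x"
proof (cases "x \<in> {\<alpha><..<\<beta>}")
  case True
  have "(\<lambda>n. exp (- (1 / real (Suc n)) / y)) \<longlonglongrightarrow> 1" if "y > 0" for y :: real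
    using that by real_asymp
  from tendsto_mult[OF this this, of "x - \<alpha>" "\<beta> - x"] show ?thesis
    using True by (simp add: bump_def half_bump_def)
qed (simp add: bump_outside)

subsection \<open>Test functions\<close>

lemma test_functions_continuous:
  assumes "\<phi> \<in> test_functions S"
  shows "continuous_on A \<phi>" "(\<phi> has_real_derivative deriv \<phi> x) (at x)"
proof -
  have "\<phi> differentiable (at x)" for x
    using assms by (auto simp: test_functions_def dest: spec[of _ 0])
  then show "(\<phi> has_real_derivative deriv \<phi> x) (at x)"
    "continuous_on A \<phi>"
    by (auto simp: DERIV_deriv_iff_real_differentiable
      intro!: continuous_at_imp_continuous_on differentiable_imp_continuous_within)
qed

text \<open>Outside the closed support the function vanishes on a whole neighbourhood, so its
  derivative vanishes there too.\<close>

lemma test_functions_deriv: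
  assumes "\<phi> \<in> test_functions S"
  shows "deriv \<phi> \<in> test_functions S"
proof -
  let ?C = "closure {x. \<phi> x \<noteq> 0}"
  have "deriv \<phi> x = 0" if "x \<notin> ?C" for x
  proof -
    have "eventually (\<lambda>y. y \<in> - ?C) (nhds x)"
      using that by (intro eventually_nhds_in_open) auto
    then have "eventually (\<lambda>y. \<phi> y = 0) (nhds x)"
      by eventually_elim (use closure_subset[of "{x. \<phi> x \<noteq> 0}"] in blast)
    then have "deriv \<phi> x = deriv (\<lambda>y. 0) x" by (intro deriv_cong_ev) auto
    then show ?thesis by simp
  qed
  then have "closure {x. deriv \<phi> x \<noteq> 0} \<subseteq> ?C" by (intro closure_minimal) auto
  moreover have "(deriv ^^ k) (deriv \<phi>) differentiable (at x)" for k x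
    using assms by (auto simp: test_functions_def funpow_swap1 dest!: spec[of _ "Suc k"])
  moreover have "compact (closure {x. deriv \<phi> x \<noteq> 0})"
    using calculation(1) assms unfolding test_functions_def mem_Collect_eq
    by (metis closed_closure compact_Int_closed inf.absorb_iff2 inf_commute)
  ultimately show ?thesis using assms unfolding test_functions_def by blast
qed

lemma test_functions_funpow_deriv:
  "\<phi> \<in> test_functions S \<Longrightarrow> (deriv ^^ k) \<phi> \<in> test_functions S"
  by (induction k) (auto simp: test_functions_deriv)

lemma compact_subset_open_interval:
  fixes S :: "real set"
  assumes "open S" "is_interval S" "S \<noteq> {}" "compact K" "K \<subseteq> S"
  obtains \<alpha> \<beta> where "\<alpha> < \<beta>" "K \<subseteq> {\<alpha><..<\<beta>}" "{\<alpha>..\<beta>} \<subseteq> S"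
proof -
  obtain x0 where "x0 \<in> S" using assms by auto
  \<comment> \<open>A point of \<open>S\<close> is inserted so that extreme points exist also when
    \<open>K\<close> is empty.\<close>
  let ?K = "insert x0 K"
  have K: "compact ?K" "?K \<noteq> {}" using assms by auto
  obtain a where a: "a \<in> ?K" "\<And>x. x \<in> ?K \<Longrightarrow> a \<le> x" using compact_attains_inf[OF K] by auto
  obtain b where b: "b \<in> ?K" "\<And>x. x \<in> ?K \<Longrightarrow> x \<le> b" using compact_attains_sup[OF K] by auto
  have "a \<in> S" "b \<in> S" using a b assms \<open>x0 \<in> S\<close> by auto
  then obtain e1 e2 where e: "e1 > 0" "cball a e1 \<subseteq> S" "e2 > 0" "cball b e2 \<subseteq> S"
    using \<open>open S\<close> by (meson open_contains_cball)
  have "a - e1 \<in> cball a e1" "b + e2 \<in> cball b e2" using e(1,3) by (simp_all add: dist_real_def)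
  then have "a - e1 \<in> S" "b + e2 \<in> S" using e(2,4) by blast+
  then have "{a - e1..b + e2} \<subseteq> S"
    using mem_is_interval_1_I[OF \<open>is_interval S\<close>, of "a - e1" "b + e2"] by (simp add: subset_iff)
  moreover have *: "a - e1 < x \<and> x < b + e2" if "x \<in> ?K" for x
    using a(2)[OF that] b(2)[OF that] e(1,3) by linarith
  moreover have "a - e1 < b + e2" using *[of x0] by simp
  moreover have "K \<subseteq> {a - e1<..<b + e2}" using * by auto
  ultimately show ?thesis using that by blast
qed

lemma test_functions_support:
  fixes S :: "real set"
  assumes "open S" "is_interval S" "S \<noteq> {}" "\<phi> \<in> test_functions S"
  obtains \<alpha> \<beta> where "\<alpha> < \<beta>" "{\<alpha>..\<beta>} \<subseteq> S" "\<And>x. x \<notin> {\<alpha><..<\<beta>} \<Longrightarrow> \<phi> x = 0"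
proof -
  obtain \<alpha> \<beta> where "\<alpha> < \<beta>" "closure {x. \<phi> x \<noteq> 0} \<subseteq> {\<alpha><..<\<beta>}" "{\<alpha>..\<beta>} \<subseteq> S"
    using compact_subset_open_interval[OF assms(1-3)] assms(4) unfolding test_functions_def by blast
  then show ?thesis using that closure_subset[of "{x. \<phi> x \<noteq> 0}"] by blast
qed

lemma test_functions_diff_cmult:
  assumes \<phi>: "\<phi> \<in> test_functions S" and \<psi>: "\<psi> \<in> test_functions S"
  shows "(\<lambda>x. \<phi> x - c * \<psi> x) \<in> test_functions S"
proof -
  have D: "((deriv ^^ k) \<phi> has_real_derivative (deriv ^^ Suc k) \<phi> x) (at x)"
    "((deriv ^^ k) \<psi> has_real_derivative (deriv ^^ Suc k) \<psi> x) (at x)" for k x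
    using test_functions_continuous(2)[OF test_functions_funpow_deriv] assms by auto
  have eq: "(deriv ^^ k) (\<lambda>x. \<phi> x - c * \<psi> x) = (\<lambda>x. (deriv ^^ k) \<phi> x - c * (deriv ^^ k) \<psi> x)" for k
  proof (induction k)
    case (Suc k)
    have "deriv (\<lambda>x. (deriv ^^ k) \<phi> x - c * (deriv ^^ k) \<psi> x) x
        = (deriv ^^ Suc k) \<phi> x - c * (deriv ^^ Suc k) \<psi> x" for x
      by (rule DERIV_imp_deriv) (intro DERIV_diff DERIV_cmult D)
    then show ?case by (simp add: Suc)
  qed simp
  have "(deriv ^^ k) (\<lambda>x. \<phi> x - c * \<psi> x) differentiable (at x)" for k x
    unfolding eq real_differentiable_def by (rule exI, rule DERIV_diff[OF D(1) DERIV_cmult[OF D(2)]])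
  moreover
  have sub: "closure {x. \<phi> x - c * \<psi> x \<noteq> 0} \<subseteq> closure {x. \<phi> x \<noteq> 0} \<union> closure {x. \<psi> x \<noteq> 0}"
    unfolding closure_Un[symmetric] by (rule closure_mono) auto
  moreover have "compact (closure {x. \<phi> x \<noteq> 0} \<union> closure {x. \<psi> x \<noteq> 0})"
    using assms by (auto simp: test_functions_def)
  then have "compact (closure {x. \<phi> x - c * \<psi> x \<noteq> 0})"
    using sub by (meson bounded_subset closed_closure compact_eq_bounded_closed)
  ultimately show ?thesis using assms unfolding test_functions_def by blast
qed

subsection \<open>Locally integrable functions\<close>

lemma set_integrable_mult_continuous:
  fixes f g :: "real \<Rightarrow> real"
  assumes "set_integrable lebesgue {a..b} f" "continuous_on {a..b} g"
  shows "set_integrable lebesgue {a..b} (\<lambda>x. f x * g x)"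
proof -
  have "(\<lambda>x. g x * f x) absolutely_integrable_on {a..b}"
    using assms
    by (intro absolutely_integrable_bounded_measurable_product_real
        continuous_imp_measurable_on_sets_lebesgue)
      (auto intro: compact_imp_bounded compact_continuous_image)
  then show ?thesis by (simp add: mult.commute)
qed

text \<open>Integrals here refer to the completed measure, while the Dynkin argument and uniqueness
  of densities live on Borel sets; this is the passage to a Borel representative.\<close>

lemma set_lebesgue_integral_lborel_eq:
  fixes f g :: "real \<Rightarrow> real"
  assumes "AE x in lebesgue. f x = g x" "g \<in> borel_measurable borel" "f \<in> borel_measurable lebesgue"
    "A \<in> sets borel"
  shows "(LINT x:A|lborel. g x) = (LINT x:A|lebesgue. f x)"
proof -
  have [measurable]: "f \<in> borel_measurable lebesgue" "g \<in> borel_measurable borel" "A \<in> sets borel"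
    using assms by auto
  have gl: "g \<in> borel_measurable lebesgue" using assms(2) by (simp add: measurable_completion)
  have Al: "A \<in> sets lebesgue" using assms(4) by auto
  have "(LINT x:A|lborel. g x) = (LINT x:A|lebesgue. g x)"
    unfolding set_lebesgue_integral_def by (rule integral_completion[symmetric]) measurable
  also have "\<dots> = (LINT x:A|lebesgue. f x)"
    unfolding set_lebesgue_integral_def
    by (rule integral_cong_AE)
      (use assms(1) borel_measurable_times[OF borel_measurable_indicator[OF Al] gl]
        borel_measurable_times[OF borel_measurable_indicator[OF Al] assms(3)] in auto)
  finally show ?thesis .
qed

text \<open>Half-lines form an intersection-stable generator of the Borel sets, so vanishing
  integrals over them force vanishing integrals over all Borel sets, and such a density is zero
  almost everywhere.\<close>

lemma AE_zero_if_primitive_zero: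
  fixes h :: "real \<Rightarrow> real"
  assumes int: "set_integrable lebesgue {a..b} h"
    and zero: "\<And>x. x \<in> {a..b} \<Longrightarrow> (LINT t:{a..x}|lebesgue. h t) = 0"
  shows "AE x in lebesgue. x \<in> {a..b} \<longrightarrow> h x = 0"
proof (cases "a \<le> b")
  case True
  define H where "H = (\<lambda>x. indicator {a..b} x *\<^sub>R h x)"
  have Hi: "integrable lebesgue H" using int by (simp add: H_def set_integrable_def)
  then obtain g where g: "g \<in> borel_measurable lborel" "AE x in lborel. H x = g x"
    using completion_ex_borel_measurable_real by blast
  have g': "AE x in lebesgue. H x = g x" using g(2) by (rule AE_completion)
  have eq: "(LINT x:A|lborel. g x) = (LINT x:A|lebesgue. H x)" if "A \<in> sets borel" for A
    using set_lebesgue_integral_lborel_eq[OF g' _ _ that] g(1) Hi by auto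
  have "integrable lebesgue g"
    using Hi g g' by (subst integrable_cong_AE[of _ _ H]) (auto simp: measurable_completion)
  then have gi: "integrable lborel g" using integrable_completion[OF g(1)] by simp
  have basic: "(LINT t:{..x}|lborel. g t) = 0" for x
  proof -
    have "(LINT t:{..x}|lborel. g t) = (LINT t:{a..min x b}|lebesgue. h t)"
      unfolding eq[OF atMost_borel] unfolding set_lebesgue_integral_def H_def
      by (rule Bochner_Integration.integral_cong) (auto simp: indicator_def)
    also have "\<dots> = 0"
    proof (cases "a \<le> min x b")
      case False
      then show ?thesis by (simp add: set_lebesgue_integral_def)
    qed (rule zero, simp)
    finally show ?thesis .
  qed
  \<comment> \<open>The total integral is what the closure under complements needs.\<close>
  have UN: "(LINT t|lborel. g t) = 0"
  proof -
    have UNIV: "UNIV \<in> sets (borel :: real measure)" by simp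
    have "(LINT t:UNIV|lborel. g t) = (LINT t:{..b}|lborel. g t)"
      unfolding eq[OF atMost_borel] eq[OF UNIV] unfolding set_lebesgue_integral_def H_def
      by (rule Bochner_Integration.integral_cong) (auto simp: indicator_def)
    then show ?thesis unfolding basic by (simp add: set_lebesgue_integral_def)
  qed
  have meas: "A \<in> sets borel" if "A \<in> sigma_sets UNIV (range (\<lambda>a::real. {..a}))" for A
    using that by (simp add: borel_eq_atMost sets_measure_of)
  have Int_stable_atMost: "Int_stable (range (\<lambda>a::real. {..a}))"
    unfolding Int_stable_def by auto
  have sub_Pow: "range (\<lambda>a::real. {..a}) \<subseteq> Pow UNIV" by simp
  have all: "(LINT t:A|lborel. g t) = 0" if "A \<in> sigma_sets UNIV (range (\<lambda>a::real. {..a}))" for A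
    using Int_stable_atMost sub_Pow that
  proof (induction rule: sigma_sets_induct_disjoint)
    case (basic A)
    then show ?case using \<open>\<And>x. (LINT t:{..x}|lborel. g t) = 0\<close> by auto
  next
    case empty
    then show ?case by (simp add: set_lebesgue_integral_def)
  next
    case (compl A)
    note A = meas[OF compl(1)]
    have si: "set_integrable lborel B g" if "B \<in> sets borel" for B
      using gi that unfolding set_integrable_def by (intro integrable_mult_indicator) auto
    have "(LINT t:A \<union> (UNIV - A)|lborel. g t) = (LINT t:A|lborel. g t) + (LINT t:UNIV - A|lborel. g t)"
      by (rule set_integral_Un) (use A si in auto)
    moreover have "A \<union> (UNIV - A) = UNIV" by auto
    ultimately show ?case using UN compl by (simp add: set_lebesgue_integral_def)
  next
    case (union A)
    have A: "A i \<in> sets borel" for i using union meas by blast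
    have "(LINT t:(\<Union>i. A i)|lborel. g t) = (\<Sum>i. (LINT t:A i|lborel. g t))"
    proof (rule lebesgue_integral_countable_add)
      show "set_integrable lborel (\<Union>i. A i) g"
        using gi A unfolding set_integrable_def by (intro integrable_mult_indicator) auto
    qed (use A union(1) in \<open>auto simp: disjoint_family_on_def\<close>)
    then show ?case using union by simp
  qed
  have "AE x in lborel. g x = 0"
    by (rule density_unique_real[OF gi]) (use all in \<open>auto simp: borel_eq_atMost set_lebesgue_integral_def\<close>)
  then have "AE x in lebesgue. g x = 0" by (rule AE_completion)
  with g' have "AE x in lebesgue. H x = 0" by eventually_elim simp
  then show ?thesis by eventually_elim (auto simp: H_def)
qed simp

lemma L1_locD: "f \<in> L1_loc S \<Longrightarrow> {a..b} \<subseteq> S \<Longrightarrow> set_integrable lebesgue {a..b} f" for a b :: real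
  by (auto simp: L1_loc_def)

lemma L1_loc_cmult: "f \<in> L1_loc S \<Longrightarrow> (\<lambda>x. c * f x) \<in> L1_loc S"
  by (auto simp: L1_loc_def)

lemma L1_loc_diff: "f \<in> L1_loc S \<Longrightarrow> g \<in> L1_loc S \<Longrightarrow> (\<lambda>x. f x - g x) \<in> L1_loc S"
  by (auto simp: L1_loc_def intro!: set_integral_diff)

lemma L1_loc_continuous: "continuous_on S f \<Longrightarrow> f \<in> L1_loc S" for f :: "real \<Rightarrow> real"
proof -
  assume f: "continuous_on S f"
  have "set_integrable lebesgue K f" if K: "compact K" "K \<subseteq> S" for K
  proof -
    have i: "integrable lborel (\<lambda>x. indicator K x *\<^sub>R f x)"
      by (rule borel_integrable_compact[OF K(1) continuous_on_subset[OF f K(2)]])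
    show ?thesis
      unfolding set_integrable_def
      using integrable_completion[OF borel_measurable_integrable[OF i]] i by simp
  qed
  then show ?thesis by (auto simp: L1_loc_def)
qed

locale open_interval =
  fixes S :: "real set"
  assumes open_S: "open S" and interval_S: "is_interval S" and nonempty_S: "S \<noteq> {}"
begin

lemmas compact_subset = compact_subset_open_interval[OF open_S interval_S nonempty_S]
lemmas support = test_functions_support[OF open_S interval_S nonempty_S]

lemma mult_test:
  assumes f: "f \<in> L1_loc S" and \<phi>: "continuous_on {\<alpha>..\<beta>} \<phi>"
    and ab: "{\<alpha>..\<beta>} \<subseteq> S" "\<And>x. x \<notin> {\<alpha><..<\<beta>} \<Longrightarrow> \<phi> x = 0"
  shows "set_integrable lebesgue S (\<lambda>x. f x * \<phi> x)"
    "(LINT x:S|lebesgue. f x * \<phi> x) = (LINT x:{\<alpha>..\<beta>}|lebesgue. f x * \<phi> x)"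
proof -
  have eq: "(\<lambda>x. indicator S x *\<^sub>R (f x * \<phi> x)) = (\<lambda>x. indicator {\<alpha>..\<beta>} x *\<^sub>R (f x * \<phi> x))"
    using ab by (fastforce simp: indicator_def)
  show "set_integrable lebesgue S (\<lambda>x. f x * \<phi> x)"
    using set_integrable_mult_continuous[OF L1_locD[OF f ab(1)] \<phi>]
    unfolding set_integrable_def eq .
  show "(LINT x:S|lebesgue. f x * \<phi> x) = (LINT x:{\<alpha>..\<beta>}|lebesgue. f x * \<phi> x)"
    unfolding set_lebesgue_integral_def eq ..
qed

lemma integrable_mult_test:
  assumes "f \<in> L1_loc S" "\<phi> \<in> test_functions S"
  shows "set_integrable lebesgue S (\<lambda>x. f x * \<phi> x)"
  using support[OF assms(2)] mult_test[OF assms(1)] test_functions_continuous[OF assms(2)]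
  by metis

text \<open>Testing with \<^term>\<open>bump n \<alpha> \<beta>\<close>, which tends to the indicator of the open interval, shows that
  all integrals over intervals vanish.\<close>

lemma fundamental_lemma:
  assumes h: "h \<in> L1_loc S"
    and zero: "\<And>\<phi>. \<phi> \<in> test_functions S \<Longrightarrow> (LINT x:S|lebesgue. h x * \<phi> x) = 0"
  shows "AE x in lebesgue. x \<in> S \<longrightarrow> h x = 0"
proof -
  have int0: "(LINT x:{a..b}|lebesgue. h x) = 0" if ab: "{a..b} \<subseteq> S" for a b
  proof -
    have hi: "set_integrable lebesgue {a..b} h" using L1_locD[OF h ab] .
    have "(\<lambda>n. LINT x:{a..b}|lebesgue. h x * bump n a b x)
        \<longlonglongrightarrow> (LINT x:{a..b}|lebesgue. h x * indicator {a<..<b} x)"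
      unfolding set_lebesgue_integral_def
    proof (rule integral_dominated_convergence)
      show "integrable lebesgue (\<lambda>x. norm (indicator {a..b} x *\<^sub>R h x))"
        using hi unfolding set_integrable_def by (rule integrable_norm)
      have m: "(\<lambda>x. indicator {a..b} x *\<^sub>R h x) \<in> borel_measurable lebesgue"
        using hi unfolding set_integrable_def by (rule borel_measurable_integrable)
      have i: "(\<lambda>x. indicator {a<..<b} x :: real) \<in> borel_measurable lebesgue"
        by (rule borel_measurable_indicator) auto
      show "(\<lambda>x. indicat_real {a..b} x *\<^sub>R (h x * indicat_real {a<..<b} x)) \<in> borel_measurable lebesgue"
        using borel_measurable_times[OF m i] by (simp add: mult.assoc)
      have c: "bump n a b \<in> borel_measurable lebesgue" for n
        using test_functions_continuous(1)[OF bump_test[OF ab]]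
        by (intro measurable_completion) (simp add: borel_measurable_continuous_onI)
      show "(\<lambda>x. indicat_real {a..b} x *\<^sub>R (h x * bump n a b x)) \<in> borel_measurable lebesgue" for n
        using borel_measurable_times[OF m c[of n]] by (simp add: mult.assoc)
      show "AE x in lebesgue. (\<lambda>n. indicat_real {a..b} x *\<^sub>R (h x * bump n a b x))
          \<longlonglongrightarrow> indicat_real {a..b} x *\<^sub>R (h x * indicat_real {a<..<b} x)"
        by (intro AE_I2 tendsto_intros bump_tendsto)
      show "AE x in lebesgue. norm (indicat_real {a..b} x *\<^sub>R (h x * bump n a b x))
          \<le> norm (indicat_real {a..b} x *\<^sub>R h x)" for n
      proof (rule AE_I2)
        fix x show "norm (indicat_real {a..b} x *\<^sub>R (h x * bump n a b x))
          \<le> norm (indicat_real {a..b} x *\<^sub>R h x)"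
          using bump_bounds[of n a b x] mult_left_le[of "bump n a b x" "\<bar>h x\<bar>"]
          by (auto simp: indicator_def abs_mult)
      qed
    qed
    moreover have "(LINT x:{a..b}|lebesgue. h x * bump n a b x) = 0" for n
      using zero[OF bump_test[OF ab, of n]]
        mult_test(2)[OF h test_functions_continuous(1)[OF bump_test[OF ab, of n]] ab bump_outside]
      by simp
    ultimately have "(\<lambda>n::nat. 0) \<longlonglongrightarrow> (LINT x:{a..b}|lebesgue. h x * indicator {a<..<b} x)"
      by simp
    then have "(LINT x:{a..b}|lebesgue. h x * indicator {a<..<b} x) = 0"
      by (simp add: LIMSEQ_const_iff)
    moreover have "(LINT x:{a..b}|lebesgue. h x * indicator {a<..<b} x) = (LINT x:{a<..<b}|lebesgue. h x)"
      unfolding set_lebesgue_integral_def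
      by (rule Bochner_Integration.integral_cong) (auto simp: indicator_def)
    moreover have "(LINT x:{a..b}|lebesgue. h x) = integral {a..b} h"
      using set_lebesgue_integral_eq_integral(2)[OF hi] .
    moreover have "(LINT x:{a<..<b}|lebesgue. h x) = integral {a<..<b} h"
      by (rule set_lebesgue_integral_eq_integral(2))
        (use hi absolutely_integrable_on_Icc_iff_Ioo in blast)
    ultimately show ?thesis using integral_open_interval_real[of a b h] by simp
  qed
  have *: "AE x in lebesgue. x \<in> {a..b} \<longrightarrow> h x = 0" if "{a..b} \<subseteq> S" for a b
    using that by (intro AE_zero_if_primitive_zero L1_locD[OF h] int0) auto
  \<comment> \<open>The closed intervals inside \<open>S\<close> with rational end points cover
    \<open>S\<close> and are countably many, so their exceptional null sets can be united.\<close>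
  have "AE x in lebesgue. \<forall>p q :: rat. {of_rat p..of_rat q} \<subseteq> S \<longrightarrow>
      x \<in> {of_rat p..of_rat q} \<longrightarrow> h x = 0"
    unfolding AE_all_countable
  proof (intro allI)
    fix p q :: rat
    show "AE x in lebesgue. {of_rat p..of_rat q} \<subseteq> S \<longrightarrow> x \<in> {of_rat p..of_rat q} \<longrightarrow> h x = 0"
      by (cases "{of_rat p..of_rat q} \<subseteq> S") (simp_all add: * del: atLeastAtMost_iff)
  qed
  then show ?thesis
  proof eventually_elim
    case (elim x)
    show ?case
    proof
      assume "x \<in> S"
      then obtain e where e: "e > 0" "ball x e \<subseteq> S" by (rule openE[OF open_S])
      obtain p where p: "x - e < of_rat p" "of_rat p < x"
        using of_rat_dense[of "x - e" x] e by auto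
      obtain q where q: "x < of_rat q" "of_rat q < x + e"
        using of_rat_dense[of x "x + e"] e by auto
      have "{of_rat p..of_rat q} \<subseteq> ball x e" using p q by (auto simp: dist_real_def)
      moreover have "x \<in> {of_rat p..of_rat q}" using p q by auto
      ultimately show "h x = 0" using elim[rule_format, of p q] e(2) by blast
    qed
  qed
qed

text \<open>Du Bois-Reymond: subtracting a multiple of a fixed bump of integral one turns a test function
  into the derivative of a test function.\<close>

lemma const_lemma:
  assumes h: "h \<in> L1_loc S"
    and zero: "\<And>\<phi>. \<phi> \<in> test_functions S \<Longrightarrow> (LINT x:S|lebesgue. h x * deriv \<phi> x) = 0"
  shows "\<exists>C. AE x in lebesgue. x \<in> S \<longrightarrow> h x = C"
proof -
  obtain \<alpha> \<beta> where ab: "\<alpha> < \<beta>" "{\<alpha>..\<beta>} \<subseteq> S" using compact_subset[of "{}"] by auto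
  define b where "b = bump 0 \<alpha> \<beta>"
  have b: "b \<in> test_functions S" unfolding b_def by (rule bump_test[OF ab(2)])
  note bc = test_functions_continuous(1)[OF b]
  have bout: "b x = 0" if "x \<notin> {\<alpha><..<\<beta>}" for x using bump_outside[OF that] by (simp add: b_def)
  define m where "m = integral {\<alpha>..\<beta>} b"
  \<comment> \<open>If \<open>h\<close> is constant almost everywhere, testing with \<open>b\<close>
    forces the constant to be this quotient.\<close>
  define C where "C = (LINT x:S|lebesgue. h x * b x) / m"
  have m: "m \<noteq> 0"
  proof
    assume "m = 0"
    then have "(b has_integral 0) (cbox \<alpha> \<beta>)"
      using integrable_continuous_real[OF bc] unfolding m_def
      by (metis cbox_interval integrable_integral)
    then have "b ((\<alpha>+\<beta>)/2) = 0"
      using has_integral_0_cbox_imp_0[of \<alpha> \<beta> b] bc ab(1) bump_bounds(1) by (auto simp: b_def)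
    moreover have "b ((\<alpha>+\<beta>)/2) > 0" unfolding b_def by (rule bump_pos) (use ab in auto)
    ultimately show False by simp
  qed
  have "AE x in lebesgue. x \<in> S \<longrightarrow> h x - C = 0"
  proof (rule fundamental_lemma)
    show "(\<lambda>x. h x - C) \<in> L1_loc S" by (intro L1_loc_diff h L1_loc_continuous continuous_intros)
    fix \<phi> assume \<phi>: "\<phi> \<in> test_functions S"
    note \<phi>c = test_functions_continuous(1)[OF \<phi>]
    obtain p0 q0 where pq0: "p0 < q0" "{p0..q0} \<subseteq> S" "\<And>x. x \<notin> {p0<..<q0} \<Longrightarrow> \<phi> x = 0"
      using support[OF \<phi>] by metis
    obtain p q where pq: "p < q" "{p0..q0} \<union> {\<alpha>..\<beta>} \<subseteq> {p<..<q}" "{p..q} \<subseteq> S"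
      using compact_subset[of "{p0..q0} \<union> {\<alpha>..\<beta>}"] pq0(2) ab(2)
      by (metis Un_least compact_Icc compact_Un)
    have sub: "p < p0" "q0 < q" "p < \<alpha>" "\<beta> < q" using pq(2) pq0(1) ab(1) by (simp_all add: subset_iff)
    have out: "\<phi> x = 0" "b x = 0" if "x \<le> p \<or> x \<ge> q" for x
      using that sub pq0(3)[of x] bout[of x] by auto
    have mpq: "integral {p..q} b = m"
    proof -
      have "integral {p..q} b = integral {p..q} (\<lambda>x. if x \<in> {\<alpha>..\<beta>} then b x else 0)"
        using bout by (intro Henstock_Kurzweil_Integration.integral_cong) auto
      also have "\<dots> = integral ({\<alpha>..\<beta>} \<inter> {p..q}) b" by (rule integral_restrict_Int)
      also have "{\<alpha>..\<beta>} \<inter> {p..q} = {\<alpha>..\<beta>}" using sub by auto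
      finally show ?thesis by (simp add: m_def)
    qed
    define I where "I = integral {p..q} \<phi>"
    define w where "w x = \<phi> x - I / m * b x" for x
    have wt: "w \<in> test_functions S"
      using test_functions_diff_cmult[OF \<phi> b, of "I / m"] unfolding w_def[abs_def] .
    have wc: "continuous_on A w" for A by (rule test_functions_continuous(1)[OF wt])
    have "isCont w x" for x using wc[of UNIV] by (simp add: continuous_on_eq_continuous_at)
    then obtain X where X: "\<And>x. (X has_real_derivative w x) (at x)"
      using einterval_antiderivative[of "-\<infinity>" "\<infinity>" w]
      by (auto simp: has_real_derivative_iff_has_vector_derivative)
    define V where "V x = X x - X p" for x
    have V: "(V has_real_derivative w x) (at x)" for x
      unfolding V_def by (auto intro!: derivative_eq_intros X)
    then have dV: "deriv V = w" by (auto simp: DERIV_imp_deriv)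
    have "(w has_integral (V q - V p)) {p..q}"
      using pq(1) V by (intro fundamental_theorem_of_calculus)
        (auto simp: has_real_derivative_iff_has_vector_derivative intro: has_vector_derivative_at_within)
    moreover have "(w has_integral (I - I / m * m)) {p..q}"
    proof -
      have 1: "(\<phi> has_integral I) {p..q}"
        unfolding I_def by (rule integrable_integral[OF integrable_continuous_real[OF \<phi>c]])
      have 2: "(b has_integral m) {p..q}"
        unfolding mpq[symmetric] by (rule integrable_integral[OF integrable_continuous_real[OF bc]])
      show ?thesis
        unfolding w_def by (rule has_integral_diff[OF 1 has_integral_mult_right[OF 2]])
    qed
    ultimately have "V q - V p = I - I / m * m" by (rule has_integral_unique)
    then have "V q - V p = 0" using m by simp
    then have Vq: "V q = 0" by (simp add: V_def)
    have w0: "w x = 0" if "x \<le> p \<or> x \<ge> q" for x using out[OF that] by (simp add: w_def)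
    have V0: "V x = 0" if "x \<notin> {p..q}" for x
    proof (cases "x \<le> p")
      case True
      have "V x = V p"
        using has_field_derivative_zero_constant[of "{..p}" V] V w0 True
        by (metis atMost_iff convex_real_interval(2) has_field_derivative_at_within order_refl)
      then show ?thesis by (simp add: V_def)
    next
      case False
      then have "x \<ge> q" using that by simp
      then have "V x = V q"
        using has_field_derivative_zero_constant[of "{q..}" V] V w0
        by (metis atLeast_iff convex_real_interval(1) has_field_derivative_at_within order_refl)
      then show ?thesis by (simp add: Vq)
    qed
    have "V \<in> test_functions S"
    proof (rule test_functionsI[OF _ V0 pq(3)])
      show "(deriv ^^ k) V differentiable (at x)" for k x
      proof (cases k)
        case 0
        then show ?thesis using V by (auto simp: real_differentiable_def)
      next
        case (Suc j)
        then have "(deriv ^^ k) V = (deriv ^^ j) w" by (simp add: funpow_swap1 dV)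
        then show ?thesis using wt by (simp add: test_functions_def)
      qed
    qed
    from zero[OF this] have "(LINT x:S|lebesgue. h x * w x) = 0" by (simp add: dV)
    moreover have "(LINT x:S|lebesgue. h x * w x)
        = (LINT x:S|lebesgue. h x * \<phi> x) - (LINT x:S|lebesgue. (I / m) * (h x * b x))"
      unfolding set_integral_diff(2)[OF integrable_mult_test[OF h \<phi>]
          set_integrable_mult_right[OF integrable_mult_test[OF h b]], symmetric]
      by (simp add: w_def algebra_simps)
    ultimately have 1: "(LINT x:S|lebesgue. h x * \<phi> x) = I * C"
      using m by (simp add: C_def)
    have one: "(\<lambda>x. 1) \<in> L1_loc S" by (intro L1_loc_continuous continuous_intros)
    have "(LINT x:S|lebesgue. 1 * \<phi> x) = (LINT x:{p..q}|lebesgue. 1 * \<phi> x)"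
      using out by (intro mult_test(2)[OF one \<phi>c pq(3)]) auto
    also have "\<dots> = I"
      unfolding I_def using set_lebesgue_integral_eq_integral(2)[OF L1_locD[OF L1_loc_continuous[OF \<phi>c[of UNIV]]], of p q]
      by simp
    finally have 2: "(LINT x:S|lebesgue. \<phi> x) = I" by simp
    have "(LINT x:S|lebesgue. (h x - C) * \<phi> x)
        = (LINT x:S|lebesgue. h x * \<phi> x) - (LINT x:S|lebesgue. C * (1 * \<phi> x))"
      unfolding set_integral_diff(2)[OF integrable_mult_test[OF h \<phi>]
          set_integrable_mult_right[OF integrable_mult_test[OF one \<phi>]], symmetric]
      by (simp add: algebra_simps)
    then show "(LINT x:S|lebesgue. (h x - C) * \<phi> x) = 0" using 1 2 by simp
  qed
  then show ?thesis by (intro exI[of _ C]) (auto elim: eventually_mono)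
qed

end

subsection \<open>Absolutely continuous functions\<close>

text \<open>Local absolute continuity in integrated form. Carrying the density \<open>g\<close>
  along avoids any statement about pointwise differentiability of \<open>f\<close>.\<close>

definition primitive_on :: "real set \<Rightarrow> (real \<Rightarrow> real) \<Rightarrow> (real \<Rightarrow> real) \<Rightarrow> bool" where
  "primitive_on S f g \<longleftrightarrow> g \<in> L1_loc S \<and> (\<forall>x\<in>S. \<forall>y\<in>S. x \<le> y \<longrightarrow> f y - f x = integral {x..y} g)"

lemma L1_loc_subset: "f \<in> L1_loc S \<Longrightarrow> T \<subseteq> S \<Longrightarrow> f \<in> L1_loc T"
  unfolding L1_loc_def by blast

lemma primitive_on_subset: "primitive_on S f g \<Longrightarrow> T \<subseteq> S \<Longrightarrow> primitive_on T f g"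
  unfolding primitive_on_def using L1_loc_subset by blast

lemma L1_loc_integrable_on: "g \<in> L1_loc S \<Longrightarrow> {a..b} \<subseteq> S \<Longrightarrow> g integrable_on {a..b}" for a b :: real
  using L1_locD set_lebesgue_integral_eq_integral(1) by blast

lemma primitive_on_continuous:
  assumes "primitive_on {a..b} f g"
  shows "continuous_on {a..b} f"
proof -
  have "continuous_on {a..b} (\<lambda>x. f a + integral {a..x} g)"
    using assms L1_loc_integrable_on[of g "{a..b}" a b]
    by (intro continuous_intros indefinite_integral_continuous_1) (auto simp: primitive_on_def)
  moreover have "f a + integral {a..x} g = f x" if "x \<in> {a..b}" for x
  proof -
    have "f x - f a = integral {a..x} g" using assms that by (auto simp: primitive_on_def)
    then show ?thesis by simp
  qed
  ultimately show ?thesis by (metis (no_types, lifting) continuous_on_cong)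
qed

lemma primitive_on_C1:
  fixes f f' :: "real \<Rightarrow> real"
  assumes f: "\<And>x. x \<in> S \<Longrightarrow> (f has_real_derivative f' x) (at x within S)" and c: "continuous_on S f'"
    and S: "is_interval S"
  shows "primitive_on S f f'"
proof -
  have "f y - f x = integral {x..y} f'" if "x \<in> S" "y \<in> S" "x \<le> y" for x y
  proof -
    have sub: "{x..y} \<subseteq> S"
      using mem_is_interval_1_I[OF S that(1,2)] by (auto simp: subset_iff)
    have "(f' has_integral f y - f x) {x..y}"
    proof (rule fundamental_theorem_of_calculus[OF that(3)])
      fix t assume "t \<in> {x..y}"
      then show "(f has_vector_derivative f' t) (at t within {x..y})"
        using DERIV_subset[OF f[of t] sub] sub
        by (auto simp: has_real_derivative_iff_has_vector_derivative[symmetric])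
    qed
    then show ?thesis by (simp add: integral_unique)
  qed
  then show ?thesis unfolding primitive_on_def by (auto intro: L1_loc_continuous c)
qed

text \<open>The bound is additive over adjacent intervals, so it suffices to cut [a, b] into equal
  pieces shorter than \<delta>.\<close>

lemma increment_bound:
  fixes Q M :: "real \<Rightarrow> real"
  assumes ab: "a \<le> b" and d: "\<delta> > 0"
    and step: "\<And>x y. a \<le> x \<Longrightarrow> x \<le> y \<Longrightarrow> y \<le> b \<Longrightarrow> y - x < \<delta> \<Longrightarrow> \<bar>Q y - Q x\<bar> \<le> M y - M x"
  shows "\<bar>Q b - Q a\<bar> \<le> M b - M a"
proof -
  obtain N :: nat where N: "(b - a) / \<delta> < real N" using reals_Archimedean2 by blast
  have N0: "N > 0"
  proof (rule ccontr)
    assume "\<not> 0 < N"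
    then have "(b - a) / \<delta> < 0" using N by simp
    moreover have "(b - a) / \<delta> \<ge> 0" using ab d by simp
    ultimately show False by linarith
  qed
  define s where "s = (b - a) / N"
  have s: "0 \<le> s" "s < \<delta>" using N N0 ab d by (auto simp: s_def field_simps)
  have Ns: "real N * s = b - a" using N0 by (simp add: s_def)
  have "k \<le> N \<Longrightarrow> \<bar>Q (a + k * s) - Q a\<bar> \<le> M (a + k * s) - M a" for k :: nat
  proof (induction k)
    case (Suc k)
    have "real (Suc k) * s \<le> real N * s" using Suc.prems s by (intro mult_right_mono) auto
    then have "\<bar>Q (a + Suc k * s) - Q (a + k * s)\<bar> \<le> M (a + Suc k * s) - M (a + k * s)"
      using s Ns by (intro step) (auto simp: algebra_simps)
    moreover have "\<bar>Q (a + k * s) - Q a\<bar> \<le> M (a + k * s) - M a" using Suc by simp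
    ultimately show ?case by linarith
  qed simp
  from this[of N] show ?thesis using Ns by simp
qed

text \<open>Over a short interval the defect in the product rule is small compared with the integral
  of \<^term>\<open>\<lambda>t. \<bar>k t\<bar> + \<bar>g t\<bar>\<close>, because \<^term>\<open>f\<close> and \<^term>\<open>h\<close> are uniformly continuous.\<close>

lemma integration_by_parts_primitive:
  assumes f: "primitive_on {a..b} f g" and h: "primitive_on {a..b} h k" and ab: "a \<le> b"
  shows "f b * h b - f a * h a = integral {a..b} (\<lambda>t. f t * k t + g t * h t)"
proof -
  have fc: "continuous_on {a..b} f" and hc: "continuous_on {a..b} h"
    using f h primitive_on_continuous by auto
  have g': "set_integrable lebesgue {a..b} g" and k': "set_integrable lebesgue {a..b} k"
    using f h L1_locD[of _ "{a..b}"] by (auto simp: primitive_on_def)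
  have sub: "set_integrable lebesgue {x..y} F" if "set_integrable lebesgue {a..b} F" "a \<le> x" "y \<le> b"
    for F :: "real \<Rightarrow> real" and x y
    using that by (intro set_integrable_subset[OF that(1)]) auto
  note io = set_lebesgue_integral_eq_integral(1)
  define P where "P t = f t * k t + g t * h t" for t
  have P: "set_integrable lebesgue {a..b} P"
    unfolding P_def
    using set_integral_add(1)[OF set_integrable_mult_continuous[OF k' fc] set_integrable_mult_continuous[OF g' hc]]
    by (simp add: mult.commute)
  define m where "m t = \<bar>k t\<bar> + \<bar>g t\<bar>" for t
  have m: "set_integrable lebesgue {a..b} m"
    unfolding m_def using set_integral_add(1)[OF set_integrable_abs[OF k'] set_integrable_abs[OF g']] .
  \<comment> \<open>The defect of the product rule; the aim is that it takes the same value at both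
    ends.\<close>
  define Q where "Q x = f x * h x - integral {a..x} P" for x
  have split: "integral {a..y} F - integral {a..x} F = integral {x..y} F"
    if "set_integrable lebesgue {a..b} F" "a \<le> x" "x \<le> y" "y \<le> b"
    for F :: "real \<Rightarrow> real" and x y
    using Henstock_Kurzweil_Integration.integral_combine[of a x y F] io[OF sub[OF that(1), of a y]] that by simp
  have bound: "\<bar>Q b - Q a\<bar> \<le> e * integral {a..b} m" if e: "e > 0" for e
  proof -
    have uf: "uniformly_continuous_on {a..b} f" and uh: "uniformly_continuous_on {a..b} h"
      using fc hc compact_uniformly_continuous by auto
    obtain d1 where d1: "d1 > 0" "\<And>x y. x \<in> {a..b} \<Longrightarrow> y \<in> {a..b} \<Longrightarrow> dist y x < d1 \<Longrightarrow> dist (f y) (f x) < e"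
      using uf e unfolding uniformly_continuous_on_def by meson
    obtain d2 where d2: "d2 > 0" "\<And>x y. x \<in> {a..b} \<Longrightarrow> y \<in> {a..b} \<Longrightarrow> dist y x < d2 \<Longrightarrow> dist (h y) (h x) < e"
      using uh e unfolding uniformly_continuous_on_def by meson
    have "\<bar>Q b - Q a\<bar> \<le> e * integral {a..b} m - e * integral {a..a} m"
    proof (rule increment_bound[OF ab, of "min d1 d2"])
      fix x y assume xy: "a \<le> x" "x \<le> y" "y \<le> b" "y - x < min d1 d2"
      have s: "set_integrable lebesgue {x..y} P" "set_integrable lebesgue {x..y} m"
        "set_integrable lebesgue {x..y} k" "set_integrable lebesgue {x..y} g"
        using sub[OF _ xy(1,3)] P m k' g' by blast+
      have fi: "f y - f x = integral {x..y} g" "h y - h x = integral {x..y} k"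
        using f h xy by (auto simp: primitive_on_def)
      \<comment> \<open>One factor is frozen at each end of the short interval, so that every error
        term is an oscillation of \<open>f\<close> or \<open>h\<close> times \<open>k\<close> or
        \<open>g\<close>.\<close>
      have "Q y - Q x = f x * (h y - h x) + h y * (f y - f x) - integral {x..y} P"
        using split[OF P xy(1-3)] by (simp add: Q_def algebra_simps)
      also have "\<dots> = integral {x..y} (\<lambda>t. f x * k t + h y * g t - P t)"
        unfolding fi using s[THEN io]
        by (simp add: Henstock_Kurzweil_Integration.integral_diff Henstock_Kurzweil_Integration.integral_add integrable_add integrable_on_mult_right integral_mult_right)
      finally have Qe: "Q y - Q x = integral {x..y} (\<lambda>t. f x * k t + h y * g t - P t)" .
      have "norm (integral {x..y} (\<lambda>t. f x * k t + h y * g t - P t)) \<le> integral {x..y} (\<lambda>t. e * m t)"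
      proof (rule integral_norm_bound_integral)
        show "(\<lambda>t. f x * k t + h y * g t - P t) integrable_on {x..y}"
          using s[THEN io] by (intro integrable_diff integrable_add integrable_on_mult_right) auto
        show "(\<lambda>t. e * m t) integrable_on {x..y}" using s(2)[THEN io] by (intro integrable_on_mult_right) auto
        fix t assume t: "t \<in> {x..y}"
        have "\<bar>f x - f t\<bar> \<le> e" using d1(2)[of x t] xy t by (auto simp: dist_real_def abs_minus_commute)
        moreover have "\<bar>h y - h t\<bar> \<le> e" using d2(2)[of y t] xy t by (auto simp: dist_real_def abs_minus_commute)
        ultimately have "\<bar>(f x - f t) * k t\<bar> \<le> e * \<bar>k t\<bar>" "\<bar>(h y - h t) * g t\<bar> \<le> e * \<bar>g t\<bar>"
          by (auto simp: abs_mult intro!: mult_right_mono)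
        moreover have "f x * k t + h y * g t - P t = (f x - f t) * k t + (h y - h t) * g t"
          by (simp add: P_def algebra_simps)
        ultimately show "norm (f x * k t + h y * g t - P t) \<le> e * m t"
          by (simp add: m_def algebra_simps)
      qed
      then show "\<bar>Q y - Q x\<bar> \<le> e * integral {a..y} m - e * integral {a..x} m"
        using Qe split[OF m xy(1-3)] by (simp add: algebra_simps flip: right_diff_distrib)
    qed (use d1 d2 in auto)
    then show ?thesis by simp
  qed
  have "\<bar>Q b - Q a\<bar> \<le> 0"
  proof (rule field_le_epsilon)
    fix e :: real assume e: "e > 0"
    let ?K = "\<bar>integral {a..b} m\<bar> + 1"
    have "\<bar>Q b - Q a\<bar> \<le> (e / ?K) * integral {a..b} m" by (rule bound) (use e in \<open>auto intro!: divide_pos_pos\<close>)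
    also have "\<dots> \<le> (e / ?K) * ?K" by (intro mult_left_mono) (use e in \<open>auto intro!: divide_nonneg_nonneg\<close>)
    also have "\<dots> = e" by simp
    finally show "\<bar>Q b - Q a\<bar> \<le> 0 + e" by simp
  qed
  then have "f b * h b - f a * h a = integral {a..b} P" by (simp add: Q_def)
  then show ?thesis unfolding P_def[abs_def] .
qed

lemma primitive_on_mult:
  assumes "primitive_on {a..b} f g" "primitive_on {a..b} h k"
  shows "primitive_on {a..b} (\<lambda>t. f t * h t) (\<lambda>t. f t * k t + g t * h t)"
proof -
  have g: "g \<in> L1_loc {a..b}" "k \<in> L1_loc {a..b}" using assms by (auto simp: primitive_on_def)
  have "set_integrable lebesgue {a..b} (\<lambda>t. f t * k t + g t * h t)"
    using set_integral_add(1)[OF set_integrable_mult_continuous[OF L1_locD[OF g(2)] primitive_on_continuous[OF assms(1)]]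
      set_integrable_mult_continuous[OF L1_locD[OF g(1)] primitive_on_continuous[OF assms(2)]]]
    by (simp add: mult.commute)
  then have "(\<lambda>t. f t * k t + g t * h t) \<in> L1_loc {a..b}"
    unfolding L1_loc_def using lmeasurable_compact
    by (auto intro!: set_integrable_subset[of lebesgue "{a..b}"])
  moreover have "f y * h y - f x * h x = integral {x..y} (\<lambda>t. f t * k t + g t * h t)"
    if "x \<in> {a..b}" "y \<in> {a..b}" "x \<le> y" for x y
    using that by (intro integration_by_parts_primitive primitive_on_subset[OF assms(1)]
        primitive_on_subset[OF assms(2)]) auto
  ultimately show ?thesis unfolding primitive_on_def by blast
qed

subsection \<open>Weak derivatives on an open interval\<close>

lemma AE_set_integral_cong:
  fixes f g h :: "real \<Rightarrow> real"
  assumes "AE x in lebesgue. x \<in> S \<longrightarrow> f x = g x" "set_integrable lebesgue S f"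
  shows "set_integrable lebesgue S g" "(LINT x:S|lebesgue. g x) = (LINT x:S|lebesgue. f x)"
proof -
  have ae: "AE x in lebesgue. indicator S x *\<^sub>R f x = indicator S x *\<^sub>R g x"
    using assms(1) by eventually_elim (auto simp: indicator_def)
  have m: "(\<lambda>x. indicator S x *\<^sub>R f x) \<in> borel_measurable lebesgue"
    using assms(2) unfolding set_integrable_def by (rule borel_measurable_integrable)
  have m': "(\<lambda>x. indicator S x *\<^sub>R g x) \<in> borel_measurable lebesgue"
    by (rule borel_measurable_AE[OF m ae])
  show "set_integrable lebesgue S g"
    using assms(2) integrable_cong_AE[OF m m' ae] by (simp add: set_integrable_def)
  show "(LINT x:S|lebesgue. g x) = (LINT x:S|lebesgue. f x)"
    unfolding set_lebesgue_integral_def using integral_cong_AE[OF m m' ae] by simp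
qed

lemma L1_loc_cong_AE:
  assumes "AE x in lebesgue. x \<in> S \<longrightarrow> f x = g x" "f \<in> L1_loc S"
  shows "g \<in> L1_loc S"
  unfolding L1_loc_def
proof safe
  fix K assume K: "compact K" "K \<subseteq> S"
  have "AE x in lebesgue. x \<in> K \<longrightarrow> f x = g x" using assms(1) by eventually_elim (use K in auto)
  then show "set_integrable lebesgue K g"
    by (rule AE_set_integral_cong(1)) (use assms(2) K in \<open>auto simp: L1_loc_def\<close>)
qed

context open_interval
begin

lemma weak_deriv_0: "f \<in> L1_loc S \<Longrightarrow> weak_deriv S 0 f f"
  by (simp add: weak_deriv_def)

lemma primitive_on_continuous_on:
  assumes "primitive_on S f g"
  shows "continuous_on S f"
proof (rule continuous_at_imp_continuous_on, safe)
  fix x assume "x \<in> S"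
  then have "compact {x}" "{x} \<subseteq> S" by simp_all
  then obtain \<alpha> \<beta> where *: "\<alpha> < \<beta>" "{x} \<subseteq> {\<alpha><..<\<beta>}" "{\<alpha>..\<beta>} \<subseteq> S"
    by (rule compact_subset)
  have "continuous_on {\<alpha>..\<beta>} f"
    by (rule primitive_on_continuous[OF primitive_on_subset[OF assms *(3)]])
  then show "isCont f x"
    by (rule continuous_on_interior) (use *(2) in simp)
qed

text \<open>Integration by parts on a compact interval whose interior contains the supports of the
  test function and its derivative, so that the boundary terms drop out.\<close>

lemma primitive_on_imp_weak_deriv:
  assumes f: "primitive_on S f g"
  shows "weak_deriv S 1 f g"
proof -
  have fl: "f \<in> L1_loc S" by (rule L1_loc_continuous[OF primitive_on_continuous_on[OF f]])
  have gl: "g \<in> L1_loc S" using f by (simp add: primitive_on_def)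
  have "(LINT x:S|lebesgue. f x * deriv \<phi> x) = - (LINT x:S|lebesgue. g x * \<phi> x)"
    if \<phi>: "\<phi> \<in> test_functions S" for \<phi>
  proof -
    let ?K = "closure {x. \<phi> x \<noteq> 0} \<union> closure {x. deriv \<phi> x \<noteq> 0}"
    have supp: "compact (closure {x. \<psi> x \<noteq> 0})" "closure {x. \<psi> x \<noteq> 0} \<subseteq> S"
      if "\<psi> \<in> test_functions S" for \<psi>
      using that unfolding test_functions_def mem_Collect_eq by argo+
    have "compact ?K" "?K \<subseteq> S"
      by (rule compact_Un, rule supp(1)[OF \<phi>], rule supp(1)[OF test_functions_deriv[OF \<phi>]],
          rule Un_least, rule supp(2)[OF \<phi>], rule supp(2)[OF test_functions_deriv[OF \<phi>]])
    then obtain \<alpha> \<beta> where ab: "\<alpha> < \<beta>" "?K \<subseteq> {\<alpha><..<\<beta>}" "{\<alpha>..\<beta>} \<subseteq> S"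
      by (rule compact_subset)
    have sub: "{x. \<phi> x \<noteq> 0} \<subseteq> ?K" "{x. deriv \<phi> x \<noteq> 0} \<subseteq> ?K"
      by (rule le_supI1[OF closure_subset], rule le_supI2[OF closure_subset])
    have out: "\<phi> x = 0 \<and> deriv \<phi> x = 0" if "x \<notin> {\<alpha><..<\<beta>}" for x
      using that subsetD[OF subset_trans[OF sub(1) ab(2)], of x]
        subsetD[OF subset_trans[OF sub(2) ab(2)], of x] unfolding mem_Collect_eq by argo
    note \<phi>c = test_functions_continuous[OF \<phi>] and \<phi>'c = test_functions_continuous[OF test_functions_deriv[OF \<phi>]]
    have P: "primitive_on {\<alpha>..\<beta>} \<phi> (deriv \<phi>)"
      by (rule primitive_on_C1[OF has_field_derivative_at_within[OF \<phi>c(2)] \<phi>'c(1)]) simp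
    have zero: "\<phi> \<alpha> = 0" "\<phi> \<beta> = 0" using out[of \<alpha>] out[of \<beta>] by auto
    have i: "set_integrable lebesgue {\<alpha>..\<beta>} (\<lambda>t. f t * deriv \<phi> t)" "set_integrable lebesgue {\<alpha>..\<beta>} (\<lambda>t. g t * \<phi> t)"
      by (rule set_integrable_mult_continuous[OF L1_locD[OF fl ab(3)] \<phi>'c(1)],
          rule set_integrable_mult_continuous[OF L1_locD[OF gl ab(3)] \<phi>c(1)])
    have "0 = integral {\<alpha>..\<beta>} (\<lambda>t. f t * deriv \<phi> t + g t * \<phi> t)"
      using integration_by_parts_primitive[OF primitive_on_subset[OF f ab(3)] P less_imp_le[OF ab(1)]]
      unfolding zero mult_zero_right diff_self .
    also have "\<dots> = integral {\<alpha>..\<beta>} (\<lambda>t. f t * deriv \<phi> t) + integral {\<alpha>..\<beta>} (\<lambda>t. g t * \<phi> t)"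
      by (rule Henstock_Kurzweil_Integration.integral_add[OF i[THEN set_lebesgue_integral_eq_integral(1)]])
    finally have 0: "integral {\<alpha>..\<beta>} (\<lambda>t. f t * deriv \<phi> t) = - integral {\<alpha>..\<beta>} (\<lambda>t. g t * \<phi> t)"
      by linarith
    have "(LINT x:S|lebesgue. f x * deriv \<phi> x) = (LINT x:{\<alpha>..\<beta>}|lebesgue. f x * deriv \<phi> x)"
      by (rule mult_test(2)[OF fl \<phi>'c(1) ab(3)]) (drule out, rule conjunct2, assumption)
    also have "\<dots> = integral {\<alpha>..\<beta>} (\<lambda>t. f t * deriv \<phi> t)"
      by (rule set_lebesgue_integral_eq_integral(2)[OF i(1)])
    also have "\<dots> = - integral {\<alpha>..\<beta>} (\<lambda>t. g t * \<phi> t)" by (rule 0)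
    also have "integral {\<alpha>..\<beta>} (\<lambda>t. g t * \<phi> t) = (LINT x:{\<alpha>..\<beta>}|lebesgue. g x * \<phi> x)"
      by (rule set_lebesgue_integral_eq_integral(2)[OF i(2), symmetric])
    also have "\<dots> = (LINT x:S|lebesgue. g x * \<phi> x)"
      by (rule mult_test(2)[OF gl \<phi>c(1) ab(3), symmetric]) (drule out, rule conjunct1, assumption)
    finally show ?thesis .
  qed
  then show ?thesis unfolding weak_deriv_def
    by (intro conjI fl gl ballI) simp
qed

lemma weak_deriv_Suc:
  assumes "weak_deriv S k f g" "weak_deriv S 1 g h"
  shows "weak_deriv S (Suc k) f h"
proof -
  have "(LINT x:S|lebesgue. f x * (deriv ^^ Suc k) \<phi> x) = (-1) ^ Suc k * (LINT x:S|lebesgue. h x * \<phi> x)"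
    if \<phi>: "\<phi> \<in> test_functions S" for \<phi>
  proof -
    have "(LINT x:S|lebesgue. f x * (deriv ^^ Suc k) \<phi> x) = (LINT x:S|lebesgue. f x * (deriv ^^ k) (deriv \<phi>) x)"
      by (simp add: funpow_swap1)
    also have "\<dots> = (-1) ^ k * (LINT x:S|lebesgue. g x * deriv \<phi> x)"
      using assms(1) test_functions_deriv[OF \<phi>] by (simp add: weak_deriv_def)
    also have "(LINT x:S|lebesgue. g x * deriv \<phi> x) = - (LINT x:S|lebesgue. h x * \<phi> x)"
      using assms(2) \<phi> by (simp add: weak_deriv_def)
    finally show ?thesis by simp
  qed
  moreover have "f \<in> L1_loc S" "h \<in> L1_loc S" using assms by (simp_all add: weak_deriv_def)
  ultimately show ?thesis unfolding weak_deriv_def by (intro conjI ballI)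
qed

text \<open>Testing the order \<open>Suc k\<close> identity with a test function is testing the
  order \<open>k\<close> identity with its derivative; the powers of -1 then cancel.\<close>

lemma weak_deriv_1I:
  assumes "weak_deriv S k f g" "weak_deriv S (Suc k) f h"
  shows "weak_deriv S 1 g h"
proof -
  have "(LINT x:S|lebesgue. g x * deriv \<phi> x) = - (LINT x:S|lebesgue. h x * \<phi> x)"
    if \<phi>: "\<phi> \<in> test_functions S" for \<phi>
  proof -
    have "(-1) ^ k * (LINT x:S|lebesgue. g x * deriv \<phi> x)
        = (LINT x:S|lebesgue. f x * (deriv ^^ k) (deriv \<phi>) x)"
      using assms(1) test_functions_deriv[OF \<phi>] by (simp add: weak_deriv_def)
    also have "\<dots> = (-1) ^ Suc k * (LINT x:S|lebesgue. h x * \<phi> x)"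
      using assms(2) \<phi> by (simp add: weak_deriv_def funpow_swap1)
    also have "\<dots> = (-1) ^ k * (- (LINT x:S|lebesgue. h x * \<phi> x))" by simp
    finally show ?thesis by (subst (asm) mult_left_cancel) auto
  qed
  then show ?thesis using assms by (simp add: weak_deriv_def)
qed


lemma weak_deriv_diff:
  assumes "weak_deriv S k f g" "weak_deriv S k f' g'"
  shows "weak_deriv S k (\<lambda>x. f x - f' x) (\<lambda>x. g x - g' x)"
proof -
  have L: "f \<in> L1_loc S" "f' \<in> L1_loc S" "g \<in> L1_loc S" "g' \<in> L1_loc S"
    using assms by (auto simp: weak_deriv_def)
  have "(LINT x:S|lebesgue. (u x - v x) * \<psi> x) = (LINT x:S|lebesgue. u x * \<psi> x) - (LINT x:S|lebesgue. v x * \<psi> x)"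
    if "u \<in> L1_loc S" "v \<in> L1_loc S" "\<psi> \<in> test_functions S" for u v \<psi>
    unfolding set_integral_diff(2)[OF integrable_mult_test[OF that(1,3)] integrable_mult_test[OF that(2,3)], symmetric]
    by (simp add: algebra_simps)
  note key = this
  have "(LINT x:S|lebesgue. (f x - f' x) * (deriv ^^ k) \<phi> x) = (-1) ^ k * (LINT x:S|lebesgue. (g x - g' x) * \<phi> x)"
    if \<phi>: "\<phi> \<in> test_functions S" for \<phi>
  proof -
    have "(LINT x:S|lebesgue. f x * (deriv ^^ k) \<phi> x) = (-1) ^ k * (LINT x:S|lebesgue. g x * \<phi> x)"
      "(LINT x:S|lebesgue. f' x * (deriv ^^ k) \<phi> x) = (-1) ^ k * (LINT x:S|lebesgue. g' x * \<phi> x)"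
      using assms \<phi> unfolding weak_deriv_def by blast+
    then show ?thesis
      unfolding key[OF L(1,2) test_functions_funpow_deriv[OF \<phi>]] key[OF L(3,4) \<phi>]
      by (simp only: right_diff_distrib)
  qed
  then show ?thesis using L1_loc_diff[OF L(1,2)] L1_loc_diff[OF L(3,4)] by (simp add: weak_deriv_def)
qed

lemma weak_deriv_unique:
  assumes "weak_deriv S k f g" "weak_deriv S k f g'"
  shows "AE x in lebesgue. x \<in> S \<longrightarrow> g x = g' x"
proof -
  have "weak_deriv S k (\<lambda>x. f x - f x) (\<lambda>x. g x - g' x)" by (rule weak_deriv_diff[OF assms])
  then have "AE x in lebesgue. x \<in> S \<longrightarrow> g x - g' x = 0"
    by (intro fundamental_lemma) (auto simp: weak_deriv_def set_lebesgue_integral_def)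
  then show ?thesis by eventually_elim auto
qed

lemma weak_deriv_cong:
  assumes "weak_deriv S k f g" "\<And>x. x \<in> S \<Longrightarrow> f x = f' x"
  shows "weak_deriv S k f' g"
proof -
  have "f' \<in> L1_loc S"
    by (rule L1_loc_cong_AE[of _ f]) (use assms in \<open>auto simp: weak_deriv_def\<close>)
  moreover have "(LINT x:S|lebesgue. f' x * \<psi> x) = (LINT x:S|lebesgue. f x * \<psi> x)" for \<psi>
    unfolding set_lebesgue_integral_def using assms(2)
    by (intro Bochner_Integration.integral_cong) (auto simp: indicator_def)
  ultimately show ?thesis using assms(1) by (simp add: weak_deriv_def)
qed

lemma weak_deriv_wderiv:
  assumes "weak_deriv S k f g"
  shows "weak_deriv S k f (wderiv S k f)" "AE x in lebesgue. x \<in> S \<longrightarrow> wderiv S k f x = g x"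
proof -
  show *: "weak_deriv S k f (wderiv S k f)" unfolding wderiv_def by (rule someI[of "weak_deriv S k f", OF assms])
  show "AE x in lebesgue. x \<in> S \<longrightarrow> wderiv S k f x = g x" by (rule weak_deriv_unique[OF * assms])
qed

lemma primitive_ex:
  assumes g: "g \<in> L1_loc S"
  shows "\<exists>f. primitive_on S f g"
proof -
  obtain x0 where x0: "x0 \<in> S" using nonempty_S by auto
  define f where "f x = (if x0 \<le> x then integral {x0..x} g else - integral {x..x0} g)" for x
  have int: "g integrable_on {x..y}" if "x \<in> S" "y \<in> S" for x y
    by (rule L1_loc_integrable_on[OF g])
      (use mem_is_interval_1_I[OF interval_S that] in \<open>auto simp: subset_iff\<close>)
  have "f y - f x = integral {x..y} g" if xy: "x \<in> S" "y \<in> S" "x \<le> y" for x y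
  proof -
    note c = Henstock_Kurzweil_Integration.integral_combine
    consider "x0 \<le> x" | "x < x0" "x0 \<le> y" | "y < x0" by linarith
    then show ?thesis
    proof cases
      case 1 then show ?thesis using c[of x0 x y g] int[OF x0 xy(2)] xy by (simp add: f_def)
    next
      case 2 then show ?thesis using c[of x x0 y g] int[OF xy(1,2)] xy by (simp add: f_def)
    next
      case 3 then show ?thesis using c[of x y x0 g] int[OF xy(1) x0] xy by (simp add: f_def)
    qed
  qed
  then show ?thesis using g unfolding primitive_on_def by blast
qed

text \<open>The difference of \<open>f\<close> and any primitive of \<open>g\<close> has weak
  derivative zero, hence is constant by Du Bois-Reymond.\<close>

lemma weak_deriv_imp_primitive_AE:
  assumes "weak_deriv S 1 f g"
  shows "\<exists>f'. primitive_on S f' g \<and> (AE x in lebesgue. x \<in> S \<longrightarrow> f x = f' x)"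
proof -
  have "g \<in> L1_loc S" using assms by (simp add: weak_deriv_def)
  then obtain p where p: "primitive_on S p g" using primitive_ex by blast
  have w: "weak_deriv S 1 (\<lambda>x. f x - p x) (\<lambda>x. g x - g x)"
    by (rule weak_deriv_diff[OF assms primitive_on_imp_weak_deriv[OF p]])
  then have "\<exists>C. AE x in lebesgue. x \<in> S \<longrightarrow> f x - p x = C"
    by (intro const_lemma) (auto simp: weak_deriv_def set_lebesgue_integral_def)
  then obtain C where C: "AE x in lebesgue. x \<in> S \<longrightarrow> f x - p x = C" by blast
  have "primitive_on S (\<lambda>x. p x + C) g" using p by (simp add: primitive_on_def)
  moreover have "AE x in lebesgue. x \<in> S \<longrightarrow> f x = p x + C" using C by eventually_elim auto
  ultimately show ?thesis by blast
qed

text \<open>A nonempty open set is not negligible, so it is not contained in the exceptional null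
  set.\<close>

lemma AE_imp_dense:
  assumes "AE x in lebesgue. x \<in> S \<longrightarrow> P x" "x \<in> S" "e > 0"
  obtains y where "y \<in> S" "\<bar>y - x\<bar> < e" "P y"
proof -
  have "open (S \<inter> ball x e)" "S \<inter> ball x e \<noteq> {}" using open_S assms(2,3) by auto
  then have n: "\<not> negligible (S \<inter> ball x e)" using open_not_negligible by blast
  obtain N where N: "N \<in> null_sets lebesgue" "{y. \<not> (y \<in> S \<longrightarrow> P y)} \<subseteq> N"
    using assms(1) by (auto simp: eventually_ae_filter)
  have "negligible N" using N(1) by (simp add: negligible_iff_null_sets)
  then have "\<not> S \<inter> ball x e \<subseteq> N" using negligible_subset n by blast
  then obtain y where "y \<in> S" "y \<in> ball x e" "y \<notin> N" by blast
  then show ?thesis using that[of y] N(2) by (auto simp: dist_real_def abs_minus_commute)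
qed

lemma AE_le_continuous:
  assumes "AE x in lebesgue. x \<in> S \<longrightarrow> f x \<le> g x" "continuous_on S f" "continuous_on S g" "x \<in> S"
  shows "f x \<le> (g x :: real)"
proof (rule ccontr)
  assume "\<not> f x \<le> g x"
  moreover have "isCont (\<lambda>y. f y - g y) x"
    using assms open_S by (intro continuous_intros) (auto simp: continuous_on_eq_continuous_at)
  ultimately have "\<exists>d>0. \<forall>y. dist y x < d \<longrightarrow> dist (f y - g y) (f x - g x) < f x - g x"
    unfolding continuous_at_eps_delta by simp
  then obtain d where d: "d > 0" "\<And>y. dist y x < d \<Longrightarrow> dist (f y - g y) (f x - g x) < f x - g x" by blast
  obtain y where "y \<in> S" "\<bar>y - x\<bar> < d" "f y \<le> g y" using AE_imp_dense[OF assms(1,4) d(1)] .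
  then show False using d(2)[of y] by (auto simp: dist_real_def)
qed

text \<open>The absolutely continuous representative equals \<open>f\<close> almost everywhere, and
  two continuous functions that do so agree everywhere.\<close>

lemma weak_deriv_imp_primitive:
  assumes "weak_deriv S 1 f g" "continuous_on S f"
  shows "primitive_on S f g"
proof -
  obtain p where p: "primitive_on S p g" "AE x in lebesgue. x \<in> S \<longrightarrow> f x = p x"
    using weak_deriv_imp_primitive_AE[OF assms(1)] by blast
  have pc: "continuous_on S p" by (rule primitive_on_continuous_on[OF p(1)])
  have "AE x in lebesgue. x \<in> S \<longrightarrow> f x \<le> p x" "AE x in lebesgue. x \<in> S \<longrightarrow> p x \<le> f x"
    using p(2) by (eventually_elim, simp)+
  then have "f x = p x" if "x \<in> S" for x
    using AE_le_continuous assms(2) pc that by (meson order_antisym)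
  then show ?thesis using p(1) by (auto simp: primitive_on_def)
qed

end

subsection \<open>Lipschitz functions have bounded weak derivatives\<close>

interpretation real_line: open_interval UNIV
  by unfold_locales auto

text \<open>The density of the push-forward of Lebesgue measure under the inverse of a bi-Lipschitz
  function is its derivative.\<close>

lemma bilipschitz_primitive:
  fixes F :: "real \<Rightarrow> real"
  assumes m: "m > 0" and lower: "\<And>x y. x \<le> y \<Longrightarrow> m * (y - x) \<le> F y - F x"
    and upper: "\<And>x y. x \<le> y \<Longrightarrow> F y - F x \<le> M * (y - x)"
  shows "\<exists>d. primitive_on UNIV F d \<and> (\<forall>x. 0 \<le> d x)"
proof -
  have sm: "F x < F y" if "x < y" for x y
  proof -
    have "0 < m * (y - x)" using that m by simp
    then show ?thesis using lower[of x y] that by linarith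
  qed
  then have mono: "F x \<le> F y \<longleftrightarrow> x \<le> y" for x y by (metis linorder_not_le order_le_less)
  have inj: "inj F" by (rule injI) (metis mono order_antisym order_refl)
  have lip: "\<bar>F y - F x\<bar> \<le> M * \<bar>y - x\<bar>" for x y
  proof (cases "x \<le> y")
    case True
    then show ?thesis using upper[of x y] mono[of x y] by simp
  next
    case False
    then show ?thesis using upper[of y x] mono[of y x] by simp
  qed
  have cont: "continuous_on A F" for A
  proof (rule continuous_on_subset[OF _ subset_UNIV])
    have "lipschitz_on (max M 0) UNIV F"
    proof (rule lipschitz_onI)
      fix x y show "dist (F x) (F y) \<le> max M 0 * dist x y"
        using lip[of y x] mult_right_mono[of M "max M 0" "\<bar>x - y\<bar>"]
        unfolding dist_real_def by (simp add: abs_minus_commute)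
    qed simp
    then show "continuous_on UNIV F" by (rule lipschitz_on_continuous_on)
  qed
  have surj: "\<exists>x. F x = z" for z
  proof -
    define r where "r = \<bar>z - F 0\<bar> / m"
    have r: "r \<ge> 0" "m * r = \<bar>z - F 0\<bar>" using m by (auto simp: r_def)
    have "F (- r) \<le> z" using lower[of "- r" 0] r by simp
    moreover have "z \<le> F r" using lower[of 0 r] r by simp
    ultimately show ?thesis using IVT'[of F "- r" z r] r(1) cont by auto
  qed
  define G where "G = inv F"
  have FG: "F (G z) = z" for z unfolding G_def using surj[of z] by (auto intro: f_inv_into_f)
  have GF: "G (F x) = x" for x unfolding G_def using inj by simp
  have "mono G"
    by (rule monoI) (metis FG mono)
  then have G[measurable]: "G \<in> borel_measurable borel" by (rule borel_measurable_mono)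
  have vim: "G -` A = F ` A" for A
  proof safe
    fix z assume "G z \<in> A" then show "z \<in> F ` A" using FG[of z] by (metis imageI)
  qed (simp add: GF)
  have img: "F ` {x..y} = {F x..F y}" for x y
  proof safe
    fix z assume "z \<in> {F x..F y}"
    then have "F x \<le> F (G z)" "F (G z) \<le> F y" by (auto simp: FG)
    then have "G z \<in> {x..y}" by (simp add: mono)
    then show "z \<in> F ` {x..y}" using FG[of z] by (metis imageI)
  qed (auto simp: mono)
  define N where "N = distr lborel borel G"
  have emN: "emeasure N A = emeasure lborel (F ` A)" if "A \<in> sets borel" for A
    using that by (simp add: N_def emeasure_distr vim)
  \<comment> \<open>The measure of a set under \<open>N\<close> is the Lebesgue measure of its image
    under \<open>F\<close>, and Lipschitz images of null sets are null. This is what Radon-Nikodym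
    requires.\<close>
  have ac: "absolutely_continuous lborel N"
    unfolding absolutely_continuous_def
  proof
    fix A :: "real set" assume A: "A \<in> null_sets lborel"
    then have Ab: "A \<in> sets borel" by auto
    have "A \<in> null_sets lebesgue" using A by (rule null_sets_completionI)
    then have neg: "negligible A" by (simp add: negligible_iff_null_sets)
    have "negligible (F ` A)"
    proof (rule negligible_locally_Lipschitz_image[OF order_refl neg])
      fix x show "\<exists>T B. open T \<and> x \<in> T \<and> (\<forall>y\<in>A \<inter> T. norm (F y - F x) \<le> B * norm (y - x))"
        using lip by (intro exI[of _ UNIV] exI[of _ M]) auto
    qed
    then have "emeasure lebesgue (F ` A) = 0" by (auto simp: negligible_iff_null_sets)
    moreover have "F ` A \<in> sets borel"
      using measurable_sets[OF G Ab] by (simp add: vim)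
    ultimately have "emeasure lborel (F ` A) = 0" by simp
    then show "A \<in> null_sets N" using emN[OF Ab] Ab by (auto simp: N_def)
  qed
  have "sets N = sets lborel" by (simp add: N_def)
  then obtain f where f[measurable]: "f \<in> borel_measurable lborel" and fN: "density lborel f = N"
    using sigma_finite_measure.Radon_Nikodym[OF sigma_finite_lborel ac] by blast
  have nn: "(\<integral>\<^sup>+t. f t * indicator {x..y} t \<partial>lborel) = ennreal (F y - F x)" if "x \<le> y" for x y
  proof -
    have "(\<integral>\<^sup>+t. f t * indicator {x..y} t \<partial>lborel) = emeasure N {x..y}"
      unfolding fN[symmetric] by (subst emeasure_density) auto
    also have "\<dots> = emeasure lborel {F x..F y}" by (simp add: emN img)
    also have "\<dots> = ennreal (F y - F x)" using that by (simp add: mono)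
    finally show ?thesis .
  qed
  define d where "d t = enn2real (f t)" for t
  have d[measurable]: "d \<in> borel_measurable borel" unfolding d_def by measurable
  have d0: "d t \<ge> 0" for t by (simp add: d_def)
  have hi: "(d has_integral (F y - F x)) {x..y}" if xy: "x \<le> y" for x y
  proof -
    \<comment> \<open>As its integral over the interval is finite, the density can be infinite only
      on a null set, where \<open>enn2real\<close> yields 0.\<close>
    have "AE t in lborel. f t * indicator {x..y} t \<noteq> \<infinity>"
      by (rule nn_integral_PInf_AE) (use nn[OF xy] in auto)
    then have ae: "AE t in lborel. ennreal (indicator {x..y} t * d t) = f t * indicator {x..y} t"
      by eventually_elim (auto simp: indicator_def d_def top.not_eq_extremum)
    have "(\<integral>\<^sup>+t. ennreal (indicator {x..y} t * d t) \<partial>lborel) = ennreal (F y - F x)"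
      unfolding nn[OF xy, symmetric] by (rule nn_integral_cong_AE[OF ae])
    then have "((\<lambda>t. indicator {x..y} t * d t) has_integral (F y - F x)) UNIV"
      by (intro nn_integral_has_integral) (use d0 xy in \<open>auto simp: mono\<close>)
    then have "((\<lambda>t. if t \<in> {x..y} then d t else 0) has_integral (F y - F x)) UNIV"
      by (rule has_integral_eq[rotated]) (auto simp: indicator_def)
    then show ?thesis by (subst (asm) has_integral_restrict_UNIV)
  qed
  have "d \<in> L1_loc UNIV"
    unfolding L1_loc_def
  proof safe
    fix K :: "real set" assume K: "compact K"
    obtain r where r: "K \<subseteq> {-r..r}"
      using compact_imp_bounded[OF K] by (metis bounded_subset_cbox_symmetric cbox_interval)
    have "set_integrable lebesgue {-r..r} d"
    proof (cases "-r \<le> r")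
      case True
      show ?thesis
        by (rule nonnegative_absolutely_integrable_1) (use hi[OF True] d0 in auto)
    qed (simp add: set_integrable_def)
    then show "set_integrable lebesgue K d"
      by (rule set_integrable_subset) (use r K lmeasurable_compact in auto)
  qed
  moreover have "F y - F x = integral {x..y} d" if "x \<le> y" for x y
    using hi[OF that] by (simp add: integral_unique)
  ultimately have "primitive_on UNIV F d" by (simp add: primitive_on_def)
  then show ?thesis using d0 by blast
qed

text \<open>Undoes the change from \<open>f\<close> to \<open>s * f x + c * x\<close>, with s a
  sign, that makes a Lipschitz function increasing.\<close>

lemma primitive_on_UNIV_affine:
  assumes "primitive_on UNIV (\<lambda>x. s * f x + c * x) d" "s * s = 1"
  shows "primitive_on UNIV f (\<lambda>x. s * (d x - c))"
proof -
  have sz: "s * (s * z) = z" for z using assms(2) by (metis mult.assoc mult_1)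
  have d: "d \<in> L1_loc UNIV" using assms by (simp add: primitive_on_def)
  have "(\<lambda>x. s * (d x - c)) \<in> L1_loc UNIV"
    by (intro L1_loc_cmult L1_loc_diff d L1_loc_continuous continuous_intros)
  moreover have "f y - f x = integral {x..y} (\<lambda>x. s * (d x - c))" if "x \<le> y" for x y
  proof -
    have di: "d integrable_on {x..y}" using L1_loc_integrable_on[OF d] by simp
    have "integral {x..y} (\<lambda>x. s * (d x - c)) = s * (integral {x..y} d - c * (y - x))"
      using Henstock_Kurzweil_Integration.integral_diff[OF di integrable_const_ivl[of c x y]] that
      by simp
    also have "integral {x..y} d = s * (f y - f x) + c * (y - x)"
    proof -
      have "(s * f y + c * y) - (s * f x + c * x) = integral {x..y} d"
        using assms(1) that by (simp add: primitive_on_def)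
      then show ?thesis by (simp add: algebra_simps)
    qed
    finally show ?thesis by (simp add: sz)
  qed
  ultimately show ?thesis by (simp add: primitive_on_def)
qed

text \<open>Adding (L + e) x to f or to -f gives slopes between e and 2 L + e. The nonnegative
  density of the bi-Lipschitz case then bounds the density of \<open>f\<close> from one side. By
  uniqueness the densities for both signs and all e agree almost everywhere, and e runs through 1 /
  Suc n.\<close>

lemma lipschitz_primitive:
  fixes f :: "real \<Rightarrow> real"
  assumes L: "L > 0" and lip: "\<And>x y. \<bar>f x - f y\<bar> \<le> L * \<bar>x - y\<bar>"
  shows "\<exists>g. primitive_on UNIV f g \<and> (AE x in lebesgue. \<bar>g x\<bar> \<le> L)"
proof -
  have ex: "\<exists>g. primitive_on UNIV f g \<and> (\<forall>x. - (L + e) \<le> s * g x)"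
    if e: "e > 0" and s: "s = 1 \<or> s = -1" for e s
  proof -
    have ss: "s * s = 1" using s by auto
    have b: "\<bar>s * f y - s * f x\<bar> \<le> L * (y - x)" if "x \<le> y" for x y
      using lip[of y x] s that by (auto simp: abs_minus_commute)
    have "\<exists>d. primitive_on UNIV (\<lambda>x. s * f x + (L + e) * x) d \<and> (\<forall>x. 0 \<le> d x)"
    proof (rule bilipschitz_primitive[OF e])
      fix x y :: real assume "x \<le> y"
      from b[OF this] show "e * (y - x) \<le> s * f y + (L + e) * y - (s * f x + (L + e) * x)"
        "s * f y + (L + e) * y - (s * f x + (L + e) * x) \<le> (2 * L + e) * (y - x)"
        by (auto simp: algebra_simps abs_le_iff)
    qed
    then obtain d where d: "primitive_on UNIV (\<lambda>x. s * f x + (L + e) * x) d" "\<And>x. 0 \<le> d x" by blast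
    have "- (L + e) \<le> s * (s * (d x - (L + e)))" for x
    proof -
      have "s * (s * (d x - (L + e))) = d x - (L + e)" using ss by (metis mult.assoc mult_1)
      then show ?thesis using d(2)[of x] by linarith
    qed
    then show ?thesis using primitive_on_UNIV_affine[OF d(1) ss] by blast
  qed
  obtain g where g: "primitive_on UNIV f g" using ex[of 1 1] by auto
  have "AE x in lebesgue. - (L + 1 / Suc n) \<le> s * g x" if s: "s = 1 \<or> s = -1" for s n
  proof -
    obtain g' where g': "primitive_on UNIV f g'" "\<And>x. - (L + 1 / Suc n) \<le> s * g' x"
      using ex[OF _ s, of "1 / Suc n"] by auto
    have "AE x in lebesgue. x \<in> UNIV \<longrightarrow> g x = g' x"
      by (rule real_line.weak_deriv_unique[OF real_line.primitive_on_imp_weak_deriv[OF g]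
            real_line.primitive_on_imp_weak_deriv[OF g'(1)]])
    then show ?thesis by eventually_elim (use g'(2) in auto)
  qed
  note * = this
  have "AE x in lebesgue. \<forall>n. - (L + 1 / Suc n) \<le> g x \<and> g x \<le> L + 1 / Suc n"
    unfolding AE_all_countable
  proof (intro allI)
    fix n :: nat
    have "AE x in lebesgue. - (L + 1 / Suc n) \<le> 1 * g x" "AE x in lebesgue. - (L + 1 / Suc n) \<le> (-1) * g x"
      using *[of 1 n] *[of "-1" n] by simp_all
    then show "AE x in lebesgue. - (L + 1 / Suc n) \<le> g x \<and> g x \<le> L + 1 / Suc n"
      by eventually_elim linarith
  qed
  then have "AE x in lebesgue. \<bar>g x\<bar> \<le> L"
  proof eventually_elim
    case (elim x)
    have "\<bar>g x\<bar> \<le> L + e" if e: "e > 0" for e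
    proof -
      obtain n where "1 / real (Suc n) < e" by (rule nat_approx_posE[OF e])
      then show ?thesis using elim[rule_format, of n] by (auto simp: abs_le_iff)
    qed
    then show ?case by (rule field_le_epsilon)
  qed
  then show ?thesis using g by blast
qed

subsection \<open>The parameter class in terms of classical derivatives\<close>

lemma primitive_on_cong_AE:
  assumes f: "primitive_on UNIV f g" and ae: "AE x in lebesgue. g x = g' x"
  shows "primitive_on UNIV f g'"
proof -
  have g: "g \<in> L1_loc UNIV" using f by (simp add: primitive_on_def)
  have ae': "AE x in lebesgue. x \<in> S \<longrightarrow> g x = g' x" for S using ae by eventually_elim simp
  have g': "g' \<in> L1_loc UNIV" by (rule L1_loc_cong_AE[OF ae' g])
  have "integral {x..y} g' = integral {x..y} g" for x y
  proof -
    have "set_integrable lebesgue {x..y} g" "set_integrable lebesgue {x..y} g'"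
      using L1_locD[OF g] L1_locD[OF g'] by auto
    then show ?thesis
      using AE_set_integral_cong(2)[OF ae', of "{x..y}"] set_lebesgue_integral_eq_integral(2)
      by metis
  qed
  then show ?thesis using f g' by (simp add: primitive_on_def)
qed

lemma primitive_on_UNIV_deriv:
  assumes f: "primitive_on UNIV f g" and g: "continuous_on UNIV g"
  shows "(f has_real_derivative g x) (at x)"
proof -
  have c: "continuous_on {x - 1..x + 1} g" by (rule continuous_on_subset[OF g]) simp
  have "((\<lambda>u. integral {x - 1..u} g) has_real_derivative g x) (at x within {x - 1..x + 1})"
    by (rule integral_has_real_derivative[OF c]) simp
  then have "((\<lambda>u. f (x - 1) + integral {x - 1..u} g) has_real_derivative g x) (at x within {x - 1..x + 1})"
    by (auto intro!: derivative_eq_intros)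
  then have "(f has_real_derivative g x) (at x within {x - 1..x + 1})"
  proof (rule has_field_derivative_transform_within[OF _ zero_less_one])
    fix u assume "u \<in> {x - 1..x + 1}"
    then have "f u - f (x - 1) = integral {x - 1..u} g" using f by (simp add: primitive_on_def)
    then show "f (x - 1) + integral {x - 1..u} g = f u" by simp
  qed simp
  then show ?thesis by (simp add: at_within_Icc_at)
qed

lemma primitive_on_lipschitz:
  assumes f: "primitive_on UNIV f g" and ae: "AE x in lebesgue. \<bar>g x\<bar> \<le> L"
  shows "\<bar>f x - f y\<bar> \<le> L * \<bar>x - y\<bar>"
proof -
  \<comment> \<open>Truncation changes \<open>g\<close> only on a null set and makes the bound hold
    at every point, as the integral estimate demands.\<close>
  define g' where "g' x = max (- L) (min L (g x))" for x
  have "AE x in lebesgue. g x = g' x"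
    using ae by eventually_elim (auto simp: g'_def abs_le_iff)
  then have g': "primitive_on UNIV f g'" by (rule primitive_on_cong_AE[OF f])
  have "\<exists>x. \<bar>g x\<bar> \<le> L"
  proof -
    have "AE x in lebesgue. x \<in> UNIV \<longrightarrow> \<bar>g x\<bar> \<le> L" using ae by simp
    from real_line.AE_imp_dense[OF this, of 0 1] show ?thesis by auto
  qed
  then have L: "L \<ge> 0" by (auto intro: order_trans[OF abs_ge_zero])
  have b: "\<bar>g' x\<bar> \<le> L" for x using L by (auto simp: g'_def)
  have *: "\<bar>f y - f x\<bar> \<le> L * (y - x)" if "x \<le> y" for x y
  proof -
    have i: "g' integrable_on {x..y}" using g' L1_loc_integrable_on[of g' UNIV] by (auto simp: primitive_on_def)
    have "norm (integral {x..y} g') \<le> integral {x..y} (\<lambda>_. L)"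
      by (rule integral_norm_bound_integral[OF i]) (use b in auto)
    then show ?thesis using g' that by (simp add: primitive_on_def mult.commute)
  qed
  show ?thesis
    using *[of x y] *[of y x] by (cases "x \<le> y") (auto simp: abs_minus_commute)
qed

text \<open>Condition (A1) with classical derivatives. The bound on the third weak derivative has
  become a Lipschitz bound, a form that survives pointwise limits.\<close>

definition C2_param where
  "C2_param a0 a1 a2 a3 b b1 b2 \<longleftrightarrow> b 0 = (0::real) \<and>
     (\<forall>x. (b has_real_derivative b1 x) (at x)) \<and> (\<forall>x. (b1 has_real_derivative b2 x) (at x)) \<and>
     (\<forall>x. a0 \<le> b1 x \<and> b1 x \<le> a1) \<and> (\<forall>x. \<bar>b2 x\<bar> \<le> a2) \<and>
     (\<forall>x y. \<bar>b2 x - b2 y\<bar> \<le> a3 * \<bar>x - y\<bar>)"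

lemma continuous_on_if_DERIV:
  fixes f f' :: "real \<Rightarrow> real"
  assumes "\<And>x. (f has_real_derivative f' x) (at x)"
  shows "continuous_on A f"
  using DERIV_continuous[OF assms] by (simp add: continuous_at_imp_continuous_on)

text \<open>The first and second weak derivatives are themselves weakly differentiable, so they have
  absolutely continuous representatives, for which the almost everywhere bounds hold
  everywhere.\<close>

lemma A1_imp_C2_param:
  assumes A: "A1 a0 a1 a2 a3 b"
  shows "\<exists>b1 b2. C2_param a0 a1 a2 a3 b b1 b2"
proof -
  have w: "weak_deriv UNIV i b (wderiv UNIV i b)" if i: "i \<le> 3" for i
  proof -
    have "\<exists>g. weak_deriv UNIV i b g" using A i by (auto simp: A1_def sobolev_Winf_loc_def)
    then show ?thesis using real_line.weak_deriv_wderiv(1) by blast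
  qed
  let ?g = "\<lambda>i. wderiv UNIV i b"
  have w1: "weak_deriv UNIV 1 b (?g 1)" by (rule w) simp
  have w2: "weak_deriv UNIV 1 (?g 1) (?g 2)"
    by (rule real_line.weak_deriv_1I[of 1 b]) (use w[of 1] w[of 2] in \<open>simp_all add: numeral_2_eq_2\<close>)
  have w3: "weak_deriv UNIV 1 (?g 2) (?g 3)"
    by (rule real_line.weak_deriv_1I[of 2 b]) (use w[of 2] w[of 3] in \<open>simp_all add: numeral_3_eq_3 numeral_2_eq_2\<close>)
  obtain p1 where p1: "primitive_on UNIV p1 (?g 2)" "AE x in lebesgue. ?g 1 x = p1 x"
    using real_line.weak_deriv_imp_primitive_AE[OF w2] by auto
  obtain p2 where p2: "primitive_on UNIV p2 (?g 3)" "AE x in lebesgue. ?g 2 x = p2 x"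
    using real_line.weak_deriv_imp_primitive_AE[OF w3] by auto
  have c1: "continuous_on UNIV p1" and c2: "continuous_on UNIV p2"
    using real_line.primitive_on_continuous_on p1 p2 by auto
  have bp: "primitive_on UNIV b p1"
    using primitive_on_cong_AE[OF real_line.weak_deriv_imp_primitive[OF w1] p1(2)] A by (simp add: A1_def)
  have p1p: "primitive_on UNIV p1 p2" by (rule primitive_on_cong_AE[OF p1(1) p2(2)])
  have ae: "AE y in lebesgue. a0 \<le> ?g 1 y \<and> ?g 1 y \<le> a1" "AE y in lebesgue. \<bar>?g 2 y\<bar> \<le> a2"
    "AE y in lebesgue. \<bar>?g 3 y\<bar> \<le> a3"
    using A by (auto simp: A1_def)
  have "AE x in lebesgue. x \<in> UNIV \<longrightarrow> a0 \<le> p1 x" "AE x in lebesgue. x \<in> UNIV \<longrightarrow> p1 x \<le> a1"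
    using ae(1) p1(2) by (eventually_elim, simp)+
  then have 1: "a0 \<le> p1 x" "p1 x \<le> a1" for x
    using real_line.AE_le_continuous[of "\<lambda>_. a0" p1 x] real_line.AE_le_continuous[of p1 "\<lambda>_. a1" x] c1 by auto
  have "AE x in lebesgue. x \<in> UNIV \<longrightarrow> \<bar>p2 x\<bar> \<le> a2"
    using ae(2) p2(2) by eventually_elim simp
  then have 2: "\<bar>p2 x\<bar> \<le> a2" for x
    using real_line.AE_le_continuous[of "\<lambda>x. \<bar>p2 x\<bar>" "\<lambda>_. a2" x] c2 by (auto intro: continuous_intros)
  have 3: "\<bar>p2 x - p2 y\<bar> \<le> a3 * \<bar>x - y\<bar>" for x y
    by (rule primitive_on_lipschitz[OF p2(1) ae(3)])
  have "b 0 = 0" using A by (simp add: A1_def)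
  then show ?thesis
    unfolding C2_param_def
    by (intro exI[of _ p1] exI[of _ p2] conjI allI 1 2 3 primitive_on_UNIV_deriv[OF bp c1]
        primitive_on_UNIV_deriv[OF p1p c2])
qed

lemma continuous_Linf_loc:
  assumes "continuous_on UNIV (f :: real \<Rightarrow> real)"
  shows "f \<in> Linf_loc UNIV"
  unfolding Linf_loc_def
proof safe
  fix K :: "real set" assume K: "compact K"
  have "K \<in> sets lebesgue" using lmeasurable_compact[OF K] by blast
  moreover have "f \<in> borel_measurable lebesgue"
    using assms by (intro measurable_completion) (simp add: borel_measurable_continuous_onI)
  ultimately show "set_borel_measurable lebesgue K f"
    unfolding set_borel_measurable_def by (intro borel_measurable_scaleR borel_measurable_indicator)
  have "bounded (f ` K)"
    by (rule compact_imp_bounded[OF compact_continuous_image[OF continuous_on_subset[OF assms] K]]) simp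
  then obtain M where "\<And>x. x \<in> K \<Longrightarrow> norm (f x) \<le> M" by (auto simp: bounded_iff)
  then show "\<exists>M. AE x in lebesgue. x \<in> K \<longrightarrow> \<bar>f x\<bar> \<le> M" by (intro exI[of _ M]) auto
qed

lemma C2_paramD:
  assumes "C2_param a0 a1 a2 a3 b b1 b2"
  shows "b 0 = 0" "(b has_real_derivative b1 x) (at x)" "(b1 has_real_derivative b2 x) (at x)"
    "a0 \<le> b1 x" "b1 x \<le> a1" "\<bar>b2 x\<bar> \<le> a2" "\<bar>b2 x - b2 y\<bar> \<le> a3 * \<bar>x - y\<bar>"
    "continuous_on A b" "continuous_on A b1" "continuous_on A b2"
proof -
  show D: "b 0 = 0" "(b has_real_derivative b1 x) (at x)" "(b1 has_real_derivative b2 x) (at x)"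
    "a0 \<le> b1 x" "b1 x \<le> a1" "\<bar>b2 x\<bar> \<le> a2" "\<bar>b2 x - b2 y\<bar> \<le> a3 * \<bar>x - y\<bar>" for x y
    using assms unfolding C2_param_def by blast+
  show "continuous_on A b" "continuous_on A b1"
    by (rule continuous_on_if_DERIV[OF D(2)], rule continuous_on_if_DERIV[OF D(3)])
  have "lipschitz_on (max a3 0) UNIV b2"
  proof (rule lipschitz_onI)
    fix x y show "dist (b2 x) (b2 y) \<le> max a3 0 * dist x y"
      using D(7)[of x y] mult_right_mono[of a3 "max a3 0" "\<bar>x - y\<bar>"]
      unfolding dist_real_def by simp
  qed simp
  from continuous_on_subset[OF lipschitz_on_continuous_on[OF this]] show "continuous_on A b2" by simp
qed

text \<open>The converse of the passage to classical derivatives, which readmits limits of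
  parameters into the class. The third weak derivative is extracted from the Lipschitz bound on
  \<open>b2\<close>.\<close>

lemma C2_param_imp_A1:
  assumes C: "C2_param a0 a1 a2 a3 b b1 b2" and a3: "a3 > 0"
  shows "A1 a0 a1 a2 a3 b" "weak_deriv UNIV 1 b b1" "weak_deriv UNIV 2 b b2"
proof -
  note D = C2_paramD[OF C]
  obtain b3 where b3: "primitive_on UNIV b2 b3" "AE x in lebesgue. \<bar>b3 x\<bar> \<le> a3"
    using lipschitz_primitive[OF a3 D(7)] by blast
  have p: "primitive_on UNIV b b1" "primitive_on UNIV b1 b2"
    by (rule primitive_on_C1; use D in simp)+
  show w1: "weak_deriv UNIV 1 b b1" by (rule real_line.primitive_on_imp_weak_deriv[OF p(1)])
  show w2: "weak_deriv UNIV 2 b b2"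
    using real_line.weak_deriv_Suc[OF w1 real_line.primitive_on_imp_weak_deriv[OF p(2)]]
    by (simp add: numeral_2_eq_2)
  have w3: "weak_deriv UNIV 3 b b3"
    using real_line.weak_deriv_Suc[OF w2 real_line.primitive_on_imp_weak_deriv[OF b3(1)]]
    by (simp add: numeral_3_eq_3 numeral_2_eq_2)
  have w0: "weak_deriv UNIV 0 b b" by (rule real_line.weak_deriv_0[OF L1_loc_continuous[OF D(8)]])
  have L: "b \<in> Linf_loc UNIV" "b1 \<in> Linf_loc UNIV" "b2 \<in> Linf_loc UNIV"
    using continuous_Linf_loc D(8-10) by auto
  have "b3 \<in> L1_loc UNIV" using b3 by (simp add: primitive_on_def)
  then have "set_borel_measurable lebesgue K b3" if "compact K" for K
    using that by (auto simp: L1_loc_def set_integrable_def set_borel_measurable_def)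
  moreover have "AE x in lebesgue. x \<in> K \<longrightarrow> \<bar>b3 x\<bar> \<le> a3" for K
    using b3(2) by eventually_elim simp
  ultimately have L3: "b3 \<in> Linf_loc UNIV" by (auto simp: Linf_loc_def)
  have "\<exists>g\<in>Linf_loc UNIV. weak_deriv UNIV i b g" if "i \<le> 3" for i
  proof -
    have "i = 0 \<or> i = 1 \<or> i = 2 \<or> i = 3" using that by auto
    moreover have "\<exists>g\<in>Linf_loc UNIV. weak_deriv UNIV 0 b g" by (rule bexI[of _ b]) (rule w0, rule L(1))
    moreover have "\<exists>g\<in>Linf_loc UNIV. weak_deriv UNIV 1 b g" by (rule bexI[of _ b1]) (rule w1, rule L(2))
    moreover have "\<exists>g\<in>Linf_loc UNIV. weak_deriv UNIV 2 b g" by (rule bexI[of _ b2]) (rule w2, rule L(3))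
    moreover have "\<exists>g\<in>Linf_loc UNIV. weak_deriv UNIV 3 b g" by (rule bexI[of _ b3]) (rule w3, rule L3)
    ultimately show ?thesis by (elim disjE) simp_all
  qed
  then have "b \<in> sobolev_Winf_loc 3 UNIV" using L by (auto simp: sobolev_Winf_loc_def)
  moreover have "AE y in lebesgue. a0 \<le> wderiv UNIV 1 b y \<and> wderiv UNIV 1 b y \<le> a1"
    using real_line.weak_deriv_wderiv(2)[OF w1] by eventually_elim (use D(4,5) in simp)
  moreover have "AE y in lebesgue. \<bar>wderiv UNIV 2 b y\<bar> \<le> a2"
    using real_line.weak_deriv_wderiv(2)[OF w2] by eventually_elim (use D(6) in simp)
  moreover have "AE y in lebesgue. \<bar>wderiv UNIV 3 b y\<bar> \<le> a3"
    using real_line.weak_deriv_wderiv(2)[OF w3] b3(2) by eventually_elim simp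
  ultimately show "A1 a0 a1 a2 a3 b" using D(1,8) by (simp add: A1_def)
qed

subsection \<open>Compactness of the parameter class\<close>

lemma convergent_everywhere_if_lipschitz:
  fixes f :: "nat \<Rightarrow> real \<Rightarrow> real"
  assumes lip: "\<And>n x y. \<bar>f n x - f n y\<bar> \<le> L * \<bar>x - y\<bar>"
    and rat: "\<And>q. q \<in> \<rat> \<Longrightarrow> convergent (\<lambda>n. f n q)"
  shows "convergent (\<lambda>n. f n x)"
proof (rule Cauchy_convergent, rule CauchyI)
  fix e :: real assume e: "e > 0"
  \<comment> \<open>Within this distance the Lipschitz bound moves each function by less than e / 3;
    the added 1 avoids division by zero.\<close>
  define d where "d = e / (3 * (\<bar>L\<bar> + 1))"
  have d: "d > 0" using e by (simp add: d_def)
  obtain q where q: "q \<in> \<rat>" "x < q" "q < x + d" using Rats_dense_in_real[of x "x + d"] d by auto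
  have close: "\<bar>f n x - f n q\<bar> < e / 3" for n
  proof -
    have "\<bar>f n x - f n q\<bar> \<le> L * \<bar>x - q\<bar>" by (rule lip)
    also have "\<dots> \<le> \<bar>L\<bar> * d" using q by (intro mult_mono) auto
    also have "\<dots> < (\<bar>L\<bar> + 1) * d" using d by simp
    also have "\<dots> = e / 3" by (simp add: d_def field_simps)
    finally show ?thesis .
  qed
  have "Cauchy (\<lambda>n. f n q)" using rat[OF q(1)] by (rule convergent_Cauchy)
  from CauchyD[OF this, of "e / 3"] e
  obtain M where M: "\<And>m n. m \<ge> M \<Longrightarrow> n \<ge> M \<Longrightarrow> norm (f m q - f n q) < e / 3" by auto
  have "norm (f m x - f n x) < e" if "m \<ge> M" "n \<ge> M" for m n
    using M[OF that, unfolded real_norm_def] close[of m] close[of n] unfolding real_norm_def by linarith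
  then show "\<exists>M. \<forall>m\<ge>M. \<forall>n\<ge>M. norm (f m x - f n x) < e" by blast
qed

text \<open>A finite net reduces the claim to convergence at finitely many points, because the limit
  inherits the Lipschitz bound.\<close>

lemma uniform_if_pointwise_lipschitz:
  fixes f :: "nat \<Rightarrow> real \<Rightarrow> real"
  assumes lip: "\<And>n x y. \<bar>f n x - f n y\<bar> \<le> L * \<bar>x - y\<bar>"
    and lim: "\<And>x. (\<lambda>n. f n x) \<longlonglongrightarrow> g x" and e: "e > 0"
  shows "\<forall>\<^sub>F n in sequentially. \<forall>x\<in>{a..b}. \<bar>f n x - g x\<bar> \<le> e"
proof -
  define d where "d = e / (3 * (\<bar>L\<bar> + 1))"
  have d: "d > 0" using e by (simp add: d_def)
  have lipg: "\<bar>g x - g y\<bar> \<le> L * \<bar>x - y\<bar>" for x y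
    by (rule tendsto_upperbound[OF tendsto_rabs[OF tendsto_diff[OF lim lim]]]) (use lip in auto)
  have "seq_compact {a..b}" by (simp add: compact_imp_seq_compact)
  then obtain k where k: "finite k" "{a..b} \<subseteq> (\<Union>x\<in>k. ball x d)"
    using seq_compact_imp_totally_bounded[of "{a..b}"] d by blast
  have "\<forall>\<^sub>F n in sequentially. \<forall>q\<in>k. \<bar>f n q - g q\<bar> < e / 3"
  proof (rule eventually_ball_finite[OF k(1)], rule ballI)
    fix q show "\<forall>\<^sub>F n in sequentially. \<bar>f n q - g q\<bar> < e / 3"
      using tendstoD[OF lim, of "e / 3" q] e by (simp add: dist_real_def)
  qed
  then show ?thesis
  proof eventually_elim
    case (elim n)
    show ?case
    proof
      fix x assume "x \<in> {a..b}"
      then obtain q where q: "q \<in> k" "\<bar>x - q\<bar> < d"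
        using k(2) by (auto simp: dist_real_def abs_minus_commute)
      have "L * \<bar>x - q\<bar> \<le> \<bar>L\<bar> * d" using q by (intro mult_mono) auto
      also have "\<dots> \<le> (\<bar>L\<bar> + 1) * d" using d by simp
      also have "\<dots> = e / 3" by (simp add: d_def field_simps)
      finally have "L * \<bar>x - q\<bar> \<le> e / 3" .
      then show "\<bar>f n x - g x\<bar> \<le> e"
        using lip[of n x q] lipg[of x q] elim[rule_format, OF q(1)] by linarith
    qed
  qed
qed

text \<open>Unlike differentiability, the quadratic bound is preserved by pointwise limits; this is
  how derivatives pass to the limit parameter.\<close>

lemma DERIV_if_quadratic_bound:
  fixes f :: "real \<Rightarrow> real"
  assumes "\<And>y. \<bar>f y - f x - g * (y - x)\<bar> \<le> L * (y - x)\<^sup>2"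
  shows "(f has_real_derivative g) (at x)"
  unfolding DERIV_def
proof (rule LIM_zero_cancel, rule Lim_null_comparison)
  show "((\<lambda>h. L * \<bar>h\<bar>) \<longlongrightarrow> 0) (at 0)" by (auto intro!: tendsto_eq_intros)
  show "\<forall>\<^sub>F h in at 0. norm ((f (x + h) - f x) / h - g) \<le> L * \<bar>h\<bar>"
  proof (rule eventually_mono[OF eventually_neq_at_within[of 0]])
    fix h :: real assume h: "h \<noteq> 0"
    have "\<bar>(f (x + h) - f x) / h - g\<bar> = \<bar>f (x + h) - f x - g * h\<bar> / \<bar>h\<bar>"
      using h by (simp add: field_simps flip: abs_divide)
    also have "\<dots> \<le> L * h\<^sup>2 / \<bar>h\<bar>" using assms[of "x + h"] by (intro divide_right_mono) auto
    also have "\<dots> = L * \<bar>h\<bar>" using h by (simp add: power2_eq_square abs_if)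
    finally show "norm ((f (x + h) - f x) / h - g) \<le> L * \<bar>h\<bar>" by simp
  qed
qed

lemma lipschitz_if_deriv_bounded:
  fixes f f' :: "real \<Rightarrow> real"
  assumes "\<And>x. (f has_real_derivative f' x) (at x)" "\<And>x. \<bar>f' x\<bar> \<le> L"
  shows "\<bar>f x - f y\<bar> \<le> L * \<bar>x - y\<bar>"
proof -
  have "norm (f x - f y) \<le> L * norm (x - y)"
    by (rule field_differentiable_bound[of UNIV f f']) (use assms in auto)
  then show ?thesis by simp
qed

lemma quadratic_bound_if_deriv_lipschitz:
  fixes f f' :: "real \<Rightarrow> real"
  assumes D: "\<And>x. (f has_real_derivative f' x) (at x)" and lip: "\<And>x y. \<bar>f' x - f' y\<bar> \<le> L * \<bar>x - y\<bar>"
  shows "\<bar>f y - f x - f' x * (y - x)\<bar> \<le> L * (y - x)\<^sup>2"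
proof -
  have "norm ((f y - f' x * y) - (f x - f' x * x)) \<le> L * \<bar>y - x\<bar> * norm (y - x)"
  proof (rule field_differentiable_bound[of "closed_segment x y" "\<lambda>z. f z - f' x * z" "\<lambda>z. f' z - f' x"])
    fix z assume z: "z \<in> closed_segment x y"
    show "((\<lambda>z. f z - f' x * z) has_real_derivative f' z - f' x) (at z within closed_segment x y)"
      using has_field_derivative_at_within[OF D] by (auto intro!: derivative_eq_intros)
    have L: "0 \<le> L" using lip[of 1 0] by auto
    have "\<bar>z - x\<bar> \<le> \<bar>y - x\<bar>" using z by (auto simp: closed_segment_eq_real_ivl split: if_splits)
    then show "norm (f' z - f' x) \<le> L * \<bar>y - x\<bar>"
      using lip[of z x] mult_left_mono[OF _ L, of "\<bar>z - x\<bar>" "\<bar>y - x\<bar>"] by simp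
  qed auto
  then show ?thesis by (simp add: power2_eq_square algebra_simps abs_mult_self_eq flip: abs_mult)
qed

lemma C2_param_lipschitz:
  assumes C: "C2_param a0 a1 a2 a3 b b1 b2" and a0: "a0 > 0"
  shows "\<bar>b x - b y\<bar> \<le> a1 * \<bar>x - y\<bar>" "\<bar>b1 x - b1 y\<bar> \<le> a2 * \<bar>x - y\<bar>"
proof -
  note D = C2_paramD[OF C]
  have "\<bar>b1 x\<bar> \<le> a1" for x using D(4,5)[of x] a0 by auto
  then show "\<bar>b x - b y\<bar> \<le> a1 * \<bar>x - y\<bar>" by (rule lipschitz_if_deriv_bounded[OF D(2)])
  show "\<bar>b1 x - b1 y\<bar> \<le> a2 * \<bar>x - y\<bar>" by (rule lipschitz_if_deriv_bounded[OF D(3,6)])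
qed

lemma C2_param_compact:
  assumes C: "\<And>n::nat. C2_param a0 a1 a2 a3 (b n) (b1 n) (b2 n)" and a0: "a0 > 0"
  obtains k c c1 c2 where "strict_mono k" "C2_param a0 a1 a2 a3 c c1 c2"
    "\<And>x. (\<lambda>n. b (k n) x) \<longlonglongrightarrow> c x" "\<And>x. (\<lambda>n. b1 (k n) x) \<longlonglongrightarrow> c1 x" "\<And>x. (\<lambda>n. b2 (k n) x) \<longlonglongrightarrow> c2 x"
proof -
  note D = C2_paramD[OF C] and Lip = C2_param_lipschitz[OF C a0]
  \<comment> \<open>The three functions are treated as one vector-valued function, so that a single
    subsequence serves them all.\<close>
  define F where "F n x = (b n x, b1 n x, b2 n x)" for n x
  have bd: "norm (F n x) \<le> a1 * \<bar>x\<bar> + (a1 + a2)" for n x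
  proof -
    have "\<bar>b n x\<bar> \<le> a1 * \<bar>x\<bar>" using Lip(1)[of n x 0] D(1)[of n] by simp
    moreover have "\<bar>b1 n x\<bar> \<le> a1" using D(4,5)[of n x] a0 by auto
    moreover have "norm (F n x) \<le> \<bar>b n x\<bar> + norm (b1 n x, b2 n x)"
      using norm_Pair_le[of "b n x" "(b1 n x, b2 n x)"] by (simp add: F_def)
    moreover have "norm (b1 n x, b2 n x) \<le> \<bar>b1 n x\<bar> + \<bar>b2 n x\<bar>"
      using norm_Pair_le[of "b1 n x" "b2 n x"] by simp
    ultimately show ?thesis using D(6)[of n x] by linarith
  qed
  \<comment> \<open>The diagonal argument wants one bound for all points, but parameters may grow
    linearly. Dividing by this weight restores such a bound and does not affect convergence at a
    point.\<close>
  define w where "w x = 1 + a1 * \<bar>x\<bar> + (a1 + a2)" for x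
  have "0 \<le> a1" "0 \<le> a2" using D(4-6)[of 0 0] a0 by auto
  then have w: "w x \<ge> 1" for x by (simp add: w_def)
  have "norm ((1 / w x) *\<^sub>R F n x) \<le> 1" for n x
    using bd[of n x] w[of x] by (simp add: w_def)
  then obtain k where k: "strict_mono k" "\<And>q. q \<in> \<rat> \<Longrightarrow> \<exists>l. (\<lambda>n. (1 / w q) *\<^sub>R F (k n) q) \<longlonglongrightarrow> l"
    using function_convergent_subsequence[OF countable_rat, of "\<lambda>n x. (1 / w x) *\<^sub>R F n x" 1] by metis
  have rat: "convergent (\<lambda>n. b (k n) q)" "convergent (\<lambda>n. b1 (k n) q)" "convergent (\<lambda>n. b2 (k n) q)"
    if q: "q \<in> \<rat>" for q
  proof -
    obtain l0 where "(\<lambda>n. (1 / w q) *\<^sub>R F (k n) q) \<longlonglongrightarrow> l0" using k(2)[OF q] by blast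
    from tendsto_scaleR[OF tendsto_const[of "w q"] this]
    have "(\<lambda>n. F (k n) q) \<longlonglongrightarrow> w q *\<^sub>R l0" using w[of q] by simp
    then obtain l where "(\<lambda>n. F (k n) q) \<longlonglongrightarrow> l" by blast
    from tendsto_fst[OF this] tendsto_snd[OF this]
    have 1: "(\<lambda>n. b (k n) q) \<longlonglongrightarrow> fst l" and 2: "(\<lambda>n. (b1 (k n) q, b2 (k n) q)) \<longlonglongrightarrow> snd l"
      by (simp_all add: F_def)
    from tendsto_fst[OF 2] tendsto_snd[OF 2] 1
    show "convergent (\<lambda>n. b (k n) q)" "convergent (\<lambda>n. b1 (k n) q)" "convergent (\<lambda>n. b2 (k n) q)"
      by (auto simp: convergent_def)
  qed
  define c where "c x = lim (\<lambda>n. b (k n) x)" for x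
  define c1 where "c1 x = lim (\<lambda>n. b1 (k n) x)" for x
  define c2 where "c2 x = lim (\<lambda>n. b2 (k n) x)" for x
  have c: "(\<lambda>n. b (k n) x) \<longlonglongrightarrow> c x" for x
    unfolding c_def convergent_LIMSEQ_iff[symmetric]
    by (rule convergent_everywhere_if_lipschitz[OF Lip(1) rat(1)])
  have c1: "(\<lambda>n. b1 (k n) x) \<longlonglongrightarrow> c1 x" for x
    unfolding c1_def convergent_LIMSEQ_iff[symmetric]
    by (rule convergent_everywhere_if_lipschitz[OF Lip(2) rat(2)])
  have c2: "(\<lambda>n. b2 (k n) x) \<longlonglongrightarrow> c2 x" for x
    unfolding c2_def convergent_LIMSEQ_iff[symmetric]
    by (rule convergent_everywhere_if_lipschitz[OF D(7) rat(3)])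
  have "C2_param a0 a1 a2 a3 c c1 c2"
    unfolding C2_param_def
  proof (intro conjI allI)
    show "c 0 = 0" using c[of 0] D(1) by (simp add: LIMSEQ_const_iff)
    fix x y
    show "(c has_real_derivative c1 x) (at x)"
    proof (rule DERIV_if_quadratic_bound)
      fix y show "\<bar>c y - c x - c1 x * (y - x)\<bar> \<le> a2 * (y - x)\<^sup>2"
        by (rule tendsto_upperbound[OF tendsto_rabs[OF tendsto_diff[OF tendsto_diff[OF c c] tendsto_mult_right[OF c1]]]])
          (use quadratic_bound_if_deriv_lipschitz[OF D(2) Lip(2)] in auto)
    qed
    show "(c1 has_real_derivative c2 x) (at x)"
    proof (rule DERIV_if_quadratic_bound)
      fix y show "\<bar>c1 y - c1 x - c2 x * (y - x)\<bar> \<le> a3 * (y - x)\<^sup>2"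
        by (rule tendsto_upperbound[OF tendsto_rabs[OF tendsto_diff[OF tendsto_diff[OF c1 c1] tendsto_mult_right[OF c2]]]])
          (use quadratic_bound_if_deriv_lipschitz[OF D(3) D(7)] in auto)
    qed
    show "a0 \<le> c1 x" by (rule tendsto_lowerbound[OF c1]) (use D(4) in auto)
    show "c1 x \<le> a1" by (rule tendsto_upperbound[OF c1]) (use D(5) in auto)
    show "\<bar>c2 x\<bar> \<le> a2" by (rule tendsto_upperbound[OF tendsto_rabs[OF c2]]) (use D(6) in auto)
    show "\<bar>c2 x - c2 y\<bar> \<le> a3 * \<bar>x - y\<bar>"
      by (rule tendsto_upperbound[OF tendsto_rabs[OF tendsto_diff[OF c2 c2]]]) (use D(7) in auto)
  qed
  then show ?thesis using that k(1) c c1 c2 by blast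
qed

subsection \<open>Square integrable functions\<close>

definition ip :: "real set \<Rightarrow> (real \<Rightarrow> real) \<Rightarrow> (real \<Rightarrow> real) \<Rightarrow> real" where
  "ip S f g = (LINT x:S|lebesgue. f x * g x)"

lemma L2_meas: "f \<in> L2 S \<Longrightarrow> (\<lambda>x. indicator S x * f x) \<in> borel_measurable lebesgue"
  by (simp add: L2_def set_borel_measurable_def)

lemma L2_mult_integrable:
  assumes "f \<in> L2 S" "g \<in> L2 S"
  shows "set_integrable lebesgue S (\<lambda>x. f x * g x)"
proof -
  have i: "integrable lebesgue (\<lambda>x. indicator S x * (f x)\<^sup>2 + indicator S x * (g x)\<^sup>2)"
    using assms by (intro Bochner_Integration.integrable_add) (simp_all add: L2_def set_integrable_def)
  have m: "(\<lambda>x. indicator S x * (f x * g x)) \<in> borel_measurable lebesgue"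
  proof -
    have "(\<lambda>x. (indicator S x * f x) * (indicator S x * g x)) \<in> borel_measurable lebesgue"
      by (rule borel_measurable_times[OF L2_meas[OF assms(1)] L2_meas[OF assms(2)]])
    moreover have "(indicator S x * f x) * (indicator S x * g x) = indicator S x * (f x * g x)" for x
      by (simp add: indicator_def)
    ultimately show ?thesis by simp
  qed
  have "\<bar>a * b\<bar> \<le> a\<^sup>2 + b\<^sup>2" for a b :: real
  proof -
    have "2 * \<bar>a * b\<bar> \<le> a\<^sup>2 + b\<^sup>2" using zero_le_power2[of "\<bar>a\<bar> - \<bar>b\<bar>"] by (simp add: power2_diff abs_mult)
    then show ?thesis by linarith
  qed
  note le = this
  have "norm (indicator S x * (f x * g x)) \<le> norm (indicator S x * (f x)\<^sup>2 + indicator S x * (g x)\<^sup>2)" for x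
    using le[of "f x" "g x"] by (simp add: indicator_def)
  then show ?thesis
    unfolding set_integrable_def real_scaleR_def
    by (intro Bochner_Integration.integrable_bound[OF i m] AE_I2)
qed

lemma L2_I:
  assumes "(\<lambda>x. indicator S x * f x) \<in> borel_measurable lebesgue"
    "set_integrable lebesgue S g" "\<And>x. x \<in> S \<Longrightarrow> (f x)\<^sup>2 \<le> g x"
  shows "f \<in> L2 S"
proof -
  have "(\<lambda>x. indicator S x * (f x)\<^sup>2) \<in> borel_measurable lebesgue"
  proof -
    have "(\<lambda>x. (indicator S x * f x)\<^sup>2) \<in> borel_measurable lebesgue"
      by (intro borel_measurable_power assms(1))
    moreover have "(indicator S x * f x)\<^sup>2 = indicator S x * (f x)\<^sup>2" for x by (simp add: indicator_def)
    ultimately show ?thesis by simp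
  qed
  moreover have "norm (indicator S x * (f x)\<^sup>2) \<le> norm (indicator S x *\<^sub>R g x)" for x
    using assms(3)[of x] by (cases "x \<in> S") auto
  ultimately have "integrable lebesgue (\<lambda>x. indicator S x * (f x)\<^sup>2)"
    by (intro Bochner_Integration.integrable_bound[OF assms(2)[unfolded set_integrable_def]] AE_I2)
  then show ?thesis using assms(1) by (simp add: L2_def set_borel_measurable_def set_integrable_def)
qed

lemma L2_cmult: "f \<in> L2 S \<Longrightarrow> (\<lambda>x. c * f x) \<in> L2 S"
proof -
  assume f: "f \<in> L2 S"
  have "(\<lambda>x. c * (indicator S x * f x)) \<in> borel_measurable lebesgue"
    by (rule borel_measurable_times[OF borel_measurable_const L2_meas[OF f]])
  moreover have "set_integrable lebesgue S (\<lambda>x. c\<^sup>2 * (f x)\<^sup>2)"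
    using f by (intro set_integrable_mult_right) (simp add: L2_def)
  ultimately show ?thesis by (intro L2_I[where g = "\<lambda>x. c\<^sup>2 * (f x)\<^sup>2"]) (auto simp: power_mult_distrib ac_simps)
qed

lemma L2_add:
  assumes "f \<in> L2 S" "g \<in> L2 S"
  shows "(\<lambda>x. f x + g x) \<in> L2 S"
proof (rule L2_I)
  have "(\<lambda>x. indicator S x * f x + indicator S x * g x) \<in> borel_measurable lebesgue"
    by (intro borel_measurable_add L2_meas assms)
  then show "(\<lambda>x. indicator S x * (f x + g x)) \<in> borel_measurable lebesgue" by (simp add: algebra_simps)
  show "set_integrable lebesgue S (\<lambda>x. (f x)\<^sup>2 + 2 * (f x * g x) + (g x)\<^sup>2)"
    using assms by (intro set_integral_add set_integrable_mult_right L2_mult_integrable) (simp_all add: L2_def)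
  show "(f x + g x)\<^sup>2 \<le> (f x)\<^sup>2 + 2 * (f x * g x) + (g x)\<^sup>2" for x
    by (simp add: power2_sum algebra_simps)
qed

lemma L2_diff:
  assumes "f \<in> L2 S" "g \<in> L2 S"
  shows "(\<lambda>x. f x - g x) \<in> L2 S"
  using L2_add[OF assms(1) L2_cmult[OF assms(2), of "-1"]] by simp

lemma L2_cong_AE:
  assumes f: "f \<in> L2 S" and ae: "AE x in lebesgue. x \<in> S \<longrightarrow> f x = g x"
  shows "g \<in> L2 S"
proof -
  have "AE x in lebesgue. indicator S x * f x = indicator S x * g x"
    using ae by eventually_elim (auto simp: indicator_def)
  then have m: "(\<lambda>x. indicator S x * g x) \<in> borel_measurable lebesgue"
    by (rule borel_measurable_AE[OF L2_meas[OF f]])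
  have "AE x in lebesgue. x \<in> S \<longrightarrow> (f x)\<^sup>2 = (g x)\<^sup>2" using ae by eventually_elim auto
  then have "set_integrable lebesgue S (\<lambda>x. (g x)\<^sup>2)"
    by (rule AE_set_integral_cong(1)) (use f in \<open>simp add: L2_def\<close>)
  then show ?thesis using m by (simp add: L2_def set_borel_measurable_def)
qed

lemma norm_L2_cong_AE:
  assumes ae: "AE x in lebesgue. x \<in> S \<longrightarrow> f x = g x" and f: "f \<in> L2 S"
  shows "norm_L2 S f = norm_L2 S g"
proof -
  have "AE x in lebesgue. x \<in> S \<longrightarrow> (f x)\<^sup>2 = (g x)\<^sup>2" using ae by eventually_elim auto
  then have "(LINT x:S|lebesgue. (g x)\<^sup>2) = (LINT x:S|lebesgue. (f x)\<^sup>2)"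
    by (rule AE_set_integral_cong(2)) (use f in \<open>simp add: L2_def\<close>)
  then show ?thesis by (simp add: norm_L2_def)
qed

lemma ip_self: "ip S f f = (norm_L2 S f)\<^sup>2"
proof -
  have "0 \<le> (LINT x:S|lebesgue. (f x)\<^sup>2)"
    unfolding set_lebesgue_integral_def by (rule Bochner_Integration.integral_nonneg) (simp add: indicator_def)
  then show ?thesis by (simp add: ip_def norm_L2_def power2_eq_square)
qed

lemma norm_L2_nonneg: "norm_L2 S f \<ge> 0"
  unfolding norm_L2_def set_lebesgue_integral_def
  by (intro real_sqrt_ge_zero Bochner_Integration.integral_nonneg) (simp add: indicator_def)

lemma ip_commute: "ip S f g = ip S g f"
  by (simp add: ip_def mult.commute)

lemma ip_add_left: "f \<in> L2 S \<Longrightarrow> g \<in> L2 S \<Longrightarrow> h \<in> L2 S \<Longrightarrow> ip S (\<lambda>x. f x + g x) h = ip S f h + ip S g h"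
  unfolding ip_def distrib_right by (rule set_integral_add(2)) (rule L2_mult_integrable; assumption)+

lemma ip_cmult_left: "ip S (\<lambda>x. c * f x) h = c * ip S f h"
  by (simp add: ip_def mult.assoc)

lemma ip_diff_left: "f \<in> L2 S \<Longrightarrow> g \<in> L2 S \<Longrightarrow> h \<in> L2 S \<Longrightarrow> ip S (\<lambda>x. f x - g x) h = ip S f h - ip S g h"
  unfolding ip_def left_diff_distrib by (rule set_integral_diff(2)) (rule L2_mult_integrable; assumption)+

lemma ip_diff_right:
  assumes "f \<in> L2 S" "g \<in> L2 S" "h \<in> L2 S"
  shows "ip S h (\<lambda>x. f x - g x) = ip S h f - ip S h g"
  by (simp only: ip_commute[of S h] ip_diff_left[OF assms])

lemma norm_L2_cmult: "norm_L2 S (\<lambda>x. c * f x) = \<bar>c\<bar> * norm_L2 S f"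
  by (simp add: norm_L2_def power_mult_distrib real_sqrt_mult)

lemma ip_Cauchy_Schwarz:
  assumes f: "f \<in> L2 S" and g: "g \<in> L2 S"
  shows "\<bar>ip S f g\<bar> \<le> norm_L2 S f * norm_L2 S g"
proof -
  let ?A = "ip S f f" and ?B = "ip S f g" and ?C = "ip S g g"
  have q: "0 \<le> ?A + 2 * t * ?B + t\<^sup>2 * ?C" for t
  proof -
    have tg: "(\<lambda>x. t * g x) \<in> L2 S" by (rule L2_cmult[OF g])
    have s: "(\<lambda>x. f x + t * g x) \<in> L2 S" by (rule L2_add[OF f tg])
    have "ip S (\<lambda>x. f x + t * g x) (\<lambda>x. f x + t * g x)
        = ip S (\<lambda>x. f x + t * g x) f + t * ip S (\<lambda>x. f x + t * g x) g"
      using ip_add_left[OF f tg s] ip_cmult_left ip_commute by metis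
    also have "\<dots> = (?A + t * ip S g f) + t * (?B + t * ?C)"
      by (simp add: ip_add_left[OF f tg f] ip_add_left[OF f tg g] ip_cmult_left)
    also have "\<dots> = ?A + 2 * t * ?B + t\<^sup>2 * ?C"
      by (simp add: ip_commute[of S g f] power2_eq_square algebra_simps)
    finally show ?thesis by (metis ip_self zero_le_power2)
  qed
  have "?B\<^sup>2 \<le> ?A * ?C"
  proof (cases "?C = 0")
    case True
    have "?B = 0"
    proof (rule ccontr)
      assume B: "?B \<noteq> 0"
      \<comment> \<open>Without the quadratic term this choice of t would give the nonnegative
        expression the value -1.\<close>
      have "?A + 2 * (- (?A + 1) / (2 * ?B)) * ?B = -1" using B by (simp add: field_simps)
      then show False using q[of "- (?A + 1) / (2 * ?B)"] True by simp
    qed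
    then show ?thesis using True by simp
  next
    case False
    then have C: "?C > 0" using ip_self[of S g] by (simp add: order_less_le)
    have "?A + 2 * (- ?B / ?C) * ?B + (- ?B / ?C)\<^sup>2 * ?C = ?A - ?B\<^sup>2 / ?C"
      using C by (simp add: power2_eq_square field_simps)
    then have "?B\<^sup>2 / ?C \<le> ?A" using q[of "- ?B / ?C"] by simp
    then show ?thesis using C by (simp add: field_simps)
  qed
  then have "?B\<^sup>2 \<le> (norm_L2 S f * norm_L2 S g)\<^sup>2" by (simp add: ip_self power_mult_distrib)
  then show ?thesis
    using norm_L2_nonneg by (metis abs_le_square_iff abs_of_nonneg mult_nonneg_nonneg)
qed

lemma norm_L2_triangle:
  assumes f: "f \<in> L2 S" and g: "g \<in> L2 S"
  shows "norm_L2 S (\<lambda>x. f x + g x) \<le> norm_L2 S f + norm_L2 S g"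
proof (rule power2_le_imp_le)
  have s: "(\<lambda>x. f x + g x) \<in> L2 S" by (rule L2_add[OF f g])
  have "(norm_L2 S (\<lambda>x. f x + g x))\<^sup>2 = ip S (\<lambda>x. f x + g x) f + ip S (\<lambda>x. f x + g x) g"
    using ip_add_left[OF f g s] ip_commute ip_self by metis
  also have "\<dots> = (norm_L2 S f)\<^sup>2 + 2 * ip S f g + (norm_L2 S g)\<^sup>2"
    by (simp add: ip_add_left[OF f g f] ip_add_left[OF f g g] ip_self ip_commute[of S g f])
  also have "\<dots> \<le> (norm_L2 S f)\<^sup>2 + 2 * (norm_L2 S f * norm_L2 S g) + (norm_L2 S g)\<^sup>2"
    using ip_Cauchy_Schwarz[OF f g] by simp
  also have "\<dots> = (norm_L2 S f + norm_L2 S g)\<^sup>2" by (simp add: power2_sum)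
  finally show "(norm_L2 S (\<lambda>x. f x + g x))\<^sup>2 \<le> (norm_L2 S f + norm_L2 S g)\<^sup>2" .
qed (simp add: norm_L2_nonneg)

lemma norm_L2_diff_ge:
  assumes f: "f \<in> L2 S" and g: "g \<in> L2 S"
  shows "\<bar>norm_L2 S f - norm_L2 S g\<bar> \<le> norm_L2 S (\<lambda>x. f x - g x)"
proof -
  have "norm_L2 S f \<le> norm_L2 S (\<lambda>x. f x - g x) + norm_L2 S g"
    using norm_L2_triangle[OF L2_diff[OF f g] g] by simp
  moreover have "norm_L2 S g \<le> norm_L2 S (\<lambda>x. g x - f x) + norm_L2 S f"
    using norm_L2_triangle[OF L2_diff[OF g f] f] by simp
  moreover have "norm_L2 S (\<lambda>x. g x - f x) = norm_L2 S (\<lambda>x. f x - g x)"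
    by (simp add: norm_L2_def power2_commute)
  ultimately show ?thesis by simp
qed

lemma L2_weight:
  assumes f: "f \<in> L2 S" and \<phi>: "continuous_on UNIV \<phi>" "\<And>x. x \<in> S \<Longrightarrow> \<bar>\<phi> x\<bar> \<le> 1"
  shows "(\<lambda>x. \<phi> x * f x) \<in> L2 S" "norm_L2 S (\<lambda>x. \<phi> x * f x) \<le> norm_L2 S f"
proof -
  have pt: "(\<phi> x * f x)\<^sup>2 \<le> (f x)\<^sup>2" if "x \<in> S" for x
    using \<phi>(2)[OF that] by (simp add: power_mult_distrib mult_left_le_one_le abs_square_le_1)
  have i: "set_integrable lebesgue S (\<lambda>x. (f x)\<^sup>2)" using f by (simp add: L2_def)
  show *: "(\<lambda>x. \<phi> x * f x) \<in> L2 S"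
  proof (rule L2_I[OF _ i pt])
    have "(\<lambda>x. \<phi> x * (indicator S x * f x)) \<in> borel_measurable lebesgue"
      by (rule borel_measurable_times[OF measurable_completion L2_meas[OF f]])
        (simp add: borel_measurable_continuous_onI \<phi>(1))
    then show "(\<lambda>x. indicator S x * (\<phi> x * f x)) \<in> borel_measurable lebesgue" by (simp add: ac_simps)
  qed
  show "norm_L2 S (\<lambda>x. \<phi> x * f x) \<le> norm_L2 S f"
    unfolding norm_L2_def
    by (intro real_sqrt_le_mono set_integral_mono i pt) (use * in \<open>simp add: L2_def\<close>)
qed

lemma ip_tendsto:
  assumes f: "\<forall>\<^sub>F s in F. f s \<in> L2 S" "f0 \<in> L2 S" "((\<lambda>s. norm_L2 S (\<lambda>x. f s x - f0 x)) \<longlongrightarrow> 0) F"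
    and g: "\<forall>\<^sub>F s in F. g s \<in> L2 S" "g0 \<in> L2 S" "((\<lambda>s. norm_L2 S (\<lambda>x. g s x - g0 x)) \<longlongrightarrow> 0) F"
  shows "((\<lambda>s. ip S (f s) (g s)) \<longlongrightarrow> ip S f0 g0) F"
proof (rule LIM_zero_cancel, rule Lim_null_comparison)
  let ?a = "\<lambda>s. norm_L2 S (\<lambda>x. f s x - f0 x)" and ?b = "\<lambda>s. norm_L2 S (\<lambda>x. g s x - g0 x)"
  show "((\<lambda>s. ?a s * (?b s + norm_L2 S g0) + norm_L2 S f0 * ?b s) \<longlongrightarrow> 0) F"
    using f(3) g(3) by (auto intro!: tendsto_eq_intros)
  show "\<forall>\<^sub>F s in F. norm (ip S (f s) (g s) - ip S f0 g0) \<le> ?a s * (?b s + norm_L2 S g0) + norm_L2 S f0 * ?b s"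
    using f(1) g(1)
  proof eventually_elim
    case (elim s)
    have d: "(\<lambda>x. f s x - f0 x) \<in> L2 S" "(\<lambda>x. g s x - g0 x) \<in> L2 S"
      using L2_diff elim f(2) g(2) by auto
    have "ip S (f s) (g s) - ip S f0 g0 = ip S (\<lambda>x. f s x - f0 x) (g s) + ip S f0 (\<lambda>x. g s x - g0 x)"
      using elim f(2) g(2) by (simp add: ip_diff_left ip_diff_right)
    moreover have "\<bar>ip S (\<lambda>x. f s x - f0 x) (g s)\<bar> \<le> ?a s * (?b s + norm_L2 S g0)"
    proof -
      have "norm_L2 S (g s) \<le> ?b s + norm_L2 S g0" using norm_L2_triangle[OF d(2) g(2)] by simp
      then show ?thesis
        using ip_Cauchy_Schwarz[OF d(1) elim(2)] mult_left_mono[OF _ norm_L2_nonneg] by (meson order_trans)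
    qed
    moreover have "\<bar>ip S f0 (\<lambda>x. g s x - g0 x)\<bar> \<le> norm_L2 S f0 * ?b s"
      by (rule ip_Cauchy_Schwarz[OF f(2) d(2)])
    ultimately show ?case by simp
  qed
qed

lemma mult_divide_diff: "(a::real) * ((b - c) / d) = (1 / d) * (a * b - a * c)"
  by (metis right_diff_distrib mult.commute mult.left_commute times_divide_eq_left mult_1 divide_inverse)

lemma diff_divide_eq_mult: "(b - c) / d = (1 / d) * (b - c :: real)"
  by simp

lemma add_divide_telescope: "(1 / d) * (a - b) + (1 / d) * (b - c) = (a - c :: real) / d"
proof -
  have "(1 / d) * (a - b) + (1 / d) * (b - c) = (1 / d) * ((a - b) + (b - c))"
    by (rule distrib_left[symmetric])
  also have "(a - b) + (b - c) = a - c" by simp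
  finally show ?thesis by simp
qed

text \<open>The product rule: the difference quotient splits into a quotient of \<open>P\<close>
  paired with \<open>U\<close> at time s, and \<open>P\<close> at time t paired with a quotient of
  \<open>U\<close>. The weight is 1 for the energy and 2 x - 1 for the multiplier.\<close>

lemma ip_has_derivative:
  assumes P: "curve_C1_L2 T P P'" and U: "curve_C1_L2 T U U'"
    and \<phi>: "continuous_on UNIV \<phi>" "\<And>x. x \<in> {0<..<1} \<Longrightarrow> \<bar>\<phi> x\<bar> \<le> 1" and t: "t \<in> {0..T}"
  shows "((\<lambda>s. ip {0<..<1} (\<lambda>x. \<phi> x * P s x) (U s)) has_real_derivative
      ip {0<..<1} (\<lambda>x. \<phi> x * P' t x) (U t) + ip {0<..<1} (\<lambda>x. \<phi> x * P t x) (U' t)) (at t within {0..T})"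
proof -
  let ?I = "{0<..<1::real}" and ?F = "at t within {0..T}"
  have PL: "P s \<in> L2 ?I" "U s \<in> L2 ?I" "P' s \<in> L2 ?I" "U' s \<in> L2 ?I" if "s \<in> {0..T}" for s
    using P U that by (auto simp: curve_C1_L2_def curve_C_L2_def)
  have ev: "\<forall>\<^sub>F s in ?F. s \<in> {0..T} \<and> s \<noteq> t" by (auto simp: eventually_at_filter)
  have Pt: "P t \<in> L2 ?I" "U t \<in> L2 ?I" "P' t \<in> L2 ?I" "U' t \<in> L2 ?I" using PL[OF t] by auto
  let ?dP = "\<lambda>s x. (P s x - P t x) / (s - t)" and ?dU = "\<lambda>s x. (U s x - U t x) / (s - t)"
  have dL: "?dP s \<in> L2 ?I" "?dU s \<in> L2 ?I" if "s \<in> {0..T}" for s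
    using L2_cmult[OF L2_diff[OF PL(1)[OF that] Pt(1)], of "1 / (s - t)"]
      L2_cmult[OF L2_diff[OF PL(2)[OF that] Pt(2)], of "1 / (s - t)"] by simp_all
  have limP: "((\<lambda>s. norm_L2 ?I (\<lambda>x. ?dP s x - P' t x)) \<longlongrightarrow> 0) ?F"
    and limU: "((\<lambda>s. norm_L2 ?I (\<lambda>x. ?dU s x - U' t x)) \<longlongrightarrow> 0) ?F"
    and limU0: "((\<lambda>s. norm_L2 ?I (\<lambda>x. U s x - U t x)) \<longlongrightarrow> 0) ?F"
    using P U t unfolding curve_C1_L2_def curve_C_L2_def by blast+
  have \<phi>L: "(\<lambda>x. \<phi> x * f x) \<in> L2 ?I" "norm_L2 ?I (\<lambda>x. \<phi> x * f x) \<le> norm_L2 ?I f"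
    if "f \<in> L2 ?I" for f
    by (rule L2_weight(1)[OF that \<phi>], assumption, rule L2_weight(2)[OF that \<phi>], assumption)
  have lim\<phi>P: "((\<lambda>s. norm_L2 ?I (\<lambda>x. \<phi> x * ?dP s x - \<phi> x * P' t x)) \<longlongrightarrow> 0) ?F"
  proof (rule Lim_null_comparison[OF eventually_mono[OF ev] limP])
    fix s assume s: "s \<in> {0..T} \<and> s \<noteq> t"
    have "norm_L2 ?I (\<lambda>x. \<phi> x * (?dP s x - P' t x)) \<le> norm_L2 ?I (\<lambda>x. ?dP s x - P' t x)"
      by (rule \<phi>L(2)[OF L2_diff[OF dL(1)[OF conjunct1[OF s]] Pt(3)]])
    then show "norm (norm_L2 ?I (\<lambda>x. \<phi> x * ?dP s x - \<phi> x * P' t x)) \<le> norm_L2 ?I (\<lambda>x. ?dP s x - P' t x)"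
      by (simp only: right_diff_distrib real_norm_def abs_of_nonneg[OF norm_L2_nonneg])
  qed
  have ev\<phi>P: "\<forall>\<^sub>F s in ?F. (\<lambda>x. \<phi> x * ?dP s x) \<in> L2 ?I"
    by (rule eventually_mono[OF ev]) (rule \<phi>L(1)[OF dL(1)[OF conjunct1]])
  have evU0: "\<forall>\<^sub>F s in ?F. U s \<in> L2 ?I"
    by (rule eventually_mono[OF ev]) (rule PL(2)[OF conjunct1])
  have l1: "((\<lambda>s. ip ?I (\<lambda>x. \<phi> x * ?dP s x) (U s)) \<longlongrightarrow> ip ?I (\<lambda>x. \<phi> x * P' t x) (U t)) ?F"
    by (rule ip_tendsto[where f = "\<lambda>s x. \<phi> x * ?dP s x", OF ev\<phi>P \<phi>L(1)[OF Pt(3)] lim\<phi>P evU0 Pt(2) limU0])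
  have evU: "\<forall>\<^sub>F s in ?F. ?dU s \<in> L2 ?I"
    by (rule eventually_mono[OF ev]) (rule dL(2)[OF conjunct1])
  have fP: "(\<lambda>x. \<phi> x * P t x) \<in> L2 ?I" by (rule \<phi>L(1)[OF Pt(1)])
  have "\<forall>\<^sub>F s in ?F. (\<lambda>x. \<phi> x * P t x) \<in> L2 ?I" using fP by simp
  moreover have "((\<lambda>s. norm_L2 ?I (\<lambda>x. \<phi> x * P t x - \<phi> x * P t x)) \<longlongrightarrow> 0) ?F"
    by (simp add: norm_L2_def set_lebesgue_integral_def)
  ultimately have l2: "((\<lambda>s. ip ?I (\<lambda>x. \<phi> x * P t x) (?dU s)) \<longlongrightarrow> ip ?I (\<lambda>x. \<phi> x * P t x) (U' t)) ?F"
    by (rule ip_tendsto[where f = "\<lambda>s x. \<phi> x * P t x", OF _ fP _ evU Pt(4) limU])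
  show ?thesis
    unfolding has_field_derivative_iff
  proof (rule Lim_transform_eventually[OF tendsto_add[OF l1 l2]])
    show "\<forall>\<^sub>F s in ?F. ip ?I (\<lambda>x. \<phi> x * ?dP s x) (U s) + ip ?I (\<lambda>x. \<phi> x * P t x) (?dU s)
        = (ip ?I (\<lambda>x. \<phi> x * P s x) (U s) - ip ?I (\<lambda>x. \<phi> x * P t x) (U t)) / (s - t)"
      using ev
    proof eventually_elim
      case (elim s)
      then have s: "s \<in> {0..T}" "s - t \<noteq> 0" by auto
      have 1: "ip ?I (\<lambda>x. \<phi> x * ?dP s x) (U s)
          = (1 / (s - t)) * (ip ?I (\<lambda>x. \<phi> x * P s x) (U s) - ip ?I (\<lambda>x. \<phi> x * P t x) (U s))"
      proof -
        have eq: "(\<lambda>x. \<phi> x * ?dP s x) = (\<lambda>x. (1 / (s - t)) * (\<phi> x * P s x - \<phi> x * P t x))"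
          by (rule ext, rule mult_divide_diff)
        show ?thesis
          by (simp only: eq ip_cmult_left ip_diff_left[OF \<phi>L(1)[OF PL(1)[OF s(1)]] fP PL(2)[OF s(1)]])
      qed
      have 2: "ip ?I (\<lambda>x. \<phi> x * P t x) (?dU s)
          = (1 / (s - t)) * (ip ?I (\<lambda>x. \<phi> x * P t x) (U s) - ip ?I (\<lambda>x. \<phi> x * P t x) (U t))"
      proof -
        have eq: "?dU s = (\<lambda>x. (1 / (s - t)) * (U s x - U t x))" by (rule ext, rule diff_divide_eq_mult)
        have "ip ?I (?dU s) (\<lambda>x. \<phi> x * P t x)
            = (1 / (s - t)) * (ip ?I (U s) (\<lambda>x. \<phi> x * P t x) - ip ?I (U t) (\<lambda>x. \<phi> x * P t x))"
          unfolding eq ip_cmult_left ip_diff_left[OF PL(2)[OF s(1)] Pt(2) fP] ..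
        then show ?thesis by (simp only: ip_commute[of ?I "\<lambda>x. \<phi> x * P t x"])
      qed
      show ?case by (simp only: 1 2 add_divide_telescope)
    qed
  qed
qed

subsection \<open>Energy and trace estimates for the linear wave system\<close>

lemma integrable_Icc_iff_Ioo:
  fixes f :: "real \<Rightarrow> real"
  shows "set_integrable lebesgue {a..b} f \<longleftrightarrow> set_integrable lebesgue {a<..<b} f"
  by (rule absolutely_integrable_on_Icc_iff_Ioo)

lemma continuous_L2:
  assumes "continuous_on {a..b} f"
  shows "f \<in> L2 {a<..<b}"
proof -
  have i: "set_integrable lebesgue {a<..<b} g" if "continuous_on {a..b} g" for g :: "real \<Rightarrow> real"
    using L1_locD[OF L1_loc_continuous[OF that], of a b] by (simp add: integrable_Icc_iff_Ioo)
  have "(\<lambda>x. indicator {a<..<b} x *\<^sub>R f x) \<in> borel_measurable lebesgue"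
    using i[OF assms] unfolding set_integrable_def by (rule borel_measurable_integrable)
  then show ?thesis
    by (intro L2_I[OF _ i[OF continuous_on_power[OF assms, of 2]]]) auto
qed

lemma L2_imp_integrable: "f \<in> L2 {a<..<b} \<Longrightarrow> set_integrable lebesgue {a..b} f"
  using L2_mult_integrable[OF _ continuous_L2[of a b "\<lambda>_. 1"], of f]
  by (simp add: integrable_Icc_iff_Ioo)

lemma ip_Ioo_eq_integral:
  assumes "f \<in> L2 {a<..<b}" "g \<in> L2 {a<..<b}"
  shows "ip {a<..<b} f g = integral {a..b} (\<lambda>x. f x * g x)" "(\<lambda>x. f x * g x) integrable_on {a..b}"
proof -
  have i: "set_integrable lebesgue {a<..<b} (\<lambda>x. f x * g x)" by (rule L2_mult_integrable[OF assms])
  show "ip {a<..<b} f g = integral {a..b} (\<lambda>x. f x * g x)"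
    unfolding ip_def set_lebesgue_integral_eq_integral(2)[OF i] by (rule integral_open_interval_real[symmetric])
  show "(\<lambda>x. f x * g x) integrable_on {a..b}"
    using i by (intro set_lebesgue_integral_eq_integral(1)) (simp add: integrable_Icc_iff_Ioo)
qed

lemma ip_cong_AE:
  assumes "AE x in lebesgue. x \<in> S \<longrightarrow> f x = g x" "f \<in> L2 S" "h \<in> L2 S"
  shows "ip S f h = ip S g h"
  unfolding ip_def
proof (rule AE_set_integral_cong(2)[symmetric])
  show "AE x in lebesgue. x \<in> S \<longrightarrow> f x * h x = g x * h x"
    using assms(1) by eventually_elim auto
qed (rule L2_mult_integrable[OF assms(2,3)])

lemma ip_cong:
  assumes "\<And>x. x \<in> S \<Longrightarrow> f x = f' x" "\<And>x. x \<in> S \<Longrightarrow> g x = g' x"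
  shows "ip S f g = ip S f' g'"
  unfolding ip_def set_lebesgue_integral_def
  by (rule Bochner_Integration.integral_cong) (simp_all add: indicator_def assms)

lemma ip_weight_swap: "ip S (\<lambda>x. w x * f x) g = ip S (\<lambda>x. w x * g x) f"
proof -
  have "(\<lambda>x. w x * f x * g x) = (\<lambda>x. w x * g x * f x)"
    by (rule ext) (simp only: mult.assoc mult.commute[of "f _"])
  then show ?thesis unfolding ip_def by (rule arg_cong)
qed

lemma double_neg_le: "- a \<le> b \<Longrightarrow> (-2) * b \<le> 2 * a" for a b :: real
  by linarith

lemma ip_integration_by_parts:
  assumes F: "primitive_on {a..b} F f" and G: "primitive_on {a..b} G g"
    and f: "f \<in> L2 {a<..<b}" and g: "g \<in> L2 {a<..<b}" and ab: "a \<le> b"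
  shows "ip {a<..<b} f G + ip {a<..<b} F g = F b * G b - F a * G a"
proof -
  have FL: "F \<in> L2 {a<..<b}" "G \<in> L2 {a<..<b}"
    by (rule continuous_L2[OF primitive_on_continuous[OF F]], rule continuous_L2[OF primitive_on_continuous[OF G]])
  have "ip {a<..<b} f G + ip {a<..<b} F g = integral {a..b} (\<lambda>x. F x * g x) + integral {a..b} (\<lambda>x. f x * G x)"
    by (simp only: ip_Ioo_eq_integral(1)[OF f FL(2)] ip_Ioo_eq_integral(1)[OF FL(1) g] add.commute)
  also have "\<dots> = integral {a..b} (\<lambda>x. F x * g x + f x * G x)"
    by (rule Henstock_Kurzweil_Integration.integral_add[OF ip_Ioo_eq_integral(2)[OF FL(1) g]
          ip_Ioo_eq_integral(2)[OF f FL(2)], symmetric])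
  also have "\<dots> = F b * G b - F a * G a"
    by (rule integration_by_parts_primitive[OF F G ab, symmetric])
  finally show ?thesis .
qed

lemma DERIV_nonpos_decreasing_within:
  fixes f f' :: "real \<Rightarrow> real"
  assumes "a \<le> b" and D: "\<And>x. x \<in> {a..b} \<Longrightarrow> (f has_real_derivative f' x) (at x within {a..b})"
    and le: "\<And>x. x \<in> {a<..<b} \<Longrightarrow> f' x \<le> 0"
  shows "f b \<le> f a"
proof -
  have c: "continuous_on {a..b} f"
    unfolding continuous_on_eq_continuous_within using DERIV_continuous[OF D] by blast
  have d: "\<exists>y. DERIV f x :> y \<and> y \<le> 0" if x: "a < x" "x < b" for x
  proof (intro exI conjI)
    have xin: "x \<in> {a..b}" "x \<in> {a<..<b}" using x by simp_all
    show "(f has_real_derivative f' x) (at x)" using D[OF xin(1)] unfolding at_within_Icc_at[OF x] .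
    show "f' x \<le> 0" by (rule le[OF xin(2)])
  qed
  show ?thesis by (rule DERIV_nonpos_imp_decreasing_open[OF assms(1) d c])
qed

abbreviation I01 :: "real set" where "I01 \<equiv> {0<..<1}"

text \<open>\<open>P\<close> and \<open>U\<close> stand for the differences of two states and
  \<open>f\<close> for the difference of their nonlinear terms. Apart from its continuity in space,
  \<open>f\<close> enters through two inequalities: monotonicity in \<open>U\<close> and linear
  growth, both up to \<epsilon>.\<close>

locale linear_wave =
  fixes T \<epsilon> A :: real and P P' Px U U' Ux f :: "real \<Rightarrow> real \<Rightarrow> real"
  assumes T: "T > 0" and \<epsilon>: "\<epsilon> \<ge> 0" and A: "A \<ge> 0"
    and PC: "curve_C1_L2 T P P'" and UC: "curve_C1_L2 T U U'"
    and Pprim: "\<And>t. t \<in> {0<..<T} \<Longrightarrow> primitive_on {0..1} (P t) (Px t)"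
    and Uprim: "\<And>t. t \<in> {0<..<T} \<Longrightarrow> primitive_on {0..1} (U t) (Ux t)"
    and PxL: "\<And>t. t \<in> {0<..<T} \<Longrightarrow> Px t \<in> L2 I01"
    and UxL: "\<And>t. t \<in> {0<..<T} \<Longrightarrow> Ux t \<in> L2 I01"
    and eqP: "\<And>t. t \<in> {0<..<T} \<Longrightarrow> AE x in lebesgue. x \<in> I01 \<longrightarrow> P' t x = - Ux t x"
    and eqU: "\<And>t. t \<in> {0<..<T} \<Longrightarrow> AE x in lebesgue. x \<in> I01 \<longrightarrow> U' t x = - Px t x - f t x"
    and bc: "\<And>t. t \<in> {0<..<T} \<Longrightarrow> U t 0 = 0 \<and> U t 1 = 0"
    and ic: "\<And>x. x \<in> I01 \<Longrightarrow> P 0 x = 0 \<and> U 0 x = 0"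
    and fc: "\<And>t. t \<in> {0<..<T} \<Longrightarrow> continuous_on {0..1} (f t)"
    and f_mono: "\<And>t x. t \<in> {0<..<T} \<Longrightarrow> x \<in> I01 \<Longrightarrow> - (\<epsilon> * \<bar>U t x\<bar>) \<le> U t x * f t x"
    and f_bound: "\<And>t x. t \<in> {0<..<T} \<Longrightarrow> x \<in> I01 \<Longrightarrow> \<bar>f t x\<bar> \<le> A * \<bar>U t x\<bar> + \<epsilon>"
begin

definition E :: "real \<Rightarrow> real" where "E t = ip I01 (P t) (P t) + ip I01 (U t) (U t)"

lemma memL2: "t \<in> {0..T} \<Longrightarrow> P t \<in> L2 I01 \<and> U t \<in> L2 I01 \<and> P' t \<in> L2 I01 \<and> U' t \<in> L2 I01"
  using PC UC unfolding curve_C1_L2_def curve_C_L2_def by blast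

lemma fL2: "t \<in> {0<..<T} \<Longrightarrow> f t \<in> L2 I01"
  by (rule continuous_L2[OF fc])

lemma E_deriv:
  assumes t: "t \<in> {0..T}"
  shows "(E has_real_derivative 2 * (ip I01 (P' t) (P t) + ip I01 (U' t) (U t))) (at t within {0..T})"
proof -
  have 1: "continuous_on UNIV (\<lambda>_::real. 1::real)" "\<And>x. x \<in> I01 \<Longrightarrow> \<bar>1::real\<bar> \<le> 1" by simp_all
  have d: "((\<lambda>s. ip I01 (V s) (V s)) has_real_derivative 2 * ip I01 (V' t) (V t)) (at t within {0..T})"
    if "curve_C1_L2 T V V'" for V V'
    using ip_has_derivative[OF that that 1 t] by (simp add: ip_commute[of _ "V t"])
  show ?thesis
    unfolding E_def[abs_def] distrib_left by (rule DERIV_add[OF d[OF PC] d[OF UC]])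
qed

lemma E_deriv_le:
  assumes t: "t \<in> {0<..<T}"
  shows "2 * (ip I01 (P' t) (P t) + ip I01 (U' t) (U t)) \<le> E t + \<epsilon>\<^sup>2"
proof -
  have t': "t \<in> {0..T}" using t by simp
  have L: "P t \<in> L2 I01" "U t \<in> L2 I01" "P' t \<in> L2 I01" "U' t \<in> L2 I01" using memL2[OF t'] by auto
  note Lx = PxL[OF t] UxL[OF t] fL2[OF t]
  have "ip I01 (P' t) (P t) = ip I01 (\<lambda>x. (-1) * Ux t x) (P t)"
  proof (rule ip_cong_AE[OF _ L(3) L(1)])
    show "AE x in lebesgue. x \<in> I01 \<longrightarrow> P' t x = (-1) * Ux t x"
      using eqP[OF t] by (rule eventually_mono) simp
  qed
  also have "\<dots> = (-1) * ip I01 (Ux t) (P t)" by (rule ip_cmult_left)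
  finally have 1: "ip I01 (P' t) (P t) = - ip I01 (Ux t) (P t)" by simp
  have nP: "(\<lambda>x. (-1) * Px t x) \<in> L2 I01" by (rule L2_cmult[OF Lx(1)])
  have "ip I01 (U' t) (U t) = ip I01 (\<lambda>x. (-1) * Px t x - f t x) (U t)"
  proof (rule ip_cong_AE[OF _ L(4) L(2)])
    show "AE x in lebesgue. x \<in> I01 \<longrightarrow> U' t x = (-1) * Px t x - f t x"
      using eqU[OF t] by (rule eventually_mono) simp
  qed
  also have "\<dots> = - ip I01 (Px t) (U t) - ip I01 (f t) (U t)"
    unfolding ip_diff_left[OF nP Lx(3) L(2)] ip_cmult_left by simp
  finally have 2: "ip I01 (U' t) (U t) = - ip I01 (Px t) (U t) - ip I01 (f t) (U t)" .
  \<comment> \<open>Integration by parts leaves only boundary terms, which vanish with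
    \<open>U\<close>.\<close>
  have 3: "ip I01 (Px t) (U t) + ip I01 (P t) (Ux t) = 0"
    using ip_integration_by_parts[OF Pprim[OF t] Uprim[OF t] Lx(1,2)] bc[OF t] by simp
  have one: "(\<lambda>_. 1) \<in> L2 I01" by (rule continuous_L2) simp
  have c: "(\<lambda>x. \<epsilon>\<^sup>2) \<in> L2 I01" by (rule continuous_L2) simp
  have "- 2 * ip I01 (f t) (U t) = (LINT x:I01|lebesgue. (-2) * (f t x * U t x))"
    unfolding ip_def by (rule set_integral_mult_right[symmetric])
  also have "\<dots> \<le> (LINT x:I01|lebesgue. \<epsilon>\<^sup>2 * 1 + U t x * U t x)"
  proof (rule set_integral_mono)
    show "set_integrable lebesgue I01 (\<lambda>x. (-2) * (f t x * U t x))"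
      by (intro set_integrable_mult_right L2_mult_integrable Lx L)
    show "set_integrable lebesgue I01 (\<lambda>x. \<epsilon>\<^sup>2 * 1 + U t x * U t x)"
      by (intro set_integral_add(1) L2_mult_integrable c one L)
    fix x assume x: "x \<in> I01"
    \<comment> \<open>Young's inequality trades the error in the monotonicity for \<epsilon> squared
      and a part of the energy.\<close>
    have "2 * \<epsilon> * \<bar>U t x\<bar> \<le> \<epsilon>\<^sup>2 + \<bar>U t x\<bar>\<^sup>2" by (rule sum_squares_bound)
    then have "2 * (\<epsilon> * \<bar>U t x\<bar>) \<le> \<epsilon>\<^sup>2 + U t x * U t x"
      unfolding power2_abs power2_eq_square[of "U t x"] mult.assoc .
    moreover have "(-2) * (f t x * U t x) \<le> 2 * (\<epsilon> * \<bar>U t x\<bar>)"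
      unfolding mult.commute[of "f t x" "U t x"] by (rule double_neg_le[OF f_mono[OF t x]])
    ultimately show "(-2) * (f t x * U t x) \<le> \<epsilon>\<^sup>2 * 1 + U t x * U t x"
      unfolding mult_1_right by (rule order_trans[rotated])
  qed
  also have "\<dots> = ip I01 (\<lambda>_. \<epsilon>\<^sup>2) (\<lambda>_. 1) + ip I01 (U t) (U t)"
    unfolding ip_def by (rule set_integral_add(2)) (intro L2_mult_integrable c one L)+
  also have "ip I01 (\<lambda>_. \<epsilon>\<^sup>2) (\<lambda>_. 1) = \<epsilon>\<^sup>2"
    using ip_Ioo_eq_integral(1)[OF c one] by simp
  finally have "- 2 * ip I01 (f t) (U t) \<le> \<epsilon>\<^sup>2 + ip I01 (U t) (U t)" .
  moreover have "ip I01 (P t) (P t) \<ge> 0" by (simp add: ip_self)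
  ultimately show ?thesis
    using 1 2 3 ip_commute[of I01 "P t" "Ux t"] unfolding E_def by simp
qed

lemma E_0: "E 0 = 0"
proof -
  have "ip I01 (V 0) (V 0) = 0" if "\<And>x. x \<in> I01 \<Longrightarrow> V 0 x = 0" for V :: "real \<Rightarrow> real \<Rightarrow> real"
    using ip_cong[of I01 "V 0" "\<lambda>_. 0" "V 0" "\<lambda>_. 0"] that by (simp add: ip_def)
  then show ?thesis using ic by (simp add: E_def)
qed

lemma energy:
  assumes t: "t \<in> {0..T}"
  shows "E t \<le> \<epsilon>\<^sup>2 * exp T"
proof -
  \<comment> \<open>Gronwall's argument with the integrating factor for
    \<open>E' \<le> E + \<epsilon>\<^sup>2\<close>.\<close>
  let ?G = "\<lambda>s. exp (- s) * (E s + \<epsilon>\<^sup>2)"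
  let ?e = "\<lambda>s. 2 * (ip I01 (P' s) (P s) + ip I01 (U' s) (U s))"
  have "?G t \<le> ?G 0"
  proof (rule DERIV_nonpos_decreasing_within[where f = ?G])
    fix s assume s: "s \<in> {0..t}"
    have "(E has_real_derivative ?e s) (at s within {0..t})"
      by (rule DERIV_subset[OF E_deriv]) (use s t in auto)
    then show "(?G has_real_derivative exp (- s) * (?e s - (E s + \<epsilon>\<^sup>2))) (at s within {0..t})"
      by (auto intro!: derivative_eq_intros simp: algebra_simps)
  next
    fix s assume "s \<in> {0<..<t}"
    then have "?e s \<le> E s + \<epsilon>\<^sup>2" using E_deriv_le[of s] t by auto
    then show "exp (- s) * (?e s - (E s + \<epsilon>\<^sup>2)) \<le> 0" by (simp add: mult_le_0_iff)
  qed (use t in simp)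
  then have "E t + \<epsilon>\<^sup>2 \<le> \<epsilon>\<^sup>2 * exp t" by (simp add: E_0 exp_minus field_simps)
  moreover have "\<epsilon>\<^sup>2 * exp t \<le> \<epsilon>\<^sup>2 * exp T" using t by (intro mult_left_mono) auto
  ultimately show ?thesis using zero_le_power2[of \<epsilon>] by linarith
qed

lemma parts_le_E: "ip I01 (P t) (P t) \<le> E t" "ip I01 (U t) (U t) \<le> E t"
  by (simp_all add: E_def ip_self)

text \<open>The multiplier \<^term>\<open>2 * x - 1\<close> produces the squares of both traces of the pressure.\<close>

definition Z :: "real \<Rightarrow> real" where "Z t = ip I01 (\<lambda>x. (2 * x - 1) * P t x) (U t)"

definition Z' :: "real \<Rightarrow> real" where
  "Z' t = ip I01 (\<lambda>x. (2 * x - 1) * P' t x) (U t) + ip I01 (\<lambda>x. (2 * x - 1) * P t x) (U' t)"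

lemma weight: "continuous_on UNIV (\<lambda>x::real. 2 * x - 1)" "x \<in> I01 \<Longrightarrow> \<bar>2 * x - 1\<bar> \<le> 1" for x :: real
  by (auto intro!: continuous_intros)

lemma Z_deriv: "t \<in> {0..T} \<Longrightarrow> (Z has_real_derivative Z' t) (at t within {0..T})"
  unfolding Z_def[abs_def] Z'_def by (rule ip_has_derivative[OF PC UC weight])

text \<open>The weight is -1 at 0 and 1 at 1, so both boundary squares appear with a positive sign;
  its slope 2 produces the interior term.\<close>

lemma weighted_parts:
  assumes F: "primitive_on {0..1} F f'" and f': "f' \<in> L2 I01"
  shows "2 * ip I01 (\<lambda>x. (2 * x - 1) * F x) f' = (F 1)\<^sup>2 + (F 0)\<^sup>2 - 2 * ip I01 F F"
proof -
  have FL: "F \<in> L2 I01" by (rule continuous_L2[OF primitive_on_continuous[OF F]])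
  have w: "primitive_on {0..1} (\<lambda>x. 2 * x - 1) (\<lambda>_. 2)"
    by (rule primitive_on_C1) (auto intro!: derivative_eq_intros)
  have wL: "(\<lambda>x. (2 * x - 1) * F x) \<in> L2 I01" "(\<lambda>x. (2 * x - 1) * f' x) \<in> L2 I01"
    using L2_weight(1)[OF FL weight] L2_weight(1)[OF f' weight] by blast+
  have 2: "(\<lambda>x. 2 * F x) \<in> L2 I01" by (rule L2_cmult[OF FL])
  have "ip I01 (\<lambda>x. (2 * x - 1) * f' x + 2 * F x) F + ip I01 (\<lambda>x. (2 * x - 1) * F x) f' = (F 1)\<^sup>2 + (F 0)\<^sup>2"
    using ip_integration_by_parts[OF primitive_on_mult[OF w F] F L2_add[OF wL(2) 2] f']
    by (simp add: power2_eq_square)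
  moreover have "ip I01 (\<lambda>x. (2 * x - 1) * f' x + 2 * F x) F = ip I01 (\<lambda>x. (2 * x - 1) * f' x) F + 2 * ip I01 F F"
    unfolding ip_add_left[OF wL(2) 2 FL] ip_cmult_left ..
  moreover have "ip I01 (\<lambda>x. (2 * x - 1) * f' x) F = ip I01 (\<lambda>x. (2 * x - 1) * F x) f'"
    by (rule ip_weight_swap)
  ultimately show ?thesis by simp
qed

text \<open>The boundary squares of \<open>U\<close> vanish, and those of \<open>P\<close> appear
  with a sign that lets them be moved to the other side and integrated in time.\<close>

lemma Z'_eq:
  assumes t: "t \<in> {0<..<T}"
  shows "2 * Z' t = 2 * E t - ((P t 0)\<^sup>2 + (P t 1)\<^sup>2) - 2 * ip I01 (\<lambda>x. (2 * x - 1) * P t x) (f t)"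
proof -
  have t': "t \<in> {0..T}" using t by simp
  have L: "P t \<in> L2 I01" "U t \<in> L2 I01" "P' t \<in> L2 I01" "U' t \<in> L2 I01" using memL2[OF t'] by auto
  note Lx = PxL[OF t] UxL[OF t] fL2[OF t]
  have wL: "(\<lambda>x. (2 * x - 1) * F x) \<in> L2 I01" if "F \<in> L2 I01" for F
    using L2_weight(1)[OF that weight] by blast
  have "ip I01 (\<lambda>x. (2 * x - 1) * P' t x) (U t) = ip I01 (\<lambda>x. (-1) * ((2 * x - 1) * Ux t x)) (U t)"
  proof (rule ip_cong_AE[OF _ wL[OF L(3)] L(2)])
    show "AE x in lebesgue. x \<in> I01 \<longrightarrow> (2 * x - 1) * P' t x = (-1) * ((2 * x - 1) * Ux t x)"
      using eqP[OF t] by (rule eventually_mono) simp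
  qed
  also have "\<dots> = - ip I01 (\<lambda>x. (2 * x - 1) * U t x) (Ux t)"
    unfolding ip_cmult_left ip_weight_swap[of I01 "\<lambda>x. 2 * x - 1" "Ux t"] by simp
  finally have 1: "ip I01 (\<lambda>x. (2 * x - 1) * P' t x) (U t) = - ip I01 (\<lambda>x. (2 * x - 1) * U t x) (Ux t)" .
  have nP: "(\<lambda>x. (-1) * Px t x) \<in> L2 I01" by (rule L2_cmult[OF Lx(1)])
  have "ip I01 (U' t) (\<lambda>x. (2 * x - 1) * P t x) = ip I01 (\<lambda>x. (-1) * Px t x - f t x) (\<lambda>x. (2 * x - 1) * P t x)"
  proof (rule ip_cong_AE[OF _ L(4) wL[OF L(1)]])
    show "AE x in lebesgue. x \<in> I01 \<longrightarrow> U' t x = (-1) * Px t x - f t x"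
      using eqU[OF t] by (rule eventually_mono) simp
  qed
  also have "\<dots> = - ip I01 (Px t) (\<lambda>x. (2 * x - 1) * P t x) - ip I01 (f t) (\<lambda>x. (2 * x - 1) * P t x)"
    unfolding ip_diff_left[OF nP Lx(3) wL[OF L(1)]] ip_cmult_left by simp
  finally have 2: "ip I01 (\<lambda>x. (2 * x - 1) * P t x) (U' t)
      = - ip I01 (\<lambda>x. (2 * x - 1) * P t x) (Px t) - ip I01 (\<lambda>x. (2 * x - 1) * P t x) (f t)"
    by (simp only: ip_commute[of I01 _ "\<lambda>x. (2 * x - 1) * P t x"])
  show ?thesis
    using weighted_parts[OF Pprim[OF t] Lx(1)] weighted_parts[OF Uprim[OF t] Lx(2)] bc[OF t]
    unfolding Z'_def 1 2 E_def by (simp add: algebra_simps)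
qed

lemma norm_f_le:
  assumes t: "t \<in> {0<..<T}"
  shows "ip I01 (f t) (f t) \<le> 2 * A\<^sup>2 * E t + 2 * \<epsilon>\<^sup>2"
proof -
  have t': "t \<in> {0..T}" using t by simp
  have L: "U t \<in> L2 I01" using memL2[OF t'] by auto
  have one: "(\<lambda>_. 1) \<in> L2 I01" and c: "(\<lambda>x. 2 * \<epsilon>\<^sup>2) \<in> L2 I01" by (rule continuous_L2, simp)+
  have AU: "(\<lambda>x. 2 * A\<^sup>2 * U t x) \<in> L2 I01" by (rule L2_cmult[OF L])
  have "ip I01 (f t) (f t) \<le> (LINT x:I01|lebesgue. 2 * A\<^sup>2 * U t x * U t x + 2 * \<epsilon>\<^sup>2 * 1)"
    unfolding ip_def
  proof (rule set_integral_mono)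
    fix x assume x: "x \<in> I01"
    have "f t x * f t x \<le> (A * \<bar>U t x\<bar> + \<epsilon>)\<^sup>2"
      using f_bound[OF t x] abs_le_square_iff[of "f t x" "A * \<bar>U t x\<bar> + \<epsilon>"] by (simp add: power2_eq_square)
    also have "\<dots> \<le> 2 * (A * \<bar>U t x\<bar>)\<^sup>2 + 2 * \<epsilon>\<^sup>2"
      using zero_le_power2[of "A * \<bar>U t x\<bar> - \<epsilon>"] unfolding power2_sum power2_diff by linarith
    also have "\<dots> = 2 * A\<^sup>2 * U t x * U t x + 2 * \<epsilon>\<^sup>2 * 1" by (simp add: power2_eq_square)
    finally show "f t x * f t x \<le> 2 * A\<^sup>2 * U t x * U t x + 2 * \<epsilon>\<^sup>2 * 1" .
  qed (intro set_integral_add(1) L2_mult_integrable fL2[OF t] AU L c one)+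
  also have "\<dots> = ip I01 (\<lambda>x. 2 * A\<^sup>2 * U t x) (U t) + ip I01 (\<lambda>_. 2 * \<epsilon>\<^sup>2) (\<lambda>_. 1)"
    unfolding ip_def by (rule set_integral_add(2)) (intro L2_mult_integrable c one L AU)+
  also have "ip I01 (\<lambda>_. 2 * \<epsilon>\<^sup>2) (\<lambda>_. 1) = 2 * \<epsilon>\<^sup>2"
    using ip_Ioo_eq_integral(1)[OF c one] by simp
  also have "ip I01 (\<lambda>x. 2 * A\<^sup>2 * U t x) (U t) = 2 * A\<^sup>2 * ip I01 (U t) (U t)" by (rule ip_cmult_left)
  also have "\<dots> \<le> 2 * A\<^sup>2 * E t" by (intro mult_left_mono parts_le_E) simp
  finally show ?thesis by simp
qed

lemma ip_weight_le:
  assumes "F \<in> L2 I01" "G \<in> L2 I01"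
  shows "2 * \<bar>ip I01 (\<lambda>x. (2 * x - 1) * F x) G\<bar> \<le> ip I01 F F + ip I01 G G"
proof -
  have w: "(\<lambda>x. (2 * x - 1) * F x) \<in> L2 I01" "norm_L2 I01 (\<lambda>x. (2 * x - 1) * F x) \<le> norm_L2 I01 F"
    using L2_weight[OF assms(1) weight] by blast+
  have "\<bar>ip I01 (\<lambda>x. (2 * x - 1) * F x) G\<bar> \<le> norm_L2 I01 (\<lambda>x. (2 * x - 1) * F x) * norm_L2 I01 G"
    by (rule ip_Cauchy_Schwarz[OF w(1) assms(2)])
  also have "\<dots> \<le> norm_L2 I01 F * norm_L2 I01 G" by (rule mult_right_mono[OF w(2) norm_L2_nonneg])
  finally show ?thesis
    using zero_le_power2[of "norm_L2 I01 F - norm_L2 I01 G"] by (simp add: ip_self power2_diff)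
qed

text \<open>The first \<open>exp T\<close> bounds 2 Z at the final time by the energy. The rest is
  the time integral of a bound for the traces plus 2 Z'. In 3 + 2 A^2, the energy occurs twice in 2
  Z' itself, once through the pressure in the weighted product, and 2 A^2 times through
  \<open>f\<close>.\<close>

definition K :: real where "K = exp T + ((3 + 2 * A\<^sup>2) * exp T + 2) * T"

lemma trace_estimate:
  assumes c: "continuous_on {0..T} (\<lambda>t. P t 0)" "continuous_on {0..T} (\<lambda>t. P t 1)"
  shows "integral {0..T} (\<lambda>t. (P t 0)\<^sup>2 + (P t 1)\<^sup>2) \<le> K * \<epsilon>\<^sup>2"
proof -
  let ?B = "\<lambda>t. (P t 0)\<^sup>2 + (P t 1)\<^sup>2"
  let ?k = "((3 + 2 * A\<^sup>2) * exp T + 2) * \<epsilon>\<^sup>2"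
  \<comment> \<open>The subtracted linear term is just large enough to make this function
    nonincreasing.\<close>
  let ?H = "\<lambda>t. integral {0..t} ?B + 2 * Z t - ?k * t"
  have Bc: "continuous_on {0..T} ?B" by (intro continuous_intros c)
  have "?H T \<le> ?H 0"
  proof (rule DERIV_nonpos_decreasing_within[where f = ?H])
    fix t assume t: "t \<in> {0..T}"
    show "(?H has_real_derivative ?B t + 2 * Z' t - ?k) (at t within {0..T})"
      by (rule derivative_eq_intros integral_has_real_derivative[OF Bc t] Z_deriv[OF t] refl)+ simp
  next
    fix t assume t: "t \<in> {0<..<T}"
    then have t': "t \<in> {0..T}" by simp
    have "2 * \<bar>ip I01 (\<lambda>x. (2 * x - 1) * P t x) (f t)\<bar> \<le> ip I01 (P t) (P t) + ip I01 (f t) (f t)"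
      by (rule ip_weight_le) (use memL2[OF t'] fL2[OF t] in auto)
    also have "\<dots> \<le> E t + (2 * A\<^sup>2 * E t + 2 * \<epsilon>\<^sup>2)"
      by (rule add_mono[OF parts_le_E(1) norm_f_le[OF t]])
    finally have "?B t + 2 * Z' t \<le> (3 + 2 * A\<^sup>2) * E t + 2 * \<epsilon>\<^sup>2"
      unfolding Z'_eq[OF t] by (simp add: algebra_simps abs_le_iff)
    also have "\<dots> \<le> (3 + 2 * A\<^sup>2) * (\<epsilon>\<^sup>2 * exp T) + 2 * \<epsilon>\<^sup>2"
      by (intro add_mono mult_left_mono energy[OF t']) simp_all
    finally show "?B t + 2 * Z' t - ?k \<le> 0" by (simp add: algebra_simps)
  qed (use T in simp)
  moreover have "2 * \<bar>Z t\<bar> \<le> E t" if "t \<in> {0..T}" for t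
    unfolding Z_def E_def by (rule ip_weight_le) (use memL2[OF that] in auto)
  from this[of 0] this[of T] have "Z 0 = 0" "2 * \<bar>Z T\<bar> \<le> \<epsilon>\<^sup>2 * exp T"
    using T energy[of T] by (simp_all add: E_0)
  ultimately have "integral {0..T} ?B \<le> \<epsilon>\<^sup>2 * exp T + ?k * T" by (simp add: abs_le_iff)
  also have "\<dots> = K * \<epsilon>\<^sup>2" by (simp add: K_def algebra_simps)
  finally show ?thesis .
qed

end

subsection \<open>Antiderivatives normalised at the origin\<close>

text \<open>The fixed interval of integration makes the formula valid for negative x as well and
  reduces continuity in parameters to that of an integral with fixed limits.\<close>

definition sprim :: "(real \<Rightarrow> real) \<Rightarrow> real \<Rightarrow> real" where
  "sprim g x = x * integral {0..1} (\<lambda>s. g (s * x))"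

lemma sprim_antideriv:
  assumes X: "\<And>z. (X has_real_derivative g z) (at z)"
  shows "sprim g x = X x - X 0"
proof -
  have "((\<lambda>s. x * g (s * x)) has_integral (X (1 * x) - X (0 * x))) {0..1}"
  proof (rule fundamental_theorem_of_calculus)
    fix s :: real
    have "((\<lambda>s. X (s * x)) has_real_derivative g (s * x) * x) (at s)"
      by (rule DERIV_chain2[OF X]) (auto intro!: derivative_eq_intros)
    then show "((\<lambda>s. X (s * x)) has_vector_derivative x * g (s * x)) (at s within {0..1})"
      unfolding has_real_derivative_iff_has_vector_derivative[symmetric]
      by (simp add: mult.commute has_field_derivative_at_within)
  qed simp
  from integral_unique[OF this] have "integral {0..1} (\<lambda>s. x * g (s * x)) = X x - X 0" by simp
  then show ?thesis by (simp add: sprim_def)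
qed

lemma continuous_antideriv:
  fixes g :: "real \<Rightarrow> real"
  assumes "continuous_on UNIV g"
  obtains X where "\<And>z. (X has_real_derivative g z) (at z)"
proof -
  have "isCont g x" for x using assms by (simp add: continuous_on_eq_continuous_at)
  then obtain X where "\<And>x. (X has_real_derivative g x) (at x)"
    using einterval_antiderivative[of "-\<infinity>" "\<infinity>" g]
    by (auto simp: has_real_derivative_iff_has_vector_derivative)
  then show ?thesis by (rule that)
qed

lemma sprim_deriv:
  assumes "continuous_on UNIV g"
  shows "(sprim g has_real_derivative g x) (at x)"
proof -
  obtain X where X: "\<And>z. (X has_real_derivative g z) (at z)" using continuous_antideriv[OF assms] by blast
  have "sprim g = (\<lambda>x. X x - X 0)" by (rule ext) (rule sprim_antideriv[OF X])
  then show ?thesis using DERIV_diff[OF X[of x] DERIV_const[of "X 0"]] by simp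
qed

lemma sprim_unique:
  assumes F: "\<And>z. (F has_real_derivative g z) (at z)" and F0: "F 0 = 0"
  shows "sprim g x = F x"
  using sprim_antideriv[OF F] F0 by simp

lemma sprim_0 [simp]: "sprim g 0 = 0"
  by (simp add: sprim_def)

lemma sprim_minus: "sprim g (- x) = - sprim (\<lambda>z. g (- z)) x"
  by (simp add: sprim_def)

lemma sprim_odd:
  assumes "\<And>z. g (- z) = g z"
  shows "sprim g (- x) = - sprim g x"
  by (simp add: sprim_minus assms)

lemma sprim_1: "sprim g 1 = integral {0..1} g"
  by (simp add: sprim_def)

text \<open>The increment over one period is constant. At x = -1 it equals twice
  \<open>sprim g 1\<close>, since the antiderivative of an even function is odd.\<close>

lemma sprim_periodic:
  assumes g: "continuous_on UNIV g" and even: "\<And>z. g (- z) = g z" and per: "\<And>z. g (z + 2) = g z"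
    and zero: "sprim g 1 = 0"
  shows "sprim g (x + 2) = sprim g x"
proof -
  have sh: "((\<lambda>x. sprim g (x + 2)) has_real_derivative g x) (at x)" for x
    using DERIV_shift[of "sprim g" "g (x + 2)" x 2] sprim_deriv[OF g, of "x + 2"] per[of x] by simp
  have "((\<lambda>x. sprim g (x + 2) - sprim g x) has_real_derivative 0) (at x)" for x
    using DERIV_diff[OF sh[of x] sprim_deriv[OF g, of x]] by simp
  then have "sprim g (x + 2) - sprim g x = sprim g (-1 + 2) - sprim g (-1)"
    using DERIV_isconst_all[of "\<lambda>x. sprim g (x + 2) - sprim g x" x "-1"] by blast
  also have "\<dots> = 0" using sprim_odd[of g 1, OF even] zero by simp
  finally show ?thesis by simp
qed

lemma sprim_bound:
  assumes "x \<ge> 0" "continuous_on UNIV F" "continuous_on UNIV G"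
    and le: "\<And>z. 0 \<le> z \<Longrightarrow> z \<le> x \<Longrightarrow> \<bar>F z\<bar> \<le> G z"
  shows "\<bar>sprim F x\<bar> \<le> sprim G x"
proof -
  have c: "continuous_on {0..1} (\<lambda>s. K (s * x))" if "continuous_on UNIV K" for K :: "real \<Rightarrow> real"
    by (rule continuous_on_compose2[OF that]) (auto intro!: continuous_intros)
  have "norm (integral {0..1} (\<lambda>s. F (s * x))) \<le> integral {0..1} (\<lambda>s. G (s * x))"
  proof (rule integral_norm_bound_integral)
    fix s :: real assume "s \<in> {0..1}"
    then have "0 \<le> s * x" "s * x \<le> x" using assms(1) by (auto simp: mult_left_le_one_le)
    then show "norm (F (s * x)) \<le> G (s * x)" using le by simp
  qed (intro integrable_continuous_real c assms)+
  then show ?thesis using assms(1) by (simp add: sprim_def abs_mult mult_left_mono)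
qed

lemma sprim_diff:
  assumes "continuous_on UNIV F" "continuous_on UNIV G"
  shows "sprim (\<lambda>z. F z - G z) x = sprim F x - sprim G x"
  by (rule sprim_unique) (auto intro!: DERIV_diff sprim_deriv assms)

text \<open>Integrating the exponential gains the factor 1 / k; from this the iteration obtains its
  contraction in a weighted norm.\<close>

lemma sprim_exp_bound:
  assumes "x \<ge> 0" "continuous_on UNIV F" "k > 0" "K \<ge> 0"
    and le: "\<And>z. 0 \<le> z \<Longrightarrow> z \<le> x \<Longrightarrow> \<bar>F z\<bar> \<le> K * exp (k * z)"
  shows "\<bar>sprim F x\<bar> \<le> K / k * exp (k * x)"
proof -
  have e: "sprim (\<lambda>z. K * exp (k * z)) x = K / k * exp (k * x) - K / k * exp (k * 0)"
  proof (rule sprim_antideriv)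
    fix z show "((\<lambda>z. K / k * exp (k * z)) has_real_derivative K * exp (k * z)) (at z)"
      using assms(3) by (auto intro!: derivative_eq_intros)
  qed
  have "\<bar>sprim F x\<bar> \<le> sprim (\<lambda>z. K * exp (k * z)) x"
    by (rule sprim_bound[OF assms(1,2) _ le]) (auto intro!: continuous_intros)
  moreover have "K / k \<ge> 0" using assms(3,4) by simp
  ultimately show ?thesis unfolding e by simp
qed

lemma sprim_continuous:
  fixes F :: "'a::topological_space \<Rightarrow> real \<Rightarrow> real"
  assumes "continuous_on UNIV (\<lambda>(p, z). F p z)" "continuous_on A f" "continuous_on A g"
  shows "continuous_on A (\<lambda>p. sprim (F (f p)) (g p))"
  unfolding sprim_def
proof (intro continuous_intros assms(3))
  have "continuous_on (A \<times> cbox 0 1) (\<lambda>(p, s). F (f p) (s * g p))"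
    unfolding split_beta
    by (rule continuous_on_compose2[OF assms(1)[unfolded split_beta], of _ "\<lambda>z. (f (fst z), snd z * g (fst z))", simplified])
      (auto intro!: continuous_intros continuous_on_compose2[OF assms(2)] continuous_on_compose2[OF assms(3)])
  from integral_continuous_on_param[OF this]
  show "continuous_on A (\<lambda>p. integral {0..1} (\<lambda>s. F (f p) (s * g p)))" by simp
qed

subsection \<open>Transport along characteristics\<close>

text \<open>Duhamel's formula: the solution of w_t + w_x = F with zero initial value.\<close>

definition transport :: "(real \<Rightarrow> real \<Rightarrow> real) \<Rightarrow> real \<Rightarrow> real \<Rightarrow> real" where
  "transport F t x = sprim (\<lambda>\<tau>. F \<tau> (x - t + \<tau>)) t"

lemma continuous_on_swap_args:
  fixes F :: "real \<Rightarrow> real \<Rightarrow> real"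
  assumes F: "continuous_on UNIV (\<lambda>(t, x). F t x)" and "continuous_on A f" "continuous_on A g"
  shows "continuous_on A (\<lambda>p. F (f p) (g p))"
  using continuous_on_compose2[OF F[unfolded split_beta] continuous_on_Pair[OF assms(2,3)]] by simp

lemma transport_continuous:
  assumes F: "continuous_on UNIV (\<lambda>(t, x). F t x)"
  shows "continuous_on UNIV (\<lambda>(t, x). transport F t x)"
proof -
  have "continuous_on UNIV (\<lambda>(s, \<tau>). F \<tau> (s + \<tau>))"
    unfolding split_beta by (intro continuous_on_swap_args[OF F] continuous_intros)
  from sprim_continuous[OF this, of UNIV "\<lambda>p. snd p - fst p" fst]
  show ?thesis unfolding transport_def split_beta
    by (simp add: continuous_intros)
qed

text \<open>The transported quantity is differentiated through the characteristic coordinates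
  \<^term>\<open>(x - t, t)\<close>, in which both partial derivatives are explicit.\<close>

lemma transport_deriv:
  assumes F: "continuous_on UNIV (\<lambda>(t, x). F t x)" and F': "continuous_on UNIV (\<lambda>(t, x). F' t x)"
    and D: "\<And>t x. (F t has_real_derivative F' t x) (at x)"
  shows "((\<lambda>x. transport F t x) has_real_derivative transport F' t x) (at x)"
    "((\<lambda>t. transport F t x) has_real_derivative F t x - transport F' t x) (at t)"
proof -
  define W where "W s t = sprim (\<lambda>\<tau>. F \<tau> (s + \<tau>)) t" for s t
  define Ws where "Ws s t = sprim (\<lambda>\<tau>. F' \<tau> (s + \<tau>)) t" for s t
  have Ws: "((\<lambda>s. W s t) has_real_derivative Ws s t) (at s)" for s t
  proof -
    have "((\<lambda>s. integral (cbox 0 1) (\<lambda>r. F (r * t) (s + r * t))) has_real_derivative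
        integral (cbox 0 1) (\<lambda>r. F' (r * t) (s + r * t))) (at s within UNIV)"
    proof (rule leibniz_rule_field_derivative)
      fix s r :: real
      show "((\<lambda>s. F (r * t) (s + r * t)) has_real_derivative F' (r * t) (s + r * t)) (at s within UNIV)"
        using iffD1[OF DERIV_shift D[of "r * t" "s + r * t"]] by simp
      show "(\<lambda>r. F (r * t) (s + r * t)) integrable_on cbox 0 1"
        by (intro integrable_continuous continuous_on_swap_args[OF F] continuous_intros)
    next
      show "continuous_on (UNIV \<times> cbox 0 1) (\<lambda>(s, r). F' (r * t) (s + r * t))"
        unfolding split_beta by (intro continuous_on_swap_args[OF F'] continuous_intros)
    qed auto
    then show ?thesis unfolding W_def Ws_def sprim_def by (auto intro: DERIV_cmult)
  qed
  have Wt: "(W s has_real_derivative F t (s + t)) (at t)" for s t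
    unfolding W_def by (rule sprim_deriv) (intro continuous_on_swap_args[OF F] continuous_intros)
  have cW: "continuous_on UNIV (\<lambda>p. F (snd p) (fst p + snd p))"
    by (intro continuous_on_swap_args[OF F] continuous_intros)
  \<comment> \<open>The partial derivative along the characteristic is continuous in both variables,
    which yields total differentiability; the chain rule along (x - t, t) then gives the time
    derivative.\<close>
  have tot: "((\<lambda>(s, t). W s t) has_derivative (\<lambda>(ds, dt). ds * Ws s t + blinfun_mult_right (F t (s + t)) dt))
      (at (s, t) within UNIV \<times> UNIV)" for s t
  proof (rule has_derivative_partialsI)
    show "((\<lambda>s. W s t) has_derivative (\<lambda>ds. ds * Ws s t)) (at s within UNIV)"
      using Ws[of t s] by (simp add: has_field_derivative_def mult_commute_abs)
    show "(W s has_derivative blinfun_apply (blinfun_mult_right (F t (s + t)))) (at t within UNIV)" for s t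
      using Wt[of s t] by (simp add: has_field_derivative_def)
    have "continuous_on UNIV (\<lambda>p::real \<times> real. blinfun_mult_right (F (snd p) (fst p + snd p)))"
      by (intro bounded_linear.continuous_on[OF bounded_linear_blinfun_mult_right] cW)
    moreover have "(\<lambda>(s, t). blinfun_mult_right (F t (s + t))) = (\<lambda>p. blinfun_mult_right (F (snd p) (fst p + snd p)))"
      by auto
    ultimately show "continuous (at (s, t) within UNIV \<times> UNIV) (\<lambda>(s, t). blinfun_mult_right (F t (s + t)))"
      by (simp add: continuous_on_eq_continuous_at)
  qed auto
  have tr: "transport F t x = W (x - t) t" "transport F' t x = Ws (x - t) t" for t x
    by (simp_all add: transport_def W_def Ws_def)
  show "((\<lambda>x. transport F t x) has_real_derivative transport F' t x) (at x)"
    unfolding tr by (rule DERIV_chain2[OF Ws, THEN DERIV_cong]) (auto intro!: derivative_eq_intros)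
  have c: "((\<lambda>t. (x - t, t)) has_derivative (\<lambda>h. (- h, h))) (at t)"
    by (auto intro!: derivative_eq_intros)
  have "((\<lambda>t. (\<lambda>(s, t). W s t) (x - t, t)) has_derivative
      (\<lambda>h. (\<lambda>(ds, dt). ds * Ws (x - t) t + blinfun_mult_right (F t (x - t + t)) dt) (- h, h))) (at t)"
    by (rule has_derivative_compose[OF c]) (rule tot[of "x - t" t, simplified UNIV_Times_UNIV])
  then show "((\<lambda>t. transport F t x) has_real_derivative F t x - transport F' t x) (at t)"
    unfolding has_field_derivative_def tr prod.case
    by (rule has_derivative_eq_rhs) (auto simp: algebra_simps)
qed

subsection \<open>Even reflection with period two\<close>

text \<open>The triangle wave, that is the distance to the nearest even integer. In this form
  evenness, period two and continuity are inherited from the cosine.\<close>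

definition tri :: "real \<Rightarrow> real" where "tri x = arccos (cos (pi * x)) / pi"

lemma tri_props: "tri (- x) = tri x" "tri (x + 2) = tri x" "0 \<le> tri x" "tri x \<le> 1"
proof -
  show "tri (- x) = tri x" by (simp add: tri_def)
  have "cos (pi * (x + 2)) = cos (pi * x)"
    using cos_periodic[of "pi * x"] by (simp add: algebra_simps)
  then show "tri (x + 2) = tri x" by (simp add: tri_def)
  show "0 \<le> tri x" "tri x \<le> 1"
    using arccos_lbound[of "cos (pi * x)"] arccos_ubound[of "cos (pi * x)"] by (simp_all add: tri_def)
qed

lemma tri_id: "0 \<le> x \<Longrightarrow> x \<le> 1 \<Longrightarrow> tri x = x"
  by (simp add: tri_def arccos_cos)

lemma tri_continuous [continuous_intros]:
  fixes f :: "'a::t2_space \<Rightarrow> real"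
  shows "continuous_on A f \<Longrightarrow> continuous_on A (\<lambda>x. tri (f x))"
  unfolding tri_def by (auto intro!: continuous_intros)

lemma transport_periodic:
  assumes "\<And>t x. F t (x + 2) = F t x"
  shows "transport F t (x + 2) = transport F t x"
proof -
  have "F \<tau> (x + 2 - t + \<tau>) = F \<tau> (x - t + \<tau>)" for \<tau>
    using assms[of \<tau> "x - t + \<tau>"] by (simp add: algebra_simps)
  then show ?thesis by (simp add: transport_def)
qed

subsection \<open>A semilinear wave system with compatible data\<close>

text \<open>The unknown \<open>r\<close> of the fixed point equation is the space derivative of the function \<open>v\<close> that
  equals \<open>q + y\<close> on \<open>[0, 1]\<close> and \<open>q - y\<close> at reflected points; \<open>v\<close> is transported to the right with
  the odd, two-periodic extension of the source. Working with \<open>r\<close> instead of \<open>v\<close> replaces that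
  extension by the even one, which \<open>tri\<close> gives as a composition.\<close>

locale wave_fixpoint =
  fixes T a1 a2 M :: real and b b1 \<psi> :: "real \<Rightarrow> real" and \<alpha> \<alpha>x \<beta> \<beta>x :: "real \<Rightarrow> real \<Rightarrow> real"
  assumes T: "T > 0" and a1: "a1 > 0" and a2: "a2 \<ge> 0"
    and b: "\<And>z. (b has_real_derivative b1 z) (at z)"
    and b1_bound: "\<And>z. \<bar>b1 z\<bar> \<le> a1" and b1_lip: "\<And>z w. \<bar>b1 z - b1 w\<bar> \<le> a2 * \<bar>z - w\<bar>"
    and cont: "continuous_on UNIV (\<lambda>(t, x). \<alpha> t x)" "continuous_on UNIV (\<lambda>(t, x). \<alpha>x t x)"
      "continuous_on UNIV (\<lambda>(t, x). \<beta> t x)" "continuous_on UNIV (\<lambda>(t, x). \<beta>x t x)"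
    and \<alpha>: "\<And>t x. (\<alpha> t has_real_derivative \<alpha>x t x) (at x)"
    and \<beta>: "\<And>t x. (\<beta> t has_real_derivative \<beta>x t x) (at x)"
    and compat: "\<And>t. \<beta> t 0 + b (\<alpha> t 0) = 0" "\<And>t. \<beta> t 1 + b (\<alpha> t 1) = 0"
    and M: "\<And>t x. x \<in> {0..1} \<Longrightarrow> \<bar>\<alpha>x t x\<bar> \<le> M" "\<And>t x. x \<in> {0..1} \<Longrightarrow> \<bar>\<beta>x t x\<bar> \<le> M"
      "\<And>x. x \<in> {0..1} \<Longrightarrow> \<bar>\<psi> x\<bar> \<le> M"
    and \<psi>: "continuous_on UNIV \<psi>" "integral {0..1} \<psi> = 0"
begin

definition \<Psi> :: "real \<Rightarrow> real" where "\<Psi> x = \<psi> (tri x)"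

text \<open>The velocity is the odd part of \<open>v\<close>, so its space derivative is the even
  part of \<open>r\<close>.\<close>

definition D :: "(real \<Rightarrow> real \<Rightarrow> real) \<Rightarrow> real \<Rightarrow> real \<Rightarrow> real" where
  "D r t x = (r t x + r t (- x)) / 2"

definition y :: "(real \<Rightarrow> real \<Rightarrow> real) \<Rightarrow> real \<Rightarrow> real \<Rightarrow> real" where
  "y r t = sprim (D r t)"

text \<open>The space derivative of the source \<beta> + b (\<alpha> + y), by the chain
  rule.\<close>

definition hx :: "(real \<Rightarrow> real \<Rightarrow> real) \<Rightarrow> real \<Rightarrow> real \<Rightarrow> real" where
  "hx r t x = \<beta>x t x + b1 (\<alpha> t x + y r t x) * (\<alpha>x t x + D r t x)"

definition H :: "(real \<Rightarrow> real \<Rightarrow> real) \<Rightarrow> real \<Rightarrow> real \<Rightarrow> real" where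
  "H r t x = hx r t (tri x)"

text \<open>The space derivative of Duhamel's formula for v_t + v_x = - f, with \<Psi> as derivative
  of the initial value.\<close>

definition step :: "(real \<Rightarrow> real \<Rightarrow> real) \<Rightarrow> real \<Rightarrow> real \<Rightarrow> real" where
  "step r t x = \<Psi> (x - t) - transport (H r) t x"

text \<open>What the iteration preserves. The last condition is the boundary condition at 1; that at
  0 holds by the normalisation of \<open>y\<close>.\<close>

definition good :: "(real \<Rightarrow> real \<Rightarrow> real) \<Rightarrow> bool" where
  "good r \<longleftrightarrow> continuous_on UNIV (\<lambda>(t, x). r t x) \<and> (\<forall>t x. r t (x + 2) = r t x) \<and> (\<forall>t. y r t 1 = 0)"

lemma b1_cont: "continuous_on A b1"
proof -
  have "lipschitz_on a2 UNIV b1"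
    by (rule lipschitz_onI) (use b1_lip a2 in \<open>auto simp: dist_real_def\<close>)
  then show ?thesis using continuous_on_subset lipschitz_on_continuous_on by blast
qed

lemma \<Psi>_cont: "continuous_on UNIV \<Psi>"
  unfolding \<Psi>_def[abs_def] by (rule continuous_on_compose2[OF \<psi>(1)]) (auto intro!: continuous_intros)

lemma \<Psi>_sym: "\<Psi> (- x) = \<Psi> x" "\<Psi> (x + 2) = \<Psi> x"
  by (simp_all add: \<Psi>_def tri_props)

lemma sprim_\<Psi>_1: "sprim \<Psi> 1 = 0"
proof -
  have "integral {0..1} \<Psi> = integral {0..1} \<psi>"
    by (rule Henstock_Kurzweil_Integration.integral_cong) (simp add: \<Psi>_def tri_id)
  then show ?thesis by (simp add: sprim_1 \<psi>(2))
qed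

section \<open>One iteration step applied to a continuous function\<close>

context
  fixes r :: "real \<Rightarrow> real \<Rightarrow> real" assumes rc: "continuous_on UNIV (\<lambda>(t, x). r t x)"
begin

lemma D_cont: "continuous_on UNIV (\<lambda>(t, x). D r t x)"
  unfolding D_def split_beta by (intro continuous_intros continuous_on_swap_args[OF rc]) auto

lemma y_cont: "continuous_on UNIV (\<lambda>(t, x). y r t x)"
  unfolding y_def split_beta by (intro sprim_continuous[OF D_cont] continuous_intros)

lemma D_cont1: "continuous_on UNIV (D r t)"
  using continuous_on_swap_args[OF D_cont, of UNIV "\<lambda>_. t" "\<lambda>x. x"] by (simp add: continuous_on_const)

lemma y_deriv: "(y r t has_real_derivative D r t x) (at x)"
  unfolding y_def by (rule sprim_deriv[OF D_cont1])

lemma y_0: "y r t 0 = 0"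
  by (simp add: y_def)

lemma hx_cont: "continuous_on UNIV (\<lambda>(t, x). hx r t x)"
  unfolding hx_def split_beta
  by (intro continuous_intros continuous_on_swap_args[OF cont(1)] continuous_on_swap_args[OF cont(2)]
      continuous_on_swap_args[OF cont(4)] continuous_on_swap_args[OF D_cont] continuous_on_swap_args[OF y_cont]
      continuous_on_compose2[OF b1_cont[of UNIV]]) auto

lemma H_cont: "continuous_on UNIV (\<lambda>(t, x). H r t x)"
  unfolding H_def split_beta by (intro continuous_on_swap_args[OF hx_cont] continuous_intros)

lemma H_sym: "H r t (- x) = H r t x" "H r t (x + 2) = H r t x"
  by (simp_all add: H_def tri_props)

lemma H_cont1: "continuous_on UNIV (H r t)"
  using continuous_on_swap_args[OF H_cont, of UNIV "\<lambda>_. t" "\<lambda>x. x"] by (simp add: continuous_on_const)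

lemma h_deriv: "((\<lambda>x. \<beta> t x + b (\<alpha> t x + y r t x)) has_real_derivative hx r t x) (at x)"
  unfolding hx_def
  by (intro DERIV_add \<beta> DERIV_chain2[OF b] \<alpha> y_deriv)

text \<open>On [0, 1] the reflection \<open>tri\<close> is the identity, and \<open>compat\<close>
  at 0 makes the constant of integration vanish.\<close>

lemma sprim_H:
  assumes "0 \<le> x" "x \<le> 1"
  shows "sprim (H r t) x = \<beta> t x + b (\<alpha> t x + y r t x)"
proof -
  have "sprim (H r t) x = sprim (hx r t) x"
    unfolding sprim_def H_def
    by (intro arg_cong2[where f = "(*)"] refl Henstock_Kurzweil_Integration.integral_cong arg_cong[where f = "hx r t"] tri_id)
      (use assms in \<open>auto intro: mult_le_one\<close>)
  also have "\<dots> = \<beta> t x + b (\<alpha> t x + y r t x)"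
    using sprim_antideriv[OF h_deriv[of t], of x] compat(1)[of t] by (simp add: y_0)
  finally show ?thesis .
qed

text \<open>As the antiderivative of an even function this is the odd extension of the
  source.\<close>

definition f :: "real \<Rightarrow> real \<Rightarrow> real" where "f t = sprim (H r t)"

definition v :: "real \<Rightarrow> real \<Rightarrow> real" where "v t x = sprim \<Psi> (x - t) - transport f t x"

lemma f_cont: "continuous_on UNIV (\<lambda>(t, x). f t x)"
  unfolding f_def split_beta by (intro sprim_continuous[OF H_cont] continuous_intros)

lemma f_deriv: "(f t has_real_derivative H r t x) (at x)"
  unfolding f_def by (rule sprim_deriv[OF H_cont1])

lemma f_odd: "f t (- x) = - f t x"
  unfolding f_def by (rule sprim_odd) (rule H_sym)

lemma v_deriv: "(v t has_real_derivative step r t x) (at x)"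
    "((\<lambda>t. v t x) has_real_derivative - step r t x - f t x) (at t)"
proof -
  have 1: "((\<lambda>x. sprim \<Psi> (x - t)) has_real_derivative \<Psi> (x - t)) (at x)"
    by (rule DERIV_chain2[OF sprim_deriv[OF \<Psi>_cont], THEN DERIV_cong]) (auto intro!: derivative_eq_intros)
  have 2: "((\<lambda>t. sprim \<Psi> (x - t)) has_real_derivative - \<Psi> (x - t)) (at t)"
    by (rule DERIV_chain2[OF sprim_deriv[OF \<Psi>_cont], THEN DERIV_cong]) (auto intro!: derivative_eq_intros)
  show "(v t has_real_derivative step r t x) (at x)"
    unfolding v_def[abs_def] step_def
    by (rule DERIV_diff[OF 1 transport_deriv(1)[OF f_cont H_cont f_deriv]])
  show "((\<lambda>t. v t x) has_real_derivative - step r t x - f t x) (at t)"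
    unfolding v_def step_def
    by (rule DERIV_cong[OF DERIV_diff[OF 2 transport_deriv(2)[OF f_cont H_cont f_deriv]]]) simp
qed

lemma step_cont: "continuous_on UNIV (\<lambda>(t, x). step r t x)"
  unfolding step_def split_beta
  by (intro continuous_intros continuous_on_swap_args[OF transport_continuous[OF H_cont]]
      continuous_on_compose2[OF \<Psi>_cont]) auto

lemma v_cont_0: "v 0 x = sprim \<Psi> x"
  by (simp add: v_def transport_def)

text \<open>By \<open>compat\<close> at 1 and the boundary condition the source vanishes at 1, which
  is what its odd extension needs in order to have period two.\<close>

lemma f_periodic:
  assumes "y r t 1 = 0"
  shows "f t (x + 2) = f t x"
  unfolding f_def
proof (rule sprim_periodic[OF H_cont1])
  show "sprim (H r t) 1 = 0" using sprim_H[of 1 t] compat(2)[of t] assms by simp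
qed (rule H_sym)+

end

lemma good_step:
  assumes g: "good r"
  shows "good (step r)" "v r t (x + 2) = v r t x"
    "y (step r) t x = (v r t x - v r t (- x)) / 2"
proof -
  have rc: "continuous_on UNIV (\<lambda>(t, x). r t x)" and y1: "\<And>t. y r t 1 = 0"
    using g by (auto simp: good_def)
  have \<Psi>2: "\<Psi> (x + 2 - t) = \<Psi> (x - t)" "sprim \<Psi> (x + 2 - t) = sprim \<Psi> (x - t)" for t x
    using \<Psi>_sym(2)[of "x - t"] sprim_periodic[OF \<Psi>_cont \<Psi>_sym sprim_\<Psi>_1, of "x - t"]
    by (simp_all add: algebra_simps)
  have per: "step r t (x + 2) = step r t x" for t x
    using \<Psi>2(1) transport_periodic[of "H r", OF H_sym(2)[OF rc]] by (simp add: step_def)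
  show vper: "v r t (x + 2) = v r t x" for t x
    using \<Psi>2(2) transport_periodic[of "f r", OF f_periodic[OF rc y1]] by (simp add: v_def[OF rc])
  show yv: "y (step r) t x = (v r t x - v r t (- x)) / 2" for t x
    unfolding y_def
  proof (rule sprim_unique)
    fix z
    have "((\<lambda>z. v r t (- z)) has_real_derivative - step r t (- z)) (at z)"
      by (rule DERIV_chain2[OF v_deriv(1)[OF rc], THEN DERIV_cong]) (auto intro!: derivative_eq_intros)
    from DERIV_cdivide[OF DERIV_diff[OF v_deriv(1)[OF rc] this], where c = 2]
    show "((\<lambda>z. (v r t z - v r t (- z)) / 2) has_real_derivative D (step r) t z) (at z)"
      by (rule DERIV_cong) (simp add: D_def)
  qed simp
  \<comment> \<open>Period two identifies the values of \<open>v\<close> at 1 and -1, so its odd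
    part vanishes at 1.\<close>
  have "y (step r) t 1 = 0" for t
    unfolding yv using vper[of t "-1"] by simp
  then show "good (step r)" using step_cont[OF rc] per by (simp add: good_def)
qed


section \<open>A priori bound and contraction estimate\<close>

lemma M_nonneg: "M \<ge> 0"
  using M(3)[of 0] by (auto intro: order_trans[OF abs_ge_zero])

lemma D_diff:
  assumes "\<And>x. \<bar>r t x - q s x\<bar> \<le> \<delta>"
  shows "\<bar>D r t x - D q s x\<bar> \<le> \<delta>"
  using assms[of x] assms[of "- x"] unfolding D_def by (simp add: abs_le_iff field_simps)

lemma y_diff:
  assumes rc: "continuous_on UNIV (\<lambda>(t, x). r t x)" and qc: "continuous_on UNIV (\<lambda>(t, x). q t x)"
    and d: "\<And>x. \<bar>r t x - q s x\<bar> \<le> \<delta>" and x: "0 \<le> x" "x \<le> 1"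
  shows "\<bar>y r t x - y q s x\<bar> \<le> \<delta>"
proof -
  have d0: "\<delta> \<ge> 0" using d[of 0] by (rule order_trans[OF abs_ge_zero])
  have "\<bar>sprim (\<lambda>z. D r t z - D q s z) x\<bar> \<le> sprim (\<lambda>_. \<delta>) x"
    by (rule sprim_bound[OF x(1)])
      (intro continuous_on_diff D_cont1 rc qc continuous_on_const D_diff d)+
  also have "\<dots> = x * \<delta>" by (simp add: sprim_def)
  also have "\<dots> \<le> \<delta>" using x d0 by (simp add: mult_left_le_one_le)
  finally show ?thesis
    unfolding y_def sprim_diff[OF D_cont1[OF rc] D_cont1[OF qc]] .
qed

lemma hx_bound:
  assumes "\<And>x. \<bar>r t x\<bar> \<le> K" and x: "x \<in> {0..1}"
  shows "\<bar>hx r t x\<bar> \<le> M + a1 * (M + K)"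
proof -
  have "\<bar>D r t x\<bar> \<le> K" using assms(1)[of x] assms(1)[of "- x"] by (simp add: D_def abs_le_iff)
  then have "\<bar>\<alpha>x t x + D r t x\<bar> \<le> M + K" using M(1)[OF x, of t] by linarith
  then have "\<bar>b1 (\<alpha> t x + y r t x)\<bar> * \<bar>\<alpha>x t x + D r t x\<bar> \<le> a1 * (M + K)"
    using a1 by (intro mult_mono b1_bound) auto
  then show ?thesis using M(2)[OF x, of t] unfolding hx_def abs_mult[symmetric] by linarith
qed

definition C :: real where "C = 2 * (M + T * (M + a1 * M))"

definition R :: real where "R = C * exp (2 * a1 * T)"

text \<open>Lipschitz constant of \<open>hx\<close> in the unknown on the ball of radius R. The
  summand with a2 comes from varying the argument of \<open>b1\<close>, the summand a1 from varying
  the other factor.\<close>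

definition L :: real where "L = a2 * (M + R) + a1"

lemma C_nonneg: "C \<ge> 0" and R_nonneg: "R \<ge> 0" and L_pos: "L > 0"
proof -
  show C: "C \<ge> 0" using M_nonneg T a1 by (simp add: C_def)
  then show R: "R \<ge> 0" by (simp add: R_def)
  then show "L > 0" using a1 a2 M_nonneg by (simp add: L_def add_nonneg_pos)
qed

text \<open>The difference of products is split so that only \<open>q\<close> has to be bounded by
  \<open>R\<close>; the limit can then be compared with an iterate without a bound of its
  own.\<close>

lemma hx_diff:
  assumes rc: "continuous_on UNIV (\<lambda>(t, x). r t x)" and qc: "continuous_on UNIV (\<lambda>(t, x). q t x)"
    and d: "\<And>x. \<bar>r t x - q t x\<bar> \<le> \<delta>" and q: "\<And>x. \<bar>q t x\<bar> \<le> R" and x: "x \<in> {0..1}"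
  shows "\<bar>hx r t x - hx q t x\<bar> \<le> L * \<delta>"
proof -
  have d0: "\<delta> \<ge> 0" using d[of 0] by (rule order_trans[OF abs_ge_zero])
  have yd: "\<bar>y r t x - y q t x\<bar> \<le> \<delta>" using y_diff[OF rc qc d] x by simp
  let ?B = "b1 (\<alpha> t x + y r t x)" and ?B' = "b1 (\<alpha> t x + y q t x)"
  have "\<bar>D q t x\<bar> \<le> R" using q[of x] q[of "- x"] by (simp add: D_def abs_le_iff)
  then have g: "\<bar>\<alpha>x t x + D q t x\<bar> \<le> M + R" using M(1)[OF x, of t] by linarith
  have B: "\<bar>?B - ?B'\<bar> \<le> a2 * \<delta>"
  proof -
    have "\<bar>?B - ?B'\<bar> \<le> a2 * \<bar>y r t x - y q t x\<bar>"
      using b1_lip[of "\<alpha> t x + y r t x" "\<alpha> t x + y q t x"] by simp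
    also have "\<dots> \<le> a2 * \<delta>" by (rule mult_left_mono[OF yd a2])
    finally show ?thesis .
  qed
  have "\<bar>?B * (D r t x - D q t x)\<bar> \<le> a1 * \<delta>"
    unfolding abs_mult using a1 by (intro mult_mono b1_bound D_diff d) auto
  moreover have "\<bar>(?B - ?B') * (\<alpha>x t x + D q t x)\<bar> \<le> (a2 * \<delta>) * (M + R)"
    unfolding abs_mult using a2 d0 by (intro mult_mono B g) auto
  moreover have "hx r t x - hx q t x = ?B * (D r t x - D q t x) + (?B - ?B') * (\<alpha>x t x + D q t x)"
    by (simp add: hx_def algebra_simps)
  ultimately have "\<bar>hx r t x - hx q t x\<bar> \<le> a1 * \<delta> + (a2 * \<delta>) * (M + R)" by linarith
  also have "\<dots> = L * \<delta>" by (simp add: L_def algebra_simps)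
  finally show ?thesis .
qed

lemma tri_mem: "tri x \<in> {0..1}"
  by (simp add: tri_props)

lemma H_char_cont:
  assumes rc: "continuous_on UNIV (\<lambda>(t, x). r t x)"
  shows "continuous_on UNIV (\<lambda>\<tau>. H r \<tau> (x - t + \<tau>))"
  by (intro continuous_on_swap_args[OF H_cont[OF rc]] continuous_intros)

text \<open>The data and the constant part of the source contribute at most C / 2. With the rate 2
  a1, the part linear in the unknown integrates to C / 2 times the exponential minus C / 2, and the
  two constants cancel.\<close>

lemma step_bound:
  assumes rc: "continuous_on UNIV (\<lambda>(t, x). r t x)"
    and r: "\<And>t x. t \<in> {0..T} \<Longrightarrow> \<bar>r t x\<bar> \<le> C * exp (2 * a1 * t)" and t: "t \<in> {0..T}"
  shows "\<bar>step r t x\<bar> \<le> C * exp (2 * a1 * t)"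
proof -
  let ?G = "\<lambda>z. (M + a1 * M) + a1 * C * exp (2 * a1 * z)"
  have "sprim ?G t = ((M + a1 * M) * t + C / 2 * exp (2 * a1 * t)) - ((M + a1 * M) * 0 + C / 2 * exp (2 * a1 * 0))"
    by (rule sprim_antideriv) (use a1 in \<open>auto intro!: derivative_eq_intros\<close>)
  then have "sprim ?G t = (M + a1 * M) * t + C / 2 * exp (2 * a1 * t) - C / 2" by simp
  moreover have "\<bar>transport (H r) t x\<bar> \<le> sprim ?G t"
    unfolding transport_def
  proof (rule sprim_bound[OF _ H_char_cont[OF rc]])
    fix z assume z: "0 \<le> z" "z \<le> t"
    then have "\<bar>H r z (x - t + z)\<bar> \<le> M + a1 * (M + C * exp (2 * a1 * z))"
      unfolding H_def using t by (intro hx_bound r tri_mem) auto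
    then show "\<bar>H r z (x - t + z)\<bar> \<le> ?G z" by (simp add: algebra_simps)
  qed (use t in \<open>auto intro!: continuous_intros\<close>)
  moreover have "\<bar>\<Psi> (x - t)\<bar> \<le> M" unfolding \<Psi>_def by (rule M(3)[OF tri_mem])
  moreover have "(M + a1 * M) * t \<le> (M + a1 * M) * T"
    using t M_nonneg a1 by (intro mult_left_mono) auto
  moreover have "C / 2 * exp (2 * a1 * t) \<ge> 0" using C_nonneg by simp
  moreover have "C / 2 = M + (M + a1 * M) * T" by (simp add: C_def algebra_simps)
  ultimately show ?thesis unfolding step_def by linarith
qed

text \<open>In the norm weighted by \<open>exp (- 2 * L * t)\<close> a step halves distances,
  because the rate is twice the Lipschitz constant. The iteration therefore converges on the whole
  of [0, T].\<close>

lemma step_diff: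
  assumes rc: "continuous_on UNIV (\<lambda>(t, x). r t x)" and qc: "continuous_on UNIV (\<lambda>(t, x). q t x)"
    and d: "\<And>t x. t \<in> {0..T} \<Longrightarrow> \<bar>r t x - q t x\<bar> \<le> \<delta> * exp (2 * L * t)"
    and q: "\<And>t x. t \<in> {0..T} \<Longrightarrow> \<bar>q t x\<bar> \<le> R" and t: "t \<in> {0..T}" and \<delta>: "\<delta> \<ge> 0"
  shows "\<bar>step r t x - step q t x\<bar> \<le> \<delta> / 2 * exp (2 * L * t)"
proof -
  have "\<bar>sprim (\<lambda>\<tau>. H r \<tau> (x - t + \<tau>) - H q \<tau> (x - t + \<tau>)) t\<bar> \<le> (L * \<delta>) / (2 * L) * exp (2 * L * t)"
  proof (rule sprim_exp_bound)
    show "continuous_on UNIV (\<lambda>\<tau>. H r \<tau> (x - t + \<tau>) - H q \<tau> (x - t + \<tau>))"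
      by (intro continuous_on_diff H_char_cont rc qc)
    fix z assume z: "0 \<le> z" "z \<le> t"
    then have "\<bar>H r z (x - t + z) - H q z (x - t + z)\<bar> \<le> L * (\<delta> * exp (2 * L * z))"
      unfolding H_def using t by (intro hx_diff rc qc d q tri_mem) auto
    then show "\<bar>H r z (x - t + z) - H q z (x - t + z)\<bar> \<le> L * \<delta> * exp (2 * L * z)" by simp
  qed (use t L_pos \<delta> in auto)
  also have "(L * \<delta>) / (2 * L) = \<delta> / 2" using L_pos by simp
  finally show ?thesis
    unfolding step_def transport_def sprim_diff[OF H_char_cont[OF rc] H_char_cont[OF qc]]
    by (simp add: abs_minus_commute)
qed

section \<open>Picard iterates and their limit\<close>

primrec rs :: "nat \<Rightarrow> real \<Rightarrow> real \<Rightarrow> real" where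
  "rs 0 = (\<lambda>_ _. 0)"
| "rs (Suc n) = step (rs n)"

lemma rs_good: "good (rs n)"
proof (induction n)
  case 0
  have "y (\<lambda>_ _. 0) t 1 = 0" for t by (simp add: y_def D_def[abs_def] sprim_def)
  then show ?case by (simp add: good_def split_beta)
qed (simp add: good_step(1))

lemma rs_cont: "continuous_on UNIV (\<lambda>(t, x). rs n t x)"
  using rs_good[of n] by (simp add: good_def)

lemma rs_exp_bound: "t \<in> {0..T} \<Longrightarrow> \<bar>rs n t x\<bar> \<le> C * exp (2 * a1 * t)"
proof (induction n arbitrary: t x)
  case (Suc n)
  show ?case unfolding rs.simps by (rule step_bound[OF rs_cont Suc.IH Suc.prems])
qed (simp add: C_nonneg)

lemma rs_bound: "t \<in> {0..T} \<Longrightarrow> \<bar>rs n t x\<bar> \<le> R"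
  using rs_exp_bound[of t n x] mult_left_mono[of "exp (2 * a1 * t)" "exp (2 * a1 * T)" C] a1 C_nonneg
  by (simp add: R_def)

lemma rs_diff: "t \<in> {0..T} \<Longrightarrow> \<bar>rs (Suc n) t x - rs n t x\<bar> \<le> R / 2 ^ n * exp (2 * L * t)"
proof (induction n arbitrary: t x)
  case 0
  then have "1 \<le> exp (2 * L * t)" using L_pos by simp
  then have "R * 1 \<le> R * exp (2 * L * t)" by (rule mult_left_mono[OF _ R_nonneg])
  then show ?case using rs_bound[OF 0, of "Suc 0" x] by simp
next
  case (Suc n)
  have "\<bar>step (rs (Suc n)) t x - step (rs n) t x\<bar> \<le> (R / 2 ^ n) / 2 * exp (2 * L * t)"
    by (rule step_diff[OF rs_cont rs_cont Suc.IH rs_bound Suc.prems]) (use R_nonneg in simp_all)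
  then show ?case by simp
qed

definition limit :: "real \<times> real \<Rightarrow> real" where
  "limit p = (\<Sum>i. rs (Suc i) (fst p) (snd p) - rs i (fst p) (snd p))"

text \<open>The iterates are the partial sums of a telescoping series that is dominated by a
  geometric one.\<close>

lemma rs_uniform: "uniform_limit ({0..T} \<times> UNIV) (\<lambda>n p. rs n (fst p) (snd p)) limit sequentially"
proof -
  have "uniform_limit ({0..T} \<times> UNIV) (\<lambda>n p. \<Sum>i<n. rs (Suc i) (fst p) (snd p) - rs i (fst p) (snd p))
      limit sequentially"
    unfolding limit_def[abs_def]
  proof (rule Weierstrass_m_test)
    fix n and p :: "real \<times> real" assume "p \<in> {0..T} \<times> UNIV"
    then have t: "fst p \<in> {0..T}" by auto
    have "R / 2 ^ n * exp (2 * L * fst p) \<le> R / 2 ^ n * exp (2 * L * T)"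
      using t L_pos R_nonneg by (intro mult_left_mono) auto
    then show "norm (rs (Suc n) (fst p) (snd p) - rs n (fst p) (snd p)) \<le> R * exp (2 * L * T) * (1/2) ^ n"
      using rs_diff[OF t, of n "snd p"] by (simp add: power_one_over field_simps)
  next
    show "summable (\<lambda>n. R * exp (2 * L * T) * (1 / 2) ^ n)"
      by (intro summable_mult summable_geometric) simp
  qed
  moreover have "(\<Sum>i<n. rs (Suc i) a b - rs i a b) = rs n a b" for n a b
    using sum_lessThan_telescope[of "\<lambda>i. rs i a b" n] by (simp only: rs.simps(1) diff_0_right)
  ultimately show ?thesis by (simp only:)
qed

text \<open>The iterates are controlled only for times in [0, T]. Freezing time outside makes the
  limit continuous on the whole plane, as the transport formula demands.\<close>

definition cut :: "real \<Rightarrow> real" where "cut t = max 0 (min T t)"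

lemma cut: "cut t \<in> {0..T}" "t \<in> {0..T} \<Longrightarrow> cut t = t"
  using T by (auto simp: cut_def)

definition rl :: "real \<Rightarrow> real \<Rightarrow> real" where "rl t x = limit (cut t, x)"

lemma rl_uniform: "e > 0 \<Longrightarrow> \<forall>\<^sub>F n in sequentially. \<forall>t x. \<bar>rl t x - rs n (cut t) x\<bar> < e"
  using uniform_limitD[OF rs_uniform, of e]
  by (rule eventually_mono) (use cut(1) in \<open>auto simp: rl_def dist_real_def abs_minus_commute\<close>)

lemma rl_lim: "(\<lambda>n. rs n (cut t) x) \<longlonglongrightarrow> rl t x"
proof (rule tendstoI)
  fix e :: real assume "e > 0"
  from rl_uniform[OF this] show "\<forall>\<^sub>F n in sequentially. dist (rs n (cut t) x) (rl t x) < e"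
    by (rule eventually_mono) (simp add: dist_real_def abs_minus_commute)
qed

lemma rl_cont: "continuous_on UNIV (\<lambda>(t, x). rl t x)"
proof -
  have c: "continuous_on ({0..T} \<times> UNIV) (\<lambda>p. rs n (fst p) (snd p))" for n
    by (intro continuous_on_swap_args[OF rs_cont] continuous_intros)
  have "continuous_on ({0..T} \<times> UNIV) limit"
    by (rule uniform_limit_theorem[OF always_eventually rs_uniform]) (simp_all add: c)
  moreover have "continuous_on UNIV (\<lambda>p::real \<times> real. (cut (fst p), snd p))"
    unfolding cut_def by (intro continuous_intros)
  ultimately have "continuous_on UNIV (\<lambda>p. limit (cut (fst p), snd p))"
    by (rule continuous_on_compose2) (use cut(1) in auto)
  then show ?thesis by (simp add: rl_def split_beta)
qed

lemma rl_good: "good rl"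
proof -
  have "rl t (x + 2) = rl t x" for t x
  proof -
    have "rs n (cut t) (x + 2) = rs n (cut t) x" for n using rs_good[of n] by (simp add: good_def)
    then show ?thesis using rl_lim[of t "x + 2"] rl_lim[of t x] by (auto intro: LIMSEQ_unique)
  qed
  \<comment> \<open>The value vanishes for every iterate and depends on the unknown with constant 1
    in the sup norm, so otherwise it would be at most half of itself.\<close>
  moreover have "y rl t 1 = 0" for t
  proof (rule ccontr)
    assume "y rl t 1 \<noteq> 0"
    then have e: "\<bar>y rl t 1\<bar> / 2 > 0" by simp
    obtain n where n: "\<And>s x. \<bar>rl s x - rs n (cut s) x\<bar> < \<bar>y rl t 1\<bar> / 2"
      using eventually_happens'[OF sequentially_bot rl_uniform[OF e]] by blast
    have "\<bar>y rl t 1 - y (rs n) (cut t) 1\<bar> \<le> \<bar>y rl t 1\<bar> / 2"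
      by (rule y_diff[OF rl_cont rs_cont]) (use n[of t] in \<open>auto intro: less_imp_le\<close>)
    moreover have "y (rs n) (cut t) 1 = 0" using rs_good[of n] by (simp add: good_def)
    ultimately show False using e by simp
  qed
  ultimately show ?thesis using rl_cont by (simp add: good_def)
qed

text \<open>The iterates converge to the limit, while their steps converge to the step of the limit
  by the contraction estimate.\<close>

lemma rl_fix:
  assumes t: "t \<in> {0..T}"
  shows "step rl t x = rl t x"
proof -
  have "(\<lambda>n. rs (Suc n) t x) \<longlonglongrightarrow> step rl t x"
  proof (rule tendstoI)
    fix e :: real assume e: "e > 0"
    let ?E = "exp (2 * L * T)"
    have "\<forall>\<^sub>F n in sequentially. \<forall>t x. \<bar>rl t x - rs n (cut t) x\<bar> < e / ?E" by (rule rl_uniform) (use e in simp)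
    then show "\<forall>\<^sub>F n in sequentially. dist (rs (Suc n) t x) (step rl t x) < e"
    proof (rule eventually_mono)
      fix n assume n: "\<forall>t x. \<bar>rl t x - rs n (cut t) x\<bar> < e / ?E"
      have "\<bar>step rl t x - step (rs n) t x\<bar> \<le> (e / ?E) / 2 * exp (2 * L * t)"
      proof (rule step_diff[OF rl_cont rs_cont _ rs_bound t])
        fix s x assume s: "s \<in> {0..T}"
        have "1 \<le> exp (2 * L * s)" using s L_pos by simp
        then have "e / ?E * 1 \<le> e / ?E * exp (2 * L * s)" by (rule mult_left_mono) (use e in simp)
        then show "\<bar>rl s x - rs n s x\<bar> \<le> e / ?E * exp (2 * L * s)"
          using n[rule_format, of s x] cut(2)[OF s] by simp
      qed (use e in auto)
      also have "\<dots> \<le> (e / ?E) / 2 * ?E" using t L_pos e by (intro mult_left_mono) auto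
      also have "\<dots> < e" using e by simp
      finally show "dist (rs (Suc n) t x) (step rl t x) < e"
        by (simp add: dist_real_def abs_minus_commute)
    qed
  qed
  moreover have "(\<lambda>n. rs (Suc n) t x) \<longlonglongrightarrow> rl t x"
    using LIMSEQ_Suc[OF rl_lim[of t x]] cut(2)[OF t] by simp
  ultimately show ?thesis by (rule LIMSEQ_unique)
qed

section \<open>From the fixed point to the wave system\<close>

lemma sprim_\<Psi>_cont: "continuous_on UNIV (sprim \<Psi>)"
  by (rule continuous_on_if_DERIV[OF sprim_deriv[OF \<Psi>_cont]])

theorem solution_exists:
  shows "\<exists>p u px ux F :: real \<Rightarrow> real \<Rightarrow> real.
    continuous_on UNIV (\<lambda>(t, x). p t x) \<and> continuous_on UNIV (\<lambda>(t, x). u t x) \<and>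
    continuous_on UNIV (\<lambda>(t, x). px t x) \<and> continuous_on UNIV (\<lambda>(t, x). ux t x) \<and> continuous_on UNIV (\<lambda>(t, x). F t x) \<and>
    (\<forall>t x. (p t has_real_derivative px t x) (at x)) \<and> (\<forall>t x. (u t has_real_derivative ux t x) (at x)) \<and>
    (\<forall>t x. ((\<lambda>t. p t x) has_real_derivative - ux t x) (at t)) \<and>
    (\<forall>t x. ((\<lambda>t. u t x) has_real_derivative - px t x - F t x) (at t)) \<and>
    (\<forall>t\<in>{0..T}. \<forall>x\<in>{0..1}. F t x = \<beta> t x + b (\<alpha> t x + u t x)) \<and>
    (\<forall>t. u t 0 = 0 \<and> u t 1 = 0) \<and> (\<forall>x\<in>{0..1}. p 0 x = 0 \<and> u 0 x = sprim \<psi> x)"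
proof -
  note rc = rl_cont
  \<comment> \<open>Pressure and velocity will be the even and odd parts of \<open>v\<close>. Its
    space derivative is \<open>step rl\<close> at all times, which agrees with \<open>rl\<close> on
    [0, T]; there the source is the intended one.\<close>
  let ?s = "step rl" and ?v = "v rl" and ?f = "f rl"
  define p where "p t x = (?v t x + ?v t (- x)) / 2" for t x
  define u where "u t x = (?v t x - ?v t (- x)) / 2" for t x
  define px where "px t x = (?s t x - ?s t (- x)) / 2" for t x
  define ux where "ux t x = (?s t x + ?s t (- x)) / 2" for t x
  have rev: "((\<lambda>x. ?v t (- x)) has_real_derivative - ?s t (- x)) (at x)" for t x
    by (rule DERIV_chain2[OF v_deriv(1)[OF rc], THEN DERIV_cong]) (auto intro!: derivative_eq_intros)
  have c: "continuous_on UNIV (\<lambda>(t, x). px t x)" "continuous_on UNIV (\<lambda>(t, x). ux t x)"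
    unfolding px_def ux_def split_beta
    by (intro continuous_intros continuous_on_swap_args[OF step_cont[OF rc]], simp)+
  have vc: "continuous_on UNIV (\<lambda>(t, x). ?v t x)"
    unfolding v_def[OF rc] split_beta
    by (intro continuous_intros continuous_on_swap_args[OF transport_continuous[OF f_cont[OF rc]]]
        continuous_on_compose2[OF sprim_\<Psi>_cont]) auto
  have c': "continuous_on UNIV (\<lambda>(t, x). p t x)" "continuous_on UNIV (\<lambda>(t, x). u t x)"
    unfolding p_def u_def split_beta
    by (intro continuous_intros continuous_on_swap_args[OF vc], simp)+
  have dx: "(p t has_real_derivative px t x) (at x)" "(u t has_real_derivative ux t x) (at x)" for t x
    unfolding p_def[abs_def] u_def[abs_def]
    by (rule DERIV_cong[OF DERIV_cdivide[OF DERIV_add[OF v_deriv(1)[OF rc] rev], where c = 2]], simp add: px_def,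
        rule DERIV_cong[OF DERIV_cdivide[OF DERIV_diff[OF v_deriv(1)[OF rc] rev], where c = 2]], simp add: ux_def)
  have dt: "((\<lambda>t. p t x) has_real_derivative - ux t x) (at t)"
    "((\<lambda>t. u t x) has_real_derivative - px t x - ?f t x) (at t)" for t x
    unfolding p_def u_def
    by (rule DERIV_cong[OF DERIV_cdivide[OF DERIV_add[OF v_deriv(2)[OF rc] v_deriv(2)[OF rc]], where c = 2]],
        simp add: ux_def f_odd[OF rc] field_simps,
        rule DERIV_cong[OF DERIV_cdivide[OF DERIV_diff[OF v_deriv(2)[OF rc] v_deriv(2)[OF rc]], where c = 2]],
        simp add: px_def f_odd[OF rc] field_simps)
  have F: "?f t x = \<beta> t x + b (\<alpha> t x + u t x)" if "t \<in> {0..T}" "x \<in> {0..1}" for t x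
  proof -
    have "D rl t = D ?s t" using rl_fix[OF that(1)] by (simp add: D_def[abs_def])
    then have "y rl t x = u t x" using good_step(3)[OF rl_good, of t x] by (simp add: y_def u_def)
    then show ?thesis using sprim_H[OF rc, of x t] that(2) by (simp add: f_def[OF rc])
  qed
  have bc: "u t 0 = 0 \<and> u t 1 = 0" for t
    using good_step(2)[OF rl_good, of t "-1"] by (simp add: u_def)
  have ic: "p 0 x = 0 \<and> u 0 x = sprim \<psi> x" if "x \<in> {0..1}" for x
  proof -
    have "sprim \<Psi> x = sprim \<psi> x"
      unfolding sprim_def \<Psi>_def
      by (intro arg_cong2[where f = "(*)"] refl Henstock_Kurzweil_Integration.integral_cong arg_cong[where f = \<psi>] tri_id)
        (use that in \<open>auto intro: mult_le_one\<close>)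
    then show ?thesis
      using v_cont_0[OF rc] sprim_odd[of \<Psi> x, OF \<Psi>_sym(1)] by (simp add: p_def u_def)
  qed
  show ?thesis
    by (rule exI[of _ p], rule exI[of _ u], rule exI[of _ px], rule exI[of _ ux], rule exI[of _ ?f])
      (use c c' f_cont[OF rc] dx dt F bc ic in simp)
qed

end

subsection \<open>Continuously differentiable functions as curves in Sobolev spaces\<close>

interpretation unit_interval: open_interval I01
  by unfold_locales (auto simp: is_interval_1)

lemma norm_L2_le_sup:
  assumes "a \<le> b" "continuous_on {a..b} g" "\<And>x. x \<in> {a..b} \<Longrightarrow> \<bar>g x\<bar> \<le> \<delta>"
  shows "norm_L2 {a<..<b} g \<le> \<delta> * sqrt (b - a)"
proof -
  have d: "\<delta> \<ge> 0" using assms(1) assms(3)[of a] by (auto intro: order_trans[OF abs_ge_zero])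
  have gL: "g \<in> L2 {a<..<b}" by (rule continuous_L2[OF assms(2)])
  have c: "(\<lambda>x. \<delta>\<^sup>2) \<in> L2 {a<..<b}" "(\<lambda>x. 1) \<in> L2 {a<..<b}" by (rule continuous_L2, simp)+
  have "(norm_L2 {a<..<b} g)\<^sup>2 \<le> ip {a<..<b} (\<lambda>x. \<delta>\<^sup>2) (\<lambda>x. 1)"
    unfolding ip_self[symmetric] unfolding ip_def
  proof (rule set_integral_mono)
    fix x assume "x \<in> {a<..<b}"
    then have "\<bar>g x\<bar> \<le> \<delta>" using assms(3) by simp
    then have "(g x)\<^sup>2 \<le> \<delta>\<^sup>2" using d by (simp add: abs_le_square_iff[symmetric])
    then show "g x * g x \<le> \<delta>\<^sup>2 * 1" by (simp add: power2_eq_square)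
  qed (rule L2_mult_integrable[OF gL gL], rule L2_mult_integrable[OF c])
  also have "\<dots> = (\<delta> * sqrt (b - a))\<^sup>2"
    using ip_Ioo_eq_integral(1)[OF c] assms(1) by (simp add: power_mult_distrib mult.commute)
  finally show ?thesis by (rule power2_le_imp_le) (use d assms(1) in simp)
qed

lemma norm_L2_le_sup_unit:
  "continuous_on {0..1} g \<Longrightarrow> (\<And>x. x \<in> {0..1} \<Longrightarrow> \<bar>g x\<bar> \<le> \<delta>) \<Longrightarrow> norm_L2 I01 g \<le> \<delta>"
  using norm_L2_le_sup[of 0 1 g \<delta>] by simp

section \<open>Continuity on the space-time rectangle and convergence in L2\<close>

definition rect :: "real \<Rightarrow> (real \<times> real) set" where "rect T = {0..T} \<times> {0..1}"

lemma rect_slice: "continuous_on (rect T) (\<lambda>(t, x). F t x) \<Longrightarrow> t \<in> {0..T} \<Longrightarrow> continuous_on {0..1} (F t)"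
proof -
  assume F: "continuous_on (rect T) (\<lambda>(t, x). F t x)" and t: "t \<in> {0..T}"
  have p: "continuous_on {0..1::real} (\<lambda>x. (t, x))" by (intro continuous_intros)
  have "(\<lambda>x. (t, x)) ` {0..1} \<subseteq> rect T" using t by (auto simp: rect_def)
  from continuous_on_compose2[OF F p this] show "continuous_on {0..1} (F t)" by simp
qed

lemma rect_uniform:
  fixes F :: "real \<Rightarrow> real \<Rightarrow> real"
  assumes F: "continuous_on (rect T) (\<lambda>(t, x). F t x)" and e: "e > 0"
  obtains d where "d > 0"
    "\<And>s t x. s \<in> {0..T} \<Longrightarrow> t \<in> {0..T} \<Longrightarrow> x \<in> {0..1} \<Longrightarrow> \<bar>s - t\<bar> < d \<Longrightarrow> \<bar>F s x - F t x\<bar> < e"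
proof -
  have "compact (rect T)" unfolding rect_def by (intro compact_Times compact_Icc)
  with F have "uniformly_continuous_on (rect T) (\<lambda>(t, x). F t x)" by (rule compact_uniformly_continuous)
  then have "\<exists>d>0. \<forall>p\<in>rect T. \<forall>q\<in>rect T. dist q p < d \<longrightarrow> dist ((\<lambda>(t, x). F t x) q) ((\<lambda>(t, x). F t x) p) < e"
    using e unfolding uniformly_continuous_on_def by blast
  then obtain d where d: "d > 0"
    "\<And>p q. p \<in> rect T \<Longrightarrow> q \<in> rect T \<Longrightarrow> dist q p < d \<Longrightarrow> dist ((\<lambda>(t, x). F t x) q) ((\<lambda>(t, x). F t x) p) < e"
    by blast
  show ?thesis
  proof (rule that[OF d(1)])
    fix s t x :: real assume *: "s \<in> {0..T}" "t \<in> {0..T}" "x \<in> {0..1}" "\<bar>s - t\<bar> < d"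
    then show "\<bar>F s x - F t x\<bar> < e"
      using d(2)[of "(t, x)" "(s, x)"] by (simp add: rect_def dist_Pair_Pair dist_real_def)
  qed
qed

lemma rect_tendsto:
  fixes F :: "real \<Rightarrow> real \<Rightarrow> real"
  assumes F: "continuous_on (rect T) (\<lambda>(t, x). F t x)" and t: "t \<in> {0..T}"
  shows "((\<lambda>s. norm_L2 I01 (\<lambda>x. F s x - F t x)) \<longlongrightarrow> 0) (at t within {0..T})"
proof (rule tendstoI)
  fix e :: real assume e: "e > 0"
  then have e2: "e / 2 > 0" by simp
  obtain d where d: "d > 0"
    "\<And>s t x. s \<in> {0..T} \<Longrightarrow> t \<in> {0..T} \<Longrightarrow> x \<in> {0..1} \<Longrightarrow> \<bar>s - t\<bar> < d \<Longrightarrow> \<bar>F s x - F t x\<bar> < e / 2"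
    using rect_uniform[OF F e2] by blast
  have "dist (norm_L2 I01 (\<lambda>x. F s x - F t x)) 0 < e" if s: "s \<in> {0..T}" "dist s t < d" for s
  proof -
    have "norm_L2 I01 (\<lambda>x. F s x - F t x) \<le> e / 2"
    proof (rule norm_L2_le_sup_unit)
      show "continuous_on {0..1} (\<lambda>x. F s x - F t x)"
        by (intro continuous_on_diff rect_slice[OF F] s t)
      show "\<bar>F s x - F t x\<bar> \<le> e / 2" if "x \<in> {0..1}" for x
        using d(2)[OF s(1) t that] s(2) by (simp add: dist_real_def)
    qed
    then show ?thesis using e norm_L2_nonneg[of I01 "\<lambda>x. F s x - F t x"] by (simp add: dist_real_def)
  qed
  then show "\<forall>\<^sub>F s in at t within {0..T}. dist (norm_L2 I01 (\<lambda>x. F s x - F t x)) 0 < e"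
    unfolding eventually_at using d(1) by blast
qed

lemma rect_curve_C_L2: "continuous_on (rect T) (\<lambda>(t, x). F t x) \<Longrightarrow> curve_C_L2 T F"
  unfolding curve_C_L2_def using rect_tendsto continuous_L2[OF rect_slice] by blast

lemma primitive_on_weak_deriv_unit:
  assumes "\<And>x. x \<in> {0..1} \<Longrightarrow> (f has_real_derivative g x) (at x within {0..1})" "continuous_on {0..1} g"
  shows "weak_deriv I01 1 f g"
proof -
  have "primitive_on {0..1} f g" by (rule primitive_on_C1[OF assms is_interval_cc])
  then have "primitive_on I01 f g" by (rule primitive_on_subset) auto
  then show ?thesis by (rule unit_interval.primitive_on_imp_weak_deriv)
qed

text \<open>\<open>norm_H\<close> is built on chosen weak derivatives; by uniqueness any square
  integrable one gives the same value.\<close>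

lemma norm_H_1_eq:
  assumes "f \<in> L2 I01" "g \<in> L2 I01" "weak_deriv I01 1 f g"
  shows "norm_H 1 I01 f = sqrt ((norm_L2 I01 f)\<^sup>2 + (norm_L2 I01 g)\<^sup>2)" "f \<in> sobolev_H 1 I01"
proof -
  have w0: "weak_deriv I01 0 f f"
    by (rule unit_interval.weak_deriv_0) (use assms(3) in \<open>simp add: weak_deriv_def\<close>)
  have ae: "AE x in lebesgue. x \<in> I01 \<longrightarrow> f x = wderiv I01 0 f x" "AE x in lebesgue. x \<in> I01 \<longrightarrow> g x = wderiv I01 1 f x"
    using unit_interval.weak_deriv_wderiv(2)[OF w0] unit_interval.weak_deriv_wderiv(2)[OF assms(3)]
    by (eventually_elim, simp)+
  have "norm_L2 I01 (wderiv I01 0 f) = norm_L2 I01 f" "norm_L2 I01 (wderiv I01 1 f) = norm_L2 I01 g"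
    using norm_L2_cong_AE[OF ae(1) assms(1)] norm_L2_cong_AE[OF ae(2) assms(2)] by simp_all
  moreover have "{..1::nat} = {0, 1}" by auto
  ultimately show "norm_H 1 I01 f = sqrt ((norm_L2 I01 f)\<^sup>2 + (norm_L2 I01 g)\<^sup>2)"
    by (simp add: norm_H_def)
  have "\<exists>h\<in>L2 I01. weak_deriv I01 i f h" if "i \<le> 1" for i
  proof (cases "i = 0")
    case True
    then show ?thesis using w0 assms(1) by blast
  next
    case False
    then have "i = 1" using that by simp
    then show ?thesis using assms(2,3) by blast
  qed
  then show "f \<in> sobolev_H 1 I01" using assms(1) by (simp add: sobolev_H_def)
qed

text \<open>Uniform continuity on the compact rectangle makes increments and difference quotients
  converge uniformly in space, hence in L2.\<close>

lemma C1_curves: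
  fixes v vx vt :: "real \<Rightarrow> real \<Rightarrow> real"
  assumes c: "continuous_on (rect T) (\<lambda>(t, x). v t x)" and cx: "continuous_on (rect T) (\<lambda>(t, x). vx t x)"
    and ct: "continuous_on (rect T) (\<lambda>(t, x). vt t x)"
    and dx: "\<And>t x. t \<in> {0..T} \<Longrightarrow> x \<in> {0..1} \<Longrightarrow> (v t has_real_derivative vx t x) (at x within {0..1})"
    and dt: "\<And>t x. t \<in> {0..T} \<Longrightarrow> x \<in> {0..1} \<Longrightarrow> ((\<lambda>t. v t x) has_real_derivative vt t x) (at t within {0..T})"
  shows "curve_C_H1 T v" "curve_C1_L2 T v vt" "t \<in> {0..T} \<Longrightarrow> weak_deriv I01 1 (v t) (vx t)"
proof -
  show w: "weak_deriv I01 1 (v t) (vx t)" if "t \<in> {0..T}" for t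
    by (rule primitive_on_weak_deriv_unit[OF dx[OF that] rect_slice[OF cx that]])
  have L: "v t \<in> L2 I01" "vx t \<in> L2 I01" if "t \<in> {0..T}" for t
    using continuous_L2[OF rect_slice[OF c that]] continuous_L2[OF rect_slice[OF cx that]] by auto
  show "curve_C_H1 T v"
    unfolding curve_C_H1_def
  proof (intro ballI conjI)
    fix t assume t: "t \<in> {0..T}"
    show "v t \<in> sobolev_H 1 I01" by (rule norm_H_1_eq(2)[OF L[OF t] w[OF t]])
    have "((\<lambda>s. sqrt ((norm_L2 I01 (\<lambda>x. v s x - v t x))\<^sup>2 + (norm_L2 I01 (\<lambda>x. vx s x - vx t x))\<^sup>2)) \<longlongrightarrow> sqrt (0\<^sup>2 + 0\<^sup>2))
        (at t within {0..T})"
      by (intro tendsto_intros rect_tendsto c cx t)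
    then have lim: "((\<lambda>s. sqrt ((norm_L2 I01 (\<lambda>x. v s x - v t x))\<^sup>2 + (norm_L2 I01 (\<lambda>x. vx s x - vx t x))\<^sup>2)) \<longlongrightarrow> 0)
        (at t within {0..T})" by simp
    have "\<forall>\<^sub>F s in at t within {0..T}. s \<in> {0..T}" by (auto simp: eventually_at_filter)
    then show "((\<lambda>s. norm_H 1 I01 (\<lambda>x. v s x - v t x)) \<longlongrightarrow> 0) (at t within {0..T})"
    proof (rule Lim_transform_eventually[OF lim eventually_mono])
      fix s assume s: "s \<in> {0..T}"
      show "sqrt ((norm_L2 I01 (\<lambda>x. v s x - v t x))\<^sup>2 + (norm_L2 I01 (\<lambda>x. vx s x - vx t x))\<^sup>2)
          = norm_H 1 I01 (\<lambda>x. v s x - v t x)"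
        by (rule norm_H_1_eq(1)[OF L2_diff[OF L(1)[OF s] L(1)[OF t]] L2_diff[OF L(2)[OF s] L(2)[OF t]]
          unit_interval.weak_deriv_diff[OF w[OF s] w[OF t]], symmetric])
    qed
  qed
  have q: "((\<lambda>s. norm_L2 I01 (\<lambda>x. (v s x - v t x) / (s - t) - vt t x)) \<longlongrightarrow> 0) (at t within {0..T})"
    if t: "t \<in> {0..T}" for t
  proof (rule tendstoI)
    fix e :: real assume e: "e > 0"
    then have e2: "e / 2 > 0" by simp
    obtain d where d: "d > 0"
      "\<And>s t x. s \<in> {0..T} \<Longrightarrow> t \<in> {0..T} \<Longrightarrow> x \<in> {0..1} \<Longrightarrow> \<bar>s - t\<bar> < d \<Longrightarrow> \<bar>vt s x - vt t x\<bar> < e / 2"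
      using rect_uniform[OF ct e2] by blast
    have "dist (norm_L2 I01 (\<lambda>x. (v s x - v t x) / (s - t) - vt t x)) 0 < e"
      if s: "s \<in> {0..T}" "s \<noteq> t" "dist s t < d" for s
    proof -
      have "norm_L2 I01 (\<lambda>x. (v s x - v t x) / (s - t) - vt t x) \<le> e / 2"
      proof (rule norm_L2_le_sup_unit)
        show "continuous_on {0..1} (\<lambda>x. (v s x - v t x) / (s - t) - vt t x)"
          by (intro continuous_intros rect_slice[OF c] rect_slice[OF ct] s t) (use s in simp)
        fix x :: real assume x: "x \<in> {0..1}"
        let ?S = "closed_segment t s"
        have sub: "?S \<subseteq> {0..T}" using s(1) t by (auto simp: closed_segment_eq_real_ivl)
        \<comment> \<open>Subtracting the linear function with slope \<open>vt t x\<close> leaves a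
          function of time whose derivative is at most e / 2 near t.\<close>
        have "norm ((v s x - vt t x * s) - (v t x - vt t x * t)) \<le> e / 2 * norm (s - t)"
        proof (rule field_differentiable_bound[of ?S "\<lambda>r. v r x - vt t x * r" "\<lambda>r. vt r x - vt t x"])
          fix r assume r: "r \<in> ?S"
          have "((\<lambda>r. v r x) has_real_derivative vt r x) (at r within ?S)"
            by (rule DERIV_subset[OF dt[OF _ x] sub]) (use r sub in blast)
          then show "((\<lambda>r. v r x - vt t x * r) has_real_derivative vt r x - vt t x) (at r within ?S)"
            by (auto intro!: derivative_eq_intros)
          have "\<bar>r - t\<bar> < d"
            using r s(3) by (auto simp: closed_segment_eq_real_ivl dist_real_def split: if_splits)
          then show "norm (vt r x - vt t x) \<le> e / 2"
            using d(2)[of r t x] r sub t x by (simp add: subset_iff less_imp_le)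
        qed auto
        then have *: "\<bar>(v s x - v t x) - vt t x * (s - t)\<bar> \<le> e / 2 * \<bar>s - t\<bar>"
          by (simp add: algebra_simps)
        have "(v s x - v t x) / (s - t) - vt t x = ((v s x - v t x) - vt t x * (s - t)) / (s - t)"
          using s(2) by (simp add: field_simps)
        then have "\<bar>(v s x - v t x) / (s - t) - vt t x\<bar> = \<bar>(v s x - v t x) - vt t x * (s - t)\<bar> / \<bar>s - t\<bar>"
          by simp
        also have "\<dots> \<le> (e / 2 * \<bar>s - t\<bar>) / \<bar>s - t\<bar>" by (rule divide_right_mono[OF *]) simp
        also have "\<dots> = e / 2" using s(2) by simp
        finally show "\<bar>(v s x - v t x) / (s - t) - vt t x\<bar> \<le> e / 2" .
      qed
      then show ?thesis
        using e norm_L2_nonneg[of I01 "\<lambda>x. (v s x - v t x) / (s - t) - vt t x"] by (simp add: dist_real_def)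
    qed
    then show "\<forall>\<^sub>F s in at t within {0..T}. dist (norm_L2 I01 (\<lambda>x. (v s x - v t x) / (s - t) - vt t x)) 0 < e"
      unfolding eventually_at using d(1) by blast
  qed
  show "curve_C1_L2 T v vt"
    unfolding curve_C1_L2_def by (intro conjI ballI rect_curve_C_L2 c ct q)
qed

lemma classical_solutionI:
  fixes p u px ux pt ut :: "real \<Rightarrow> real \<Rightarrow> real"
  assumes c: "continuous_on (rect T) (\<lambda>(t, x). p t x)" "continuous_on (rect T) (\<lambda>(t, x). u t x)"
      "continuous_on (rect T) (\<lambda>(t, x). px t x)" "continuous_on (rect T) (\<lambda>(t, x). ux t x)"
      "continuous_on (rect T) (\<lambda>(t, x). pt t x)" "continuous_on (rect T) (\<lambda>(t, x). ut t x)"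
    and d: "\<And>t x. t \<in> {0..T} \<Longrightarrow> x \<in> {0..1} \<Longrightarrow> (p t has_real_derivative px t x) (at x within {0..1})"
      "\<And>t x. t \<in> {0..T} \<Longrightarrow> x \<in> {0..1} \<Longrightarrow> (u t has_real_derivative ux t x) (at x within {0..1})"
      "\<And>t x. t \<in> {0..T} \<Longrightarrow> x \<in> {0..1} \<Longrightarrow> ((\<lambda>t. p t x) has_real_derivative pt t x) (at t within {0..T})"
      "\<And>t x. t \<in> {0..T} \<Longrightarrow> x \<in> {0..1} \<Longrightarrow> ((\<lambda>t. u t x) has_real_derivative ut t x) (at t within {0..T})"
    and eqs: "\<And>t x. t \<in> {0..T} \<Longrightarrow> x \<in> {0..1} \<Longrightarrow> pt t x + ux t x = 0"
      "\<And>t x. t \<in> {0..T} \<Longrightarrow> x \<in> {0..1} \<Longrightarrow> ut t x + px t x + a (u t x) = 0"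
    and bc: "\<And>t. t \<in> {0..T} \<Longrightarrow> u t 0 = g0 t \<and> u t 1 = g1 t"
    and ic: "\<And>x. x \<in> {0..1} \<Longrightarrow> p 0 x = c0 \<and> u 0 x = 0"
  shows "classical_solution T c0 g0 g1 a p u"
proof -
  have P: "curve_C_H1 T p" "curve_C1_L2 T p pt" "\<And>t. t \<in> {0..T} \<Longrightarrow> weak_deriv I01 1 (p t) (px t)"
    using C1_curves[OF c(1,3,5)] d(1,3) by blast+
  have U: "curve_C_H1 T u" "curve_C1_L2 T u ut" "\<And>t. t \<in> {0..T} \<Longrightarrow> weak_deriv I01 1 (u t) (ux t)"
    using C1_curves[OF c(2,4,6)] d(2,4) by blast+
  have pde: "AE x in lebesgue. x \<in> I01 \<longrightarrow> pt t x + wderiv I01 1 (u t) x = 0 \<and>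
      ut t x + wderiv I01 1 (p t) x + a (u t x) = 0" if "t \<in> {0<..<T}" for t
  proof -
    have t: "t \<in> {0..T}" using that by simp
    have "AE x in lebesgue. x \<in> I01 \<longrightarrow> wderiv I01 1 (p t) x = px t x"
      "AE x in lebesgue. x \<in> I01 \<longrightarrow> wderiv I01 1 (u t) x = ux t x"
      using unit_interval.weak_deriv_wderiv(2) P(3)[OF t] U(3)[OF t] by blast+
    then show ?thesis by eventually_elim (use eqs[OF t] in auto)
  qed
  have "\<exists>p' u'. curve_C1_L2 T p p' \<and> curve_C1_L2 T u u' \<and>
        (\<forall>t\<in>{0<..<T}. AE x in lebesgue. x \<in> I01 \<longrightarrow>
           p' t x + wderiv I01 1 (u t) x = 0 \<and> u' t x + wderiv I01 1 (p t) x + a (u t x) = 0)"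
    by (rule exI[of _ pt], rule exI[of _ ut]) (intro conjI ballI P(2) U(2) pde)
  moreover have "\<forall>t\<in>{0..T}. continuous_on {0..1} (p t) \<and> continuous_on {0..1} (u t)"
    using rect_slice[OF c(1)] rect_slice[OF c(2)] by blast
  ultimately show ?thesis
    unfolding classical_solution_def using P(1) U(1) bc ic by blast
qed

subsection \<open>Existence of classical solutions\<close>

text \<open>The boundary data are lifted by a cubic in \<^term>\<open>x\<close>. Prescribing also its second derivatives
  at the end points makes the compatibility condition of \<^locale>\<open>wave_fixpoint\<close> hold.\<close>

definition cubic :: "real \<Rightarrow> real \<Rightarrow> real \<Rightarrow> real \<Rightarrow> real \<Rightarrow> real" where
  "cubic k0 k1 c0 c1 x = (1 - x) * k0 + x * k1 + ((1 - x)^3 - (1 - x)) / 6 * c0 + (x^3 - x) / 6 * c1"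

definition cubic_x :: "real \<Rightarrow> real \<Rightarrow> real \<Rightarrow> real \<Rightarrow> real \<Rightarrow> real" where
  "cubic_x k0 k1 c0 c1 x = k1 - k0 - (3 * (1 - x)^2 - 1) / 6 * c0 + (3 * x^2 - 1) / 6 * c1"

definition cubic_xx :: "real \<Rightarrow> real \<Rightarrow> real \<Rightarrow> real" where
  "cubic_xx c0 c1 x = (1 - x) * c0 + x * c1"

lemma cubic_deriv_x:
  "(cubic k0 k1 c0 c1 has_real_derivative cubic_x k0 k1 c0 c1 x) (at x)"
  "(cubic_x k0 k1 c0 c1 has_real_derivative cubic_xx c0 c1 x) (at x)"
  "(cubic_xx c0 c1 has_real_derivative c1 - c0) (at x)"
  unfolding cubic_def[abs_def] cubic_x_def[abs_def] cubic_xx_def[abs_def]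
  by - (auto intro!: derivative_eq_intros simp: field_simps power2_eq_square)

lemma cubic_deriv_t:
  assumes "(k0 has_real_derivative k0') (at t within S)" "(k1 has_real_derivative k1') (at t within S)"
    "(c0 has_real_derivative c0') (at t within S)" "(c1 has_real_derivative c1') (at t within S)"
  shows "((\<lambda>t. cubic (k0 t) (k1 t) (c0 t) (c1 t) x) has_real_derivative cubic k0' k1' c0' c1' x) (at t within S)"
    "((\<lambda>t. cubic_x (k0 t) (k1 t) (c0 t) (c1 t) x) has_real_derivative cubic_x k0' k1' c0' c1' x) (at t within S)"
proof -
  have r: "((\<lambda>t. k t * y) has_real_derivative k' * y) (at t within S)"
    "((\<lambda>t. y * k t) has_real_derivative y * k') (at t within S)"
    if "(k has_real_derivative k') (at t within S)" for k k' y
    using DERIV_cmult[OF that, of y] by (simp_all add: mult.commute)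
  show "((\<lambda>t. cubic (k0 t) (k1 t) (c0 t) (c1 t) x) has_real_derivative cubic k0' k1' c0' c1' x) (at t within S)"
    unfolding cubic_def by (rule DERIV_add DERIV_diff r assms)+
  show "((\<lambda>t. cubic_x (k0 t) (k1 t) (c0 t) (c1 t) x) has_real_derivative cubic_x k0' k1' c0' c1' x) (at t within S)"
    unfolding cubic_x_def by (rule DERIV_add DERIV_diff r assms)+
qed

lemma cubic_continuous:
  assumes "continuous_on A k0" "continuous_on A k1" "continuous_on A c0" "continuous_on A c1" "continuous_on A y"
  shows "continuous_on A (\<lambda>p. cubic (k0 p) (k1 p) (c0 p) (c1 p) (y p))"
    "continuous_on A (\<lambda>p. cubic_x (k0 p) (k1 p) (c0 p) (c1 p) (y p))"
  unfolding cubic_def cubic_x_def by - (intro continuous_intros assms; simp)+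

lemma cubic_xx_continuous:
  "continuous_on A c0 \<Longrightarrow> continuous_on A c1 \<Longrightarrow> continuous_on A y \<Longrightarrow> continuous_on A (\<lambda>p. cubic_xx (c0 p) (c1 p) (y p))"
  unfolding cubic_xx_def by (intro continuous_intros)

lemma cubic_ends:
  "cubic k0 k1 c0 c1 0 = k0" "cubic k0 k1 c0 c1 1 = k1" "cubic_xx c0 c1 0 = c0" "cubic_xx c0 c1 1 = c1"
  by (simp_all add: cubic_def cubic_xx_def)

text \<open>By the second equation \<open>- m\<close> is the trace of \<open>p\<^sub>x\<close>.\<close>

lemma boundary_data:
  assumes b: "\<And>z. (b has_real_derivative b1 z) (at z)" "\<And>z. (b1 has_real_derivative b2 z) (at z)"
      "continuous_on UNIV b2" "b 0 = 0" and T: "T > 0"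
    and g: "C_k_on 4 T g" "g 0 = 0" "(g has_real_derivative 0) (at 0 within {0..T})"
  obtains G g' m m1 m2 where
    "\<And>t. t \<in> {0..T} \<Longrightarrow> (G has_real_derivative g t) (at t within {0..T})"
    "\<And>t. t \<in> {0..T} \<Longrightarrow> (g has_real_derivative g' t) (at t within {0..T})"
    "\<And>t. t \<in> {0..T} \<Longrightarrow> (m has_real_derivative m1 t) (at t within {0..T})"
    "\<And>t. t \<in> {0..T} \<Longrightarrow> (m1 has_real_derivative m2 t) (at t within {0..T})"
    "\<And>t. m t = g' t + b (g t)" "G 0 = 0" "m 0 = 0"
    "continuous_on {0..T} g'" "continuous_on {0..T} m2"
proof -
  obtain d where d: "d 0 = g" "\<And>i t. i < 4 \<Longrightarrow> t \<in> {0..T} \<Longrightarrow> (d i has_real_derivative d (Suc i) t) (at t within {0..T})"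
    "\<And>i. i \<le> 4 \<Longrightarrow> continuous_on {0..T} (d i)"
    using g(1) unfolding C_k_on_def by blast
  have D: "(g has_real_derivative d 1 t) (at t within {0..T})" "(d 1 has_real_derivative d 2 t) (at t within {0..T})"
    "(d 2 has_real_derivative d 3 t) (at t within {0..T})" if "t \<in> {0..T}" for t
    using d(2)[of 0 t] d(2)[of 1 t] d(2)[of 2 t] that d(1) by (simp_all add: numeral_2_eq_2 numeral_3_eq_3)
  have gc: "continuous_on {0..T} g" using d(3)[of 0] d(1) by simp
  \<comment> \<open>At the end point only a one-sided derivative is available. It is unique because
    0 is a limit point of [0, T], so \<open>d 1 0\<close> is the prescribed value.\<close>
  have "at 0 within {0..T} \<noteq> bot" using T by (simp add: at_within_Icc_at_right)
  then have d10: "d 1 0 = 0"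
    using has_field_derivative_unique[OF D(1)[of 0] g(3)] T by simp
  define m where "m t = d 1 t + b (g t)" for t
  define m1 where "m1 t = d 2 t + b1 (g t) * d 1 t" for t
  define m2 where "m2 t = d 3 t + (b2 (g t) * d 1 t * d 1 t + b1 (g t) * d 2 t)" for t
  have ch: "((\<lambda>t. f (g t)) has_real_derivative f' (g t) * d 1 t) (at t within {0..T})"
    if "\<And>z. (f has_real_derivative f' z) (at z)" "t \<in> {0..T}" for f f' t
    by (rule DERIV_chain2[OF that(1) D(1)[OF that(2)]])
  have b1c: "continuous_on UNIV b1" by (rule continuous_on_if_DERIV[OF b(2)])
  show ?thesis
  proof (rule that[of "\<lambda>t. integral {0..t} g" "d 1" m m1 m2])
    fix t assume t: "t \<in> {0..T}"
    \<comment> \<open>A time antiderivative of the boundary value enters the lift of the pressure,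
      because p_t = - u_x.\<close>
    show "((\<lambda>t. integral {0..t} g) has_real_derivative g t) (at t within {0..T})"
      by (rule integral_has_real_derivative[OF gc t])
    show "(g has_real_derivative d 1 t) (at t within {0..T})" by (rule D(1)[OF t])
    show "(m has_real_derivative m1 t) (at t within {0..T})"
      unfolding m_def[abs_def] m1_def by (rule DERIV_add[OF D(2)[OF t] ch[OF b(1) t]])
    show "(m1 has_real_derivative m2 t) (at t within {0..T})"
      unfolding m1_def[abs_def] m2_def
      by (rule DERIV_cong[OF DERIV_add[OF D(3)[OF t] DERIV_mult[OF ch[OF b(2) t] D(2)[OF t]]]]) (simp add: ac_simps)
  next
    show "m 0 = 0" using d10 g(2) b(4) by (simp add: m_def)
    show "continuous_on {0..T} (d 1)" using d(3)[of 1] by simp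
    show "continuous_on {0..T} m2"
      unfolding m2_def[abs_def]
      by (intro continuous_intros d(3) gc continuous_on_compose2[OF b(3)] continuous_on_compose2[OF b1c]) simp_all
  qed (simp_all add: m_def)
qed

lemma classical_solution_exists:
  assumes C: "C2_param a0 a1 a2 a3 b b1 b2" and a: "a0 > 0" and T: "T > 0"
    and g0: "C_k_on 4 T g0" "g0 0 = 0" "(g0 has_real_derivative 0) (at 0 within {0..T})"
    and g1: "C_k_on 4 T g1" "g1 0 = 0" "(g1 has_real_derivative 0) (at 0 within {0..T})"
  shows "\<exists>p u. classical_solution T c g0 g1 b p u \<and> continuous_on {0..T} (\<lambda>t. p t 0) \<and> continuous_on {0..T} (\<lambda>t. p t 1)"
proof -
  note B = C2_paramD[OF C]
  note data = boundary_data[OF B(2,3,10,1) T]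
  obtain G0 h0 m0 m01 m02 where
    d0: "\<And>t. t \<in> {0..T} \<Longrightarrow> (G0 has_real_derivative g0 t) (at t within {0..T})"
    "\<And>t. t \<in> {0..T} \<Longrightarrow> (g0 has_real_derivative h0 t) (at t within {0..T})"
    "\<And>t. t \<in> {0..T} \<Longrightarrow> (m0 has_real_derivative m01 t) (at t within {0..T})"
    "\<And>t. t \<in> {0..T} \<Longrightarrow> (m01 has_real_derivative m02 t) (at t within {0..T})"
    and e0: "\<And>t. m0 t = h0 t + b (g0 t)" "G0 0 = 0" "m0 0 = 0"
    and c0: "continuous_on {0..T} h0" "continuous_on {0..T} m02"
    using data[OF g0] by blast
  obtain G1 h1 m1 m11 m12 where
    d1: "\<And>t. t \<in> {0..T} \<Longrightarrow> (G1 has_real_derivative g1 t) (at t within {0..T})"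
    "\<And>t. t \<in> {0..T} \<Longrightarrow> (g1 has_real_derivative h1 t) (at t within {0..T})"
    "\<And>t. t \<in> {0..T} \<Longrightarrow> (m1 has_real_derivative m11 t) (at t within {0..T})"
    "\<And>t. t \<in> {0..T} \<Longrightarrow> (m11 has_real_derivative m12 t) (at t within {0..T})"
    and e1: "\<And>t. m1 t = h1 t + b (g1 t)" "G1 0 = 0" "m1 0 = 0"
    and c1: "continuous_on {0..T} h1" "continuous_on {0..T} m12"
    using data[OF g1] by blast
  have dc: "continuous_on {0..T} k" if "\<And>t. t \<in> {0..T} \<Longrightarrow> (k has_real_derivative k' t) (at t within {0..T})" for k k'
    unfolding continuous_on_eq_continuous_within by (intro ballI DERIV_continuous[OF that])
  have k0: "continuous_on {0..T} G0" "continuous_on {0..T} g0" "continuous_on {0..T} m0" "continuous_on {0..T} m01"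
    by (rule dc, erule d0)+
  have k1: "continuous_on {0..T} G1" "continuous_on {0..T} g1" "continuous_on {0..T} m1" "continuous_on {0..T} m11"
    by (rule dc, erule d1)+
  \<comment> \<open>The fixed point argument asks for coefficients at all times; clamping time to
    [0, T] provides them.\<close>
  define cl where "cl t = max 0 (min T t)" for t
  have cl: "cl t \<in> {0..T}" "t \<in> {0..T} \<Longrightarrow> cl t = t" for t using T by (auto simp: cl_def)
  have clc: "continuous_on A cl" for A unfolding cl_def[abs_def] by (intro continuous_intros)
  have ext: "continuous_on UNIV (\<lambda>p::real \<times> real. k (cl (fst p)))" if "continuous_on {0..T} k" for k
    by (rule continuous_on_compose2[OF that, of UNIV "\<lambda>p. cl (fst p)"])
      (use cl(1) in \<open>auto intro!: continuous_on_compose2[OF clc[of UNIV]] continuous_intros\<close>)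
  \<comment> \<open>The lift of the velocity. Its second space derivatives at the ends are the time
    derivatives of m0 and m1, matching a pressure lift with p_x = - m there.\<close>
  define \<alpha> where "\<alpha> t x = cubic (g0 (cl t)) (g1 (cl t)) (m01 (cl t)) (m11 (cl t)) x" for t x
  define \<alpha>x where "\<alpha>x t x = cubic_x (g0 (cl t)) (g1 (cl t)) (m01 (cl t)) (m11 (cl t)) x" for t x
  \<comment> \<open>What the lifts contribute to the second equation besides \<open>b\<close>: the
    time derivative of \<alpha> and the space derivative of the pressure lift. At the ends this is h
    - m, which is minus \<open>b\<close> of the boundary value.\<close>
  define \<beta> where "\<beta> t x = cubic (h0 (cl t)) (h1 (cl t)) (m02 (cl t)) (m12 (cl t)) x - cubic_xx (m0 (cl t)) (m1 (cl t)) x" for t x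
  define \<beta>x where "\<beta>x t x = cubic_x (h0 (cl t)) (h1 (cl t)) (m02 (cl t)) (m12 (cl t)) x - (m1 (cl t) - m0 (cl t))" for t x
  \<comment> \<open>The velocity has to vanish initially, so the remainder starts from - \<alpha>;
    this is the space derivative of that initial value.\<close>
  define \<psi> where "\<psi> x = - cubic_x 0 0 (m01 0) (m11 0) x" for x
  note e00 = ext[OF k0(2)] ext[OF k1(2)] and e01 = ext[OF k0(3)] ext[OF k1(3)] and e2 = ext[OF k0(4)] ext[OF k1(4)]
    and eh = ext[OF c0(1)] ext[OF c1(1)] and em = ext[OF c0(2)] ext[OF c1(2)]
    and y = continuous_on_snd[OF continuous_on_id, of "UNIV :: (real \<times> real) set"]
  have "continuous_on UNIV (\<lambda>(t, x). \<alpha> t x)"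
    unfolding \<alpha>_def split_beta by (rule cubic_continuous(1)[OF e00 e2 y])
  moreover have "continuous_on UNIV (\<lambda>(t, x). \<alpha>x t x)"
    unfolding \<alpha>x_def split_beta by (rule cubic_continuous(2)[OF e00 e2 y])
  moreover have "continuous_on UNIV (\<lambda>(t, x). \<beta> t x)"
    unfolding \<beta>_def split_beta
    by (rule continuous_on_diff[OF cubic_continuous(1)[OF eh em y] cubic_xx_continuous[OF e01 y]])
  moreover have "continuous_on UNIV (\<lambda>(t, x). \<beta>x t x)"
    unfolding \<beta>x_def split_beta
    by (rule continuous_on_diff[OF cubic_continuous(2)[OF eh em y] continuous_on_diff[OF e01(2,1)]])
  ultimately have cont: "continuous_on UNIV (\<lambda>(t, x). \<alpha> t x)" "continuous_on UNIV (\<lambda>(t, x). \<alpha>x t x)"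
      "continuous_on UNIV (\<lambda>(t, x). \<beta> t x)" "continuous_on UNIV (\<lambda>(t, x). \<beta>x t x)" by blast+
  have \<psi>d: "((\<lambda>x. - cubic 0 0 (m01 0) (m11 0) x) has_real_derivative \<psi> x) (at x)" for x
    unfolding \<psi>_def by (rule DERIV_minus[OF cubic_deriv_x(1)])
  have \<psi>s: "sprim \<psi> x = - cubic 0 0 (m01 0) (m11 0) x" for x
    by (rule sprim_unique[OF \<psi>d]) (simp add: cubic_ends)
  have \<psi>c: "continuous_on UNIV \<psi>"
    unfolding \<psi>_def[abs_def] cubic_x_def by (intro continuous_intros) auto
  have bdd: "\<exists>M. \<forall>t x. x \<in> {0..1} \<longrightarrow> \<bar>F (cl t) x\<bar> \<le> M" if "continuous_on UNIV (\<lambda>(t, x). F t x)" for F :: "real \<Rightarrow> real \<Rightarrow> real"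
  proof -
    have "compact ({0..T} \<times> {0..1::real})" by (intro compact_Times compact_Icc)
    then have "bounded ((\<lambda>(t, x). F t x) ` ({0..T} \<times> {0..1}))"
      by (intro compact_imp_bounded compact_continuous_image continuous_on_subset[OF that]) auto
    then obtain M where M: "\<And>z. z \<in> (\<lambda>(t, x). F t x) ` ({0..T} \<times> {0..1}) \<Longrightarrow> norm z \<le> M"
      unfolding bounded_iff by blast
    have "\<bar>F (cl t) x\<bar> \<le> M" if "x \<in> {0..1}" for t x
      using M[of "F (cl t) x"] cl(1)[of t] that by force
    then show ?thesis by blast
  qed
  have cl2: "cl (cl t) = cl t" for t using cl by blast
  obtain M1 where M1: "\<And>t x. x \<in> {0..1} \<Longrightarrow> \<bar>\<alpha>x t x\<bar> \<le> M1"
    using bdd[OF cont(2)] by (auto simp: \<alpha>x_def cl2)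
  obtain M2 where M2: "\<And>t x. x \<in> {0..1} \<Longrightarrow> \<bar>\<beta>x t x\<bar> \<le> M2"
    using bdd[OF cont(4)] by (auto simp: \<beta>x_def cl2)
  have \<psi>2: "continuous_on UNIV (\<lambda>(t::real, x). \<psi> x)"
    unfolding split_beta by (rule continuous_on_compose2[OF \<psi>c]) (auto intro!: continuous_intros)
  obtain M3 where M3: "\<And>x. x \<in> {0..1} \<Longrightarrow> \<bar>\<psi> x\<bar> \<le> M3"
    using bdd[OF \<psi>2] by auto
  have b1b: "\<bar>b1 z\<bar> \<le> a1" for z using B(4)[of z] B(5)[of z] a by linarith
  have a1: "a1 > 0" using B(4)[of 0] B(5)[of 0] a by linarith
  have a2: "a2 \<ge> 0" using B(6)[of 0] by linarith
  interpret W: wave_fixpoint T a1 a2 "max M1 (max M2 M3)" b b1 \<psi> \<alpha> \<alpha>x \<beta> \<beta>x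
  proof
    show "(\<alpha> t has_real_derivative \<alpha>x t x) (at x)" for t x
      unfolding \<alpha>_def[abs_def] \<alpha>x_def by (rule cubic_deriv_x)
    show "(\<beta> t has_real_derivative \<beta>x t x) (at x)" for t x
      unfolding \<beta>_def[abs_def] \<beta>x_def by (intro DERIV_diff cubic_deriv_x)
    show "\<beta> t 0 + b (\<alpha> t 0) = 0" "\<beta> t 1 + b (\<alpha> t 1) = 0" for t
      by (simp_all add: \<alpha>_def \<beta>_def cubic_ends e0(1) e1(1))
    show "\<bar>\<alpha>x t x\<bar> \<le> max M1 (max M2 M3)" "\<bar>\<beta>x t x\<bar> \<le> max M1 (max M2 M3)" "\<bar>\<psi> x\<bar> \<le> max M1 (max M2 M3)"
      if "x \<in> {0..1}" for t x
      using M1[OF that, of t] M2[OF that, of t] M3[OF that] by simp_all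
    show "integral {0..1} \<psi> = 0" using \<psi>s[of 1] by (simp add: sprim_1 cubic_ends)
  qed (use T a1 a2 B(2) b1b C2_param_lipschitz(2)[OF C a] cont \<psi>c in simp_all)
  obtain q y qx yx F where
    qc: "continuous_on UNIV (\<lambda>(t, x). q t x)" "continuous_on UNIV (\<lambda>(t, x). y t x)"
      "continuous_on UNIV (\<lambda>(t, x). qx t x)" "continuous_on UNIV (\<lambda>(t, x). yx t x)" "continuous_on UNIV (\<lambda>(t, x). F t x)"
    and qd: "\<And>t x. (q t has_real_derivative qx t x) (at x)" "\<And>t x. (y t has_real_derivative yx t x) (at x)"
      "\<And>t x. ((\<lambda>t. q t x) has_real_derivative - yx t x) (at t)"
      "\<And>t x. ((\<lambda>t. y t x) has_real_derivative - qx t x - F t x) (at t)"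
    and F: "\<And>t x. t \<in> {0..T} \<Longrightarrow> x \<in> {0..1} \<Longrightarrow> F t x = \<beta> t x + b (\<alpha> t x + y t x)"
    and bc: "\<And>t. y t 0 = 0 \<and> y t 1 = 0" and ic: "\<And>x. x \<in> {0..1} \<Longrightarrow> q 0 x = 0 \<and> y 0 x = sprim \<psi> x"
    using W.solution_exists by (elim exE conjE) blast
  \<comment> \<open>The pressure lift is, up to c, minus the space derivative of a time
    antiderivative of \<alpha>, so that the lifts satisfy the first equation exactly.\<close>
  define p where "p t x = c - cubic_x (G0 t) (G1 t) (m0 t) (m1 t) x + q t x" for t x
  define u where "u t x = cubic (g0 t) (g1 t) (m01 t) (m11 t) x + y t x" for t x
  define px where "px t x = - cubic_xx (m0 t) (m1 t) x + qx t x" for t x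
  define ux where "ux t x = cubic_x (g0 t) (g1 t) (m01 t) (m11 t) x + yx t x" for t x
  define pt where "pt t x = - cubic_x (g0 t) (g1 t) (m01 t) (m11 t) x - yx t x" for t x
  define ut where "ut t x = cubic (h0 t) (h1 t) (m02 t) (m12 t) x + (- qx t x - F t x)" for t x
  have f1: "continuous_on (rect T) (\<lambda>z. k (fst z))" if "continuous_on {0..T} k" for k
    by (rule continuous_on_compose2[OF that]) (auto simp: rect_def intro!: continuous_intros)
  have f2: "continuous_on (rect T) (\<lambda>z. k (fst z) (snd z))" if "continuous_on UNIV (\<lambda>(t, x). k t x)" for k :: "real \<Rightarrow> real \<Rightarrow> real"
    by (intro continuous_on_swap_args[OF that] continuous_intros)
  note fG = f1[OF k0(1)] f1[OF k1(1)] and fg = f1[OF k0(2)] f1[OF k1(2)] and fm = f1[OF k0(3)] f1[OF k1(3)]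
    and fn = f1[OF k0(4)] f1[OF k1(4)] and fh = f1[OF c0(1)] f1[OF c1(1)] and fl = f1[OF c0(2)] f1[OF c1(2)]
    and y' = continuous_on_snd[OF continuous_on_id, of "rect T"]
  have pc_p: "continuous_on (rect T) (\<lambda>(t, x). p t x)"
    unfolding p_def split_beta
    by (rule continuous_on_add[OF continuous_on_diff[OF continuous_on_const cubic_continuous(2)[OF fG fm y']] f2[OF qc(1)]])
  have pc_u: "continuous_on (rect T) (\<lambda>(t, x). u t x)"
    unfolding u_def split_beta
    by (rule continuous_on_add[OF cubic_continuous(1)[OF fg fn y'] f2[OF qc(2)]])
  have pc_px: "continuous_on (rect T) (\<lambda>(t, x). px t x)"
    unfolding px_def split_beta
    by (rule continuous_on_add[OF continuous_on_minus[OF cubic_xx_continuous[OF fm y']] f2[OF qc(3)]])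
  have pc_ux: "continuous_on (rect T) (\<lambda>(t, x). ux t x)"
    unfolding ux_def split_beta
    by (rule continuous_on_add[OF cubic_continuous(2)[OF fg fn y'] f2[OF qc(4)]])
  have pc_pt: "continuous_on (rect T) (\<lambda>(t, x). pt t x)"
    unfolding pt_def split_beta
    by (rule continuous_on_diff[OF continuous_on_minus[OF cubic_continuous(2)[OF fg fn y']] f2[OF qc(4)]])
  have pc_ut: "continuous_on (rect T) (\<lambda>(t, x). ut t x)"
    unfolding ut_def split_beta
    by (rule continuous_on_add[OF cubic_continuous(1)[OF fh fl y'] continuous_on_diff[OF continuous_on_minus[OF f2[OF qc(3)]] f2[OF qc(5)]]])
  note pc = pc_p pc_u pc_px pc_ux pc_pt pc_ut
  have sol: "classical_solution T c g0 g1 b p u"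
  proof (rule classical_solutionI[OF pc])
    fix t x :: real assume t: "t \<in> {0..T}" and x: "x \<in> {0..1}"
    note w = has_field_derivative_at_within
    show "(p t has_real_derivative px t x) (at x within {0..1})"
      unfolding p_def[abs_def] px_def
      by (rule w, rule DERIV_cong[OF DERIV_add[OF DERIV_diff[OF DERIV_const cubic_deriv_x(2)] qd(1)]]) simp
    show "(u t has_real_derivative ux t x) (at x within {0..1})"
      unfolding u_def[abs_def] ux_def by (rule w, rule DERIV_add[OF cubic_deriv_x(1) qd(2)])
    show "((\<lambda>t. p t x) has_real_derivative pt t x) (at t within {0..T})"
      unfolding p_def pt_def
      by (rule DERIV_cong[OF DERIV_add[OF DERIV_diff[OF DERIV_const cubic_deriv_t(2)[OF d0(1)[OF t] d1(1)[OF t] d0(3)[OF t] d1(3)[OF t]]] w[OF qd(3)]]]) simp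
    show "((\<lambda>t. u t x) has_real_derivative ut t x) (at t within {0..T})"
      unfolding u_def ut_def
      by (rule DERIV_add[OF cubic_deriv_t(1)[OF d0(2)[OF t] d1(2)[OF t] d0(4)[OF t] d1(4)[OF t]] w[OF qd(4)]])
    show "pt t x + ux t x = 0" by (simp add: pt_def ux_def)
    have "\<alpha> t x + y t x = u t x" by (simp add: \<alpha>_def u_def cl(2)[OF t])
    then show "ut t x + px t x + b (u t x) = 0"
      using F[OF t x] by (simp add: ut_def px_def \<beta>_def cl(2)[OF t])
  next
    show "u t 0 = g0 t \<and> u t 1 = g1 t" for t using bc[of t] by (simp add: u_def cubic_ends)
    show "p 0 x = c \<and> u 0 x = 0" if "x \<in> {0..1}" for x
      using ic[OF that] by (simp add: p_def u_def \<psi>s e0(2,3) e1(2,3) g0(2) g1(2) cubic_x_def)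
  qed
  have "continuous_on {0..T} (\<lambda>t. p t x)" if "x \<in> {0..1}" for x
  proof -
    have "continuous_on {0..T} (\<lambda>t. (t, x))" by (intro continuous_intros)
    moreover have "(\<lambda>t. (t, x)) ` {0..T} \<subseteq> rect T" using that by (auto simp: rect_def)
    ultimately show ?thesis using continuous_on_compose2[OF pc(1), of "{0..T}" "\<lambda>t. (t, x)"] by simp
  qed
  then show ?thesis using sol by (intro exI[of _ p] exI[of _ u]) simp
qed

subsection \<open>Uniqueness and stability of classical solutions\<close>

text \<open>The difference of \<open>f\<close> and the indefinite integral of \<open>g\<close> is
  constant inside and continuous up to the ends, hence constant on the closed interval. This brings
  the traces into the integration by parts.\<close>

lemma primitive_on_closure:
  assumes c: "continuous_on {0..1} f" and w: "weak_deriv I01 1 f g" and g: "g \<in> L2 I01"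
  shows "primitive_on {0..1} f g"
proof -
  have i: "set_integrable lebesgue {0..1} g" by (rule L2_imp_integrable[OF g])
  have gL: "g \<in> L1_loc {0..1}"
    unfolding L1_loc_def by (auto intro: set_integrable_subset[OF i] lmeasurable_compact fmeasurableD)
  have gi: "g integrable_on {a..b}" if "a \<in> {0..1}" "b \<in> {0..1}" for a b
    by (rule L1_loc_integrable_on[OF gL]) (use that in auto)
  have p: "primitive_on I01 f g"
    by (rule unit_interval.weak_deriv_imp_primitive[OF w continuous_on_subset[OF c]]) auto
  define H where "H x = f x - integral {0..x} g" for x
  have comb: "integral {0..y} g = integral {0..x} g + integral {x..y} g" if "0 \<le> x" "x \<le> y" "y \<le> 1" for x y
    by (rule Henstock_Kurzweil_Integration.integral_combine[symmetric]) (use that gi in auto)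
  have Hc: "continuous_on {0..1} H"
    unfolding H_def[abs_def] by (intro continuous_on_diff c indefinite_integral_continuous_1 gi) auto
  have I0: "H x = H y" if "x \<in> I01" "y \<in> I01" "x \<le> y" for x y
  proof -
    have "f y - f x = integral {x..y} g" using p that unfolding primitive_on_def by blast
    then show ?thesis using comb[of x y] that by (simp add: H_def)
  qed
  have I: "H x = H (1/2)" if "x \<in> I01" for x
    using I0[of x "1/2"] I0[of "1/2" x] that by (cases "x \<le> 1/2") auto
  have K: "H x = H (1/2)" if "x \<in> {0..1}" for x
  proof (rule continuous_constant_on_closure[of I01 H])
    show "continuous_on (closure I01) H" using Hc by simp
    show "x \<in> closure I01" using that by simp
  qed (rule I)
  have "f y - f x = integral {x..y} g" if "x \<in> {0..1}" "y \<in> {0..1}" "x \<le> y" for x y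
    using K[OF that(1)] K[OF that(2)] comb[of x y] that by (simp add: H_def)
  then show ?thesis using gL by (simp add: primitive_on_def)
qed

lemma norm_L2_diff_le:
  assumes f: "f \<in> L2 S" and g: "g \<in> L2 S"
  shows "norm_L2 S (\<lambda>x. f x - g x) \<le> norm_L2 S f + norm_L2 S g"
  using norm_L2_triangle[OF f L2_cmult[OF g, of "-1"]] norm_L2_cmult[of S "-1" g] by simp

lemma tendsto_norm_L2_diff:
  assumes L: "\<forall>\<^sub>F s in F. f s \<in> L2 S" "\<forall>\<^sub>F s in F. g s \<in> L2 S"
    and lim: "((\<lambda>s. norm_L2 S (f s)) \<longlongrightarrow> 0) F" "((\<lambda>s. norm_L2 S (g s)) \<longlongrightarrow> 0) F"
  shows "((\<lambda>s. norm_L2 S (\<lambda>x. f s x - g s x)) \<longlongrightarrow> 0) F"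
proof (rule tendsto_sandwich)
  show "\<forall>\<^sub>F s in F. 0 \<le> norm_L2 S (\<lambda>x. f s x - g s x)" by (simp add: norm_L2_nonneg)
  show "\<forall>\<^sub>F s in F. norm_L2 S (\<lambda>x. f s x - g s x) \<le> norm_L2 S (f s) + norm_L2 S (g s)"
    using L by eventually_elim (rule norm_L2_diff_le)
  show "((\<lambda>s. norm_L2 S (f s) + norm_L2 S (g s)) \<longlongrightarrow> 0) F" using tendsto_add[OF lim] by simp
qed simp

lemma curve_C_L2_diff:
  assumes v: "curve_C_L2 T v" and w: "curve_C_L2 T w"
  shows "curve_C_L2 T (\<lambda>t x. v t x - w t x)"
  unfolding curve_C_L2_def
proof (intro ballI conjI)
  fix t assume t: "t \<in> {0..T}"
  have L: "v s \<in> L2 I01" "w s \<in> L2 I01" if "s \<in> {0..T}" for s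
    using v w that by (auto simp: curve_C_L2_def)
  show "(\<lambda>x. v t x - w t x) \<in> L2 I01" by (rule L2_diff[OF L[OF t]])
  have ev: "\<forall>\<^sub>F s in at t within {0..T}. s \<in> {0..T}" by (auto simp: eventually_at_filter)
  have "((\<lambda>s. norm_L2 I01 (\<lambda>x. (v s x - v t x) - (w s x - w t x))) \<longlongrightarrow> 0) (at t within {0..T})"
  proof (rule tendsto_norm_L2_diff)
    show "\<forall>\<^sub>F s in at t within {0..T}. (\<lambda>x. v s x - v t x) \<in> L2 I01"
      using ev by eventually_elim (rule L2_diff[OF L(1) L(1)[OF t]])
    show "\<forall>\<^sub>F s in at t within {0..T}. (\<lambda>x. w s x - w t x) \<in> L2 I01"
      using ev by eventually_elim (rule L2_diff[OF L(2) L(2)[OF t]])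
  qed (use v w t in \<open>auto simp: curve_C_L2_def\<close>)
  moreover have "(\<lambda>x. (v s x - v t x) - (w s x - w t x)) = (\<lambda>x. (v s x - w s x) - (v t x - w t x))" for s
    by (simp add: algebra_simps)
  ultimately show "((\<lambda>s. norm_L2 I01 (\<lambda>x. (v s x - w s x) - (v t x - w t x))) \<longlongrightarrow> 0) (at t within {0..T})"
    by simp
qed

lemma curve_C1_L2_diff:
  assumes v: "curve_C1_L2 T v v'" and w: "curve_C1_L2 T w w'"
  shows "curve_C1_L2 T (\<lambda>t x. v t x - w t x) (\<lambda>t x. v' t x - w' t x)"
proof -
  have C: "curve_C_L2 T v" "curve_C_L2 T v'" "curve_C_L2 T w" "curve_C_L2 T w'"
    using v w by (simp_all add: curve_C1_L2_def)
  have L: "v s \<in> L2 I01" "v' s \<in> L2 I01" "w s \<in> L2 I01" "w' s \<in> L2 I01" if "s \<in> {0..T}" for s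
    using C that by (simp_all add: curve_C_L2_def)
  have "((\<lambda>s. norm_L2 I01 (\<lambda>x. ((v s x - w s x) - (v t x - w t x)) / (s - t) - (v' t x - w' t x))) \<longlongrightarrow> 0)
      (at t within {0..T})" if t: "t \<in> {0..T}" for t
  proof -
    have q: "(\<lambda>x. (f s x - f t x) / (s - t) - f' t x) \<in> L2 I01"
      if "f s \<in> L2 I01" "f t \<in> L2 I01" "f' t \<in> L2 I01" for f f' :: "real \<Rightarrow> real \<Rightarrow> real" and s
      using L2_diff[OF L2_cmult[OF L2_diff[OF that(1,2)], of "1 / (s - t)"] that(3)] by simp
    have ev: "\<forall>\<^sub>F s in at t within {0..T}. s \<in> {0..T}" by (auto simp: eventually_at_filter)
    have "((\<lambda>s. norm_L2 I01 (\<lambda>x. ((v s x - v t x) / (s - t) - v' t x) - ((w s x - w t x) / (s - t) - w' t x))) \<longlongrightarrow> 0)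
      (at t within {0..T})"
    proof (rule tendsto_norm_L2_diff)
      show "\<forall>\<^sub>F s in at t within {0..T}. (\<lambda>x. (v s x - v t x) / (s - t) - v' t x) \<in> L2 I01"
        using ev by eventually_elim (rule q[where f = v and f' = v', OF L(1) L(1)[OF t] L(2)[OF t]])
      show "\<forall>\<^sub>F s in at t within {0..T}. (\<lambda>x. (w s x - w t x) / (s - t) - w' t x) \<in> L2 I01"
        using ev by eventually_elim (rule q[where f = w and f' = w', OF L(3) L(3)[OF t] L(4)[OF t]])
    qed (use v w t in \<open>auto simp: curve_C1_L2_def\<close>)
    moreover have "(\<lambda>x. ((v s x - v t x) / (s - t) - v' t x) - ((w s x - w t x) / (s - t) - w' t x))
        = (\<lambda>x. ((v s x - w s x) - (v t x - w t x)) / (s - t) - (v' t x - w' t x))" for s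
      by (rule ext) (simp add: diff_divide_distrib)
    ultimately show ?thesis by simp
  qed
  then show ?thesis
    unfolding curve_C1_L2_def using curve_C_L2_diff[OF C(1,3)] curve_C_L2_diff[OF C(2,4)] by blast
qed

lemma curve_C_H1_deriv:
  assumes "curve_C_H1 T v" "t \<in> {0..T}" "continuous_on {0..1} (v t)"
  shows "wderiv I01 1 (v t) \<in> L2 I01" "primitive_on {0..1} (v t) (wderiv I01 1 (v t))"
proof -
  obtain g where g: "g \<in> L2 I01" "weak_deriv I01 1 (v t) g"
    using assms(1,2) unfolding curve_C_H1_def sobolev_H_def by blast
  note wd = unit_interval.weak_deriv_wderiv[OF g(2)]
  have "AE x in lebesgue. x \<in> I01 \<longrightarrow> g x = wderiv I01 1 (v t) x"
    using wd(2) by eventually_elim simp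
  then show L: "wderiv I01 1 (v t) \<in> L2 I01" by (rule L2_cong_AE[OF g(1)])
  show "primitive_on {0..1} (v t) (wderiv I01 1 (v t))"
    by (rule primitive_on_closure[OF assms(3) wd(1) L])
qed

lemma primitive_on_diff:
  assumes "primitive_on {a..b} f g" "primitive_on {a..b} f' g'"
  shows "primitive_on {a..b} (\<lambda>x. f x - f' x) (\<lambda>x. g x - g' x)"
proof -
  have L: "g \<in> L1_loc {a..b}" "g' \<in> L1_loc {a..b}" using assms by (simp_all add: primitive_on_def)
  have "(f y - f' y) - (f x - f' x) = integral {x..y} (\<lambda>x. g x - g' x)" if "x \<in> {a..b}" "y \<in> {a..b}" "x \<le> y" for x y
  proof -
    have sub: "{x..y} \<subseteq> {a..b}" using that by auto
    have "integral {x..y} (\<lambda>x. g x - g' x) = integral {x..y} g - integral {x..y} g'"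
      by (rule Henstock_Kurzweil_Integration.integral_diff[OF L1_loc_integrable_on[OF L(1) sub] L1_loc_integrable_on[OF L(2) sub]])
    moreover have "f y - f x = integral {x..y} g" "f' y - f' x = integral {x..y} g'"
      using assms that by (auto simp: primitive_on_def)
    ultimately show ?thesis by simp
  qed
  then show ?thesis using L1_loc_diff[OF L] by (simp add: primitive_on_def)
qed

text \<open>Insert \<open>b z\<close>: monotonicity and the Lipschitz bound take care of b y - b z,
  and closeness of the two functions is needed at z only.\<close>

lemma monotone_difference_bounds:
  fixes b b' :: "real \<Rightarrow> real"
  assumes mono: "\<And>y z. y \<le> z \<Longrightarrow> b y \<le> b z" and lip: "\<And>y z. \<bar>b y - b z\<bar> \<le> A * \<bar>y - z\<bar>"
    and e: "\<bar>b z - b' z\<bar> \<le> \<epsilon>"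
  shows "- (\<epsilon> * \<bar>y - z\<bar>) \<le> (y - z) * (b y - b' z)" "\<bar>b y - b' z\<bar> \<le> A * \<bar>y - z\<bar> + \<epsilon>"
proof -
  have "0 \<le> (y - z) * (b y - b z)"
    using mono[of y z] mono[of z y] by (cases "y \<le> z") (auto simp: zero_le_mult_iff mult_nonpos_nonpos)
  moreover have "\<bar>(y - z) * (b z - b' z)\<bar> \<le> \<epsilon> * \<bar>y - z\<bar>"
    using mult_right_mono[OF e, of "\<bar>y - z\<bar>"] by (simp add: abs_mult mult.commute)
  moreover have "(y - z) * (b y - b' z) = (y - z) * (b y - b z) + (y - z) * (b z - b' z)"
    by (simp add: algebra_simps)
  ultimately show "- (\<epsilon> * \<bar>y - z\<bar>) \<le> (y - z) * (b y - b' z)" by linarith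
  show "\<bar>b y - b' z\<bar> \<le> A * \<bar>y - z\<bar> + \<epsilon>" using lip[of y z] e by linarith
qed

lemma C2_param_mono:
  assumes "C2_param a0 a1 a2 a3 b b1 b2" "a0 > 0" "y \<le> z"
  shows "b y \<le> b z"
proof (rule DERIV_nonneg_imp_nondecreasing[OF assms(3)])
  show "\<exists>d. (b has_real_derivative d) (at x) \<and> 0 \<le> d" for x
    using C2_paramD(2,4)[OF assms(1), of x] assms(2) by (intro exI[of _ "b1 x"]) simp
qed

text \<open>Closeness of the parameters is asked only along the velocity of the second solution, so
  a bound on [\<open>ul\<close>, \<open>uh\<close>] will be enough.\<close>

lemma solutions_difference:
  assumes T: "T > 0" and a0: "a0 > 0" and \<epsilon>: "\<epsilon> \<ge> 0"
    and C: "C2_param a0 a1 a2 a3 b b1 b2" "C2_param a0 a1 a2 a3 b' b1' b2'"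
    and S: "classical_solution T c g0 g1 b p u" and S': "classical_solution T c g0 g1 b' q v"
    and close: "\<And>t x. t \<in> {0..T} \<Longrightarrow> x \<in> {0..1} \<Longrightarrow> \<bar>b (v t x) - b' (v t x)\<bar> \<le> \<epsilon>"
  shows "\<exists>P' U'. linear_wave T \<epsilon> a1 (\<lambda>t x. p t x - q t x) P' (\<lambda>t x. wderiv I01 1 (p t) x - wderiv I01 1 (q t) x)
    (\<lambda>t x. u t x - v t x) U' (\<lambda>t x. wderiv I01 1 (u t) x - wderiv I01 1 (v t) x) (\<lambda>t x. b (u t x) - b' (v t x))"
proof -
  obtain p' u' where s: "curve_C1_L2 T p p'" "curve_C1_L2 T u u'"
    "\<And>t. t \<in> {0<..<T} \<Longrightarrow> AE x in lebesgue. x \<in> I01 \<longrightarrow>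
       p' t x + wderiv I01 1 (u t) x = 0 \<and> u' t x + wderiv I01 1 (p t) x + b (u t x) = 0"
    using S unfolding classical_solution_def by blast
  obtain q' v' where s': "curve_C1_L2 T q q'" "curve_C1_L2 T v v'"
    "\<And>t. t \<in> {0<..<T} \<Longrightarrow> AE x in lebesgue. x \<in> I01 \<longrightarrow>
       q' t x + wderiv I01 1 (v t) x = 0 \<and> v' t x + wderiv I01 1 (q t) x + b' (v t x) = 0"
    using S' unfolding classical_solution_def by blast
  have H: "curve_C_H1 T p" "curve_C_H1 T u" "curve_C_H1 T q" "curve_C_H1 T v"
    using S S' by (simp_all add: classical_solution_def)
  have c: "continuous_on {0..1} (p t)" "continuous_on {0..1} (u t)" "continuous_on {0..1} (q t)" "continuous_on {0..1} (v t)"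
    if "t \<in> {0..T}" for t using S S' that by (simp_all add: classical_solution_def)
  have I: "t \<in> {0..T}" if "t \<in> {0<..<T}" for t using that by simp
  note D = curve_C_H1_deriv
  have a1: "a1 \<ge> 0" using C2_paramD(4,5)[OF C(1), of 0] a0 by linarith
  have bounds: "- (\<epsilon> * \<bar>y - v t x\<bar>) \<le> (y - v t x) * (b y - b' (v t x)) \<and> \<bar>b y - b' (v t x)\<bar> \<le> a1 * \<bar>y - v t x\<bar> + \<epsilon>"
    if "t \<in> {0..T}" "x \<in> {0..1}" for t x y
    by (intro conjI monotone_difference_bounds[where A = a1] C2_param_mono[OF C(1) a0] C2_param_lipschitz(1)[OF C(1) a0] close that)
  have "linear_wave T \<epsilon> a1 (\<lambda>t x. p t x - q t x) (\<lambda>t x. p' t x - q' t x) (\<lambda>t x. wderiv I01 1 (p t) x - wderiv I01 1 (q t) x)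
    (\<lambda>t x. u t x - v t x) (\<lambda>t x. u' t x - v' t x) (\<lambda>t x. wderiv I01 1 (u t) x - wderiv I01 1 (v t) x) (\<lambda>t x. b (u t x) - b' (v t x))"
  proof
    show "curve_C1_L2 T (\<lambda>t x. p t x - q t x) (\<lambda>t x. p' t x - q' t x)" by (rule curve_C1_L2_diff[OF s(1) s'(1)])
    show "curve_C1_L2 T (\<lambda>t x. u t x - v t x) (\<lambda>t x. u' t x - v' t x)" by (rule curve_C1_L2_diff[OF s(2) s'(2)])
  next
    fix t assume t0: "t \<in> {0<..<T}"
    note t = I[OF t0]
    show "primitive_on {0..1} (\<lambda>x. p t x - q t x) (\<lambda>x. wderiv I01 1 (p t) x - wderiv I01 1 (q t) x)"
      by (rule primitive_on_diff[OF D(2)[OF H(1) t c(1)[OF t]] D(2)[OF H(3) t c(3)[OF t]]])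
    show "primitive_on {0..1} (\<lambda>x. u t x - v t x) (\<lambda>x. wderiv I01 1 (u t) x - wderiv I01 1 (v t) x)"
      by (rule primitive_on_diff[OF D(2)[OF H(2) t c(2)[OF t]] D(2)[OF H(4) t c(4)[OF t]]])
    show "(\<lambda>x. wderiv I01 1 (p t) x - wderiv I01 1 (q t) x) \<in> L2 I01"
      by (rule L2_diff[OF D(1)[OF H(1) t c(1)[OF t]] D(1)[OF H(3) t c(3)[OF t]]])
    show "(\<lambda>x. wderiv I01 1 (u t) x - wderiv I01 1 (v t) x) \<in> L2 I01"
      by (rule L2_diff[OF D(1)[OF H(2) t c(2)[OF t]] D(1)[OF H(4) t c(4)[OF t]]])
    show "AE x in lebesgue. x \<in> I01 \<longrightarrow> p' t x - q' t x = - (wderiv I01 1 (u t) x - wderiv I01 1 (v t) x)"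
      using s(3)[OF t0] s'(3)[OF t0] by eventually_elim auto
    show "AE x in lebesgue. x \<in> I01 \<longrightarrow>
        u' t x - v' t x = - (wderiv I01 1 (p t) x - wderiv I01 1 (q t) x) - (b (u t x) - b' (v t x))"
      using s(3)[OF t0] s'(3)[OF t0] by eventually_elim auto
    show "u t 0 - v t 0 = 0 \<and> u t 1 - v t 1 = 0"
      using S S' t by (simp add: classical_solution_def)
    show "continuous_on {0..1} (\<lambda>x. b (u t x) - b' (v t x))"
      by (intro continuous_on_diff continuous_on_compose2[OF C2_paramD(8)[OF C(1), of UNIV] c(2)[OF t]]
        continuous_on_compose2[OF C2_paramD(8)[OF C(2), of UNIV] c(4)[OF t]]) auto
    fix x :: real assume x0: "x \<in> I01"
    then have x: "x \<in> {0..1}" by simp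
    show "- (\<epsilon> * \<bar>u t x - v t x\<bar>) \<le> (u t x - v t x) * (b (u t x) - b' (v t x))"
      using bounds[OF t x] by blast
    show "\<bar>b (u t x) - b' (v t x)\<bar> \<le> a1 * \<bar>u t x - v t x\<bar> + \<epsilon>"
      using bounds[OF t x] by blast
  next
    fix x :: real assume "x \<in> I01"
    then have x: "x \<in> {0..1}" by simp
    have "p 0 x = c \<and> u 0 x = 0" "q 0 x = c \<and> v 0 x = 0"
      using S S' x unfolding classical_solution_def by blast+
    then show "p 0 x - q 0 x = 0 \<and> u 0 x - v 0 x = 0" by simp
  qed (use T \<epsilon> a1 in auto)
  then show ?thesis by blast
qed

text \<open>For \<epsilon> = 0 the energy estimate makes the L2 distance vanish, and continuity in
  space gives equality at every point, the ends included.\<close>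

lemma pressure_unique:
  assumes T: "T > 0" and a0: "a0 > 0"
    and C: "C2_param a0 a1 a2 a3 b b1 b2" "C2_param a0 a1 a2 a3 b' b1' b2'"
    and S: "classical_solution T c g0 g1 b p u" and S': "classical_solution T c g0 g1 b' q v"
    and eq: "\<And>t x. t \<in> {0..T} \<Longrightarrow> x \<in> {0..1} \<Longrightarrow> b (v t x) = b' (v t x)"
    and t: "t \<in> {0..T}" and x: "x \<in> {0..1}"
  shows "p t x = q t x"
proof -
  have close: "\<bar>b (v t x) - b' (v t x)\<bar> \<le> 0" if "t \<in> {0..T}" "x \<in> {0..1}" for t x
    using eq[OF that] by simp
  obtain P' U' where "linear_wave T 0 a1 (\<lambda>t x. p t x - q t x) P' (\<lambda>t x. wderiv I01 1 (p t) x - wderiv I01 1 (q t) x)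
    (\<lambda>t x. u t x - v t x) U' (\<lambda>t x. wderiv I01 1 (u t) x - wderiv I01 1 (v t) x) (\<lambda>t x. b (u t x) - b' (v t x))"
    using solutions_difference[OF T a0 order_refl C S S' close] by blast
  then interpret L: linear_wave T 0 a1 "\<lambda>t x. p t x - q t x" P' "\<lambda>t x. wderiv I01 1 (p t) x - wderiv I01 1 (q t) x"
    "\<lambda>t x. u t x - v t x" U' "\<lambda>t x. wderiv I01 1 (u t) x - wderiv I01 1 (v t) x" "\<lambda>t x. b (u t x) - b' (v t x)" .
  let ?d = "\<lambda>x. p t x - q t x"
  have c: "continuous_on {0..1} ?d"
    using S S' t by (intro continuous_on_diff) (simp_all add: classical_solution_def)
  have "ip I01 ?d ?d \<le> 0" using L.energy[OF t] L.parts_le_E(1)[of t] by simp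
  moreover have "ip I01 ?d ?d = integral {0..1} (\<lambda>x. ?d x * ?d x)"
    by (rule ip_Ioo_eq_integral(1)[OF continuous_L2[OF c] continuous_L2[OF c]])
  moreover have cc: "continuous_on {0..1} (\<lambda>x. ?d x * ?d x)" by (intro continuous_on_mult c)
  moreover have "integral {0..1} (\<lambda>x. ?d x * ?d x) \<ge> 0"
    by (rule Henstock_Kurzweil_Integration.integral_nonneg[OF integrable_continuous_real[OF cc]]) simp
  ultimately have "integral {0..1} (\<lambda>x. ?d x * ?d x) = 0" by simp
  then have "\<forall>x\<in>{0..1}. ?d x * ?d x = 0"
    using integral_eq_0_iff[OF cc] by simp
  then show ?thesis using x by simp
qed

text \<open>The output error is the difference of the two traces of the pressure difference. Its
  square is at most twice the sum of their squares, hence the factor 2 before the trace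
  constant.\<close>

lemma trace_stability:
  assumes T: "T > 0" and a0: "a0 > 0" and \<epsilon>: "\<epsilon> \<ge> 0"
    and C: "C2_param a0 a1 a2 a3 b b1 b2" "C2_param a0 a1 a2 a3 b' b1' b2'"
    and S: "classical_solution T c g0 g1 b p u" and S': "classical_solution T c g0 g1 b' q v"
    and close: "\<And>t x. t \<in> {0..T} \<Longrightarrow> x \<in> {0..1} \<Longrightarrow> \<bar>b (v t x) - b' (v t x)\<bar> \<le> \<epsilon>"
    and tr: "\<And>x. x \<in> {0, 1} \<Longrightarrow> continuous_on {0..T} (\<lambda>t. p t x)" "\<And>x. x \<in> {0, 1} \<Longrightarrow> continuous_on {0..T} (\<lambda>t. q t x)"
  shows "(norm_L2 {0<..<T} (\<lambda>t. (p t 0 - p t 1) - (q t 0 - q t 1)))\<^sup>2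
    \<le> 2 * (exp T + ((3 + 2 * a1\<^sup>2) * exp T + 2) * T) * \<epsilon>\<^sup>2"
proof -
  obtain P' U' where "linear_wave T \<epsilon> a1 (\<lambda>t x. p t x - q t x) P' (\<lambda>t x. wderiv I01 1 (p t) x - wderiv I01 1 (q t) x)
    (\<lambda>t x. u t x - v t x) U' (\<lambda>t x. wderiv I01 1 (u t) x - wderiv I01 1 (v t) x) (\<lambda>t x. b (u t x) - b' (v t x))"
    using solutions_difference[OF T a0 \<epsilon> C S S' close] by blast
  then interpret L: linear_wave T \<epsilon> a1 "\<lambda>t x. p t x - q t x" P' "\<lambda>t x. wderiv I01 1 (p t) x - wderiv I01 1 (q t) x"
    "\<lambda>t x. u t x - v t x" U' "\<lambda>t x. wderiv I01 1 (u t) x - wderiv I01 1 (v t) x" "\<lambda>t x. b (u t x) - b' (v t x)" .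
  let ?d = "\<lambda>x t. p t x - q t x"
  let ?f = "\<lambda>t. (p t 0 - p t 1) - (q t 0 - q t 1)"
  let ?B = "\<lambda>t. (?d 0 t)\<^sup>2 + (?d 1 t)\<^sup>2"
  have c: "continuous_on {0..T} (?d 0)" "continuous_on {0..T} (?d 1)"
    by (intro continuous_on_diff tr; simp)+
  have B: "(\<lambda>t. 2 * ?B t) integrable_on {0..T}"
    by (intro integrable_continuous_real continuous_intros c)
  have fL: "?f \<in> L2 {0<..<T}"
    by (rule continuous_L2) (intro continuous_on_diff tr; simp)
  have "(norm_L2 {0<..<T} ?f)\<^sup>2 = integral {0..T} (\<lambda>t. ?f t * ?f t)"
    unfolding ip_self[symmetric] by (rule ip_Ioo_eq_integral(1)[OF fL fL])
  also have "\<dots> \<le> integral {0..T} (\<lambda>t. 2 * ?B t)"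
  proof (rule Henstock_Kurzweil_Integration.integral_le[OF ip_Ioo_eq_integral(2)[OF fL fL] B])
    fix t assume "t \<in> {0..T}"
    show "?f t * ?f t \<le> 2 * ?B t"
      using zero_le_power2[of "?d 0 t + ?d 1 t"] by (simp add: power2_eq_square algebra_simps)
  qed
  also have "\<dots> = 2 * integral {0..T} ?B" by (rule Henstock_Kurzweil_Integration.integral_mult_right)
  also have "\<dots> \<le> 2 * (L.K * \<epsilon>\<^sup>2)" using L.trace_estimate[OF c] by simp
  finally show ?thesis by (simp only: L.K_def mult.assoc)
qed

subsection \<open>Existence of minimizers\<close>

lemma tendsto_norm_L2_distance:
  assumes f: "\<And>n::nat. f n \<in> L2 S" and g: "g \<in> L2 S" and w: "w \<in> L2 S"
    and lim: "(\<lambda>n. norm_L2 S (\<lambda>x. f n x - g x)) \<longlonglongrightarrow> 0"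
  shows "(\<lambda>n. norm_L2 S (\<lambda>x. f n x - w x)) \<longlonglongrightarrow> norm_L2 S (\<lambda>x. g x - w x)"
proof (rule LIM_zero_cancel, rule Lim_null_comparison[OF always_eventually lim], rule allI)
  fix n
  show "norm (norm_L2 S (\<lambda>x. f n x - w x) - norm_L2 S (\<lambda>x. g x - w x)) \<le> norm_L2 S (\<lambda>x. f n x - g x)"
    using norm_L2_diff_ge[OF L2_diff[OF f[of n] w] L2_diff[OF g w]] by simp
qed

lemma tendsto_norm_L2_uniform:
  fixes f :: "nat \<Rightarrow> real \<Rightarrow> real"
  assumes ab: "a \<le> b" and lip: "\<And>n x y. \<bar>f n x - f n y\<bar> \<le> L * \<bar>x - y\<bar>" and lim: "\<And>x. (\<lambda>n. f n x) \<longlonglongrightarrow> g x"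
    and c: "\<And>n. continuous_on {a..b} (f n)" "continuous_on {a..b} g"
  shows "(\<lambda>n. norm_L2 {a<..<b} (\<lambda>x. f n x - g x)) \<longlonglongrightarrow> 0"
proof (rule tendstoI)
  fix e :: real assume e: "e > 0"
  define d where "d = e / (2 * (sqrt (b - a) + 1))"
  have s: "sqrt (b - a) \<ge> 0" using ab by simp
  have d: "d > 0" "d * sqrt (b - a) < e" using e s by (auto simp: d_def field_simps add_pos_nonneg)
  have "\<forall>\<^sub>F n in sequentially. \<forall>x\<in>{a..b}. \<bar>f n x - g x\<bar> \<le> d"
    by (rule uniform_if_pointwise_lipschitz[OF lip lim d(1)])
  then show "\<forall>\<^sub>F n in sequentially. dist (norm_L2 {a<..<b} (\<lambda>x. f n x - g x)) 0 < e"
  proof eventually_elim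
    case (elim n)
    have "norm_L2 {a<..<b} (\<lambda>x. f n x - g x) \<le> d * sqrt (b - a)"
      by (rule norm_L2_le_sup[OF ab continuous_on_diff[OF c]]) (use elim in blast)
    then show ?case using d(2) norm_L2_nonneg[of "{a<..<b}" "\<lambda>x. f n x - g x"] by (simp add: dist_real_def)
  qed
qed

locale inverse_problem =
  fixes T a0 a1 a2 a3 c ul uh \<alpha> :: real and g0 g1 h as :: "real \<Rightarrow> real"
  assumes T: "T > 0" and a0: "a0 > 0" and a2: "a2 > 0" and a3: "a3 > 0" and a01: "a0 \<le> a1"
    and g0: "C_k_on 4 T g0" "g0 0 = 0" "(g0 has_real_derivative 0) (at 0 within {0..T})"
    and g1: "C_k_on 4 T g1" "g1 0 = 0" "(g1 has_real_derivative 0) (at 0 within {0..T})"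
    and ul_uh: "ul < uh"
    and range: "\<And>a p u t x. A1 a0 a1 a2 a3 a \<Longrightarrow> classical_solution T c g0 g1 a p u \<Longrightarrow>
           t \<in> {0..T} \<Longrightarrow> x \<in> {0..1} \<Longrightarrow> ul \<le> u t x \<and> u t x \<le> uh"
    and as: "as \<in> sobolev_H 2 {ul<..<uh}" and \<alpha>: "\<alpha> > 0" and h: "h \<in> L2 {0<..<T}"
begin

abbreviation "S \<equiv> {ul<..<uh}"
abbreviation "D \<equiv> param_domain a0 a1 a2 a3 ul uh"
abbreviation "F \<equiv> forward_op a0 a1 a2 a3 ul uh T c g0 g1"
abbreviation "J \<equiv> tikhonov F T ul uh \<alpha> h as"
abbreviation "C2 \<equiv> C2_param a0 a1 a2 a3"
abbreviation "solution \<equiv> classical_solution T c g0 g1"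

section \<open>Membership in the domain and well-definedness of the forward operator\<close>

definition derivs :: "(real \<Rightarrow> real) \<Rightarrow> (real \<Rightarrow> real) \<Rightarrow> (real \<Rightarrow> real) \<Rightarrow> nat \<Rightarrow> real \<Rightarrow> real" where
  "derivs b b1 b2 i = (if i = 0 then b else if i = 1 then b1 else b2)"

interpretation I: open_interval S
  by unfold_locales (use ul_uh in \<open>auto simp: is_interval_1\<close>)

lemma A1_C2: "C2 b b1 b2 \<Longrightarrow> A1 a0 a1 a2 a3 b"
  by (rule C2_param_imp_A1(1)[OF _ a3])

lemma derivs_continuous: "C2 b b1 b2 \<Longrightarrow> continuous_on A (derivs b b1 b2 i)"
  using C2_paramD(8,9,10)[of a0 a1 a2 a3 b b1 b2 A] by (simp add: derivs_def)

lemma derivs_L2: "C2 b b1 b2 \<Longrightarrow> derivs b b1 b2 i \<in> L2 S"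
  by (rule continuous_L2[OF derivs_continuous])

lemma weak_deriv_derivs:
  assumes C: "C2 b b1 b2" and eq: "\<And>y. y \<in> S \<Longrightarrow> b y = a y" and i: "i \<le> 2"
  shows "weak_deriv S i a (derivs b b1 b2 i)"
proof -
  note B = C2_paramD[OF C]
  have 1: "weak_deriv S 1 b b1" "weak_deriv S 1 b1 b2"
    by (rule I.primitive_on_imp_weak_deriv[OF primitive_on_C1[OF has_field_derivative_at_within[OF B(2)] B(9) I.interval_S]],
        rule I.primitive_on_imp_weak_deriv[OF primitive_on_C1[OF has_field_derivative_at_within[OF B(3)] B(10) I.interval_S]])
  have "weak_deriv S 0 b b" by (rule I.weak_deriv_0) (use 1 in \<open>simp add: weak_deriv_def\<close>)
  moreover have "weak_deriv S 2 b b2" using I.weak_deriv_Suc[OF 1] by (simp add: numeral_2_eq_2)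
  moreover have "i = 0 \<or> i = 1 \<or> i = 2" using i by linarith
  ultimately have "weak_deriv S i b (derivs b b1 b2 i)" using 1 by (auto simp: derivs_def)
  then show ?thesis by (rule I.weak_deriv_cong[OF _ eq])
qed

lemma extension_C2:
  assumes "a \<in> D"
  obtains b b1 b2 where "extends_param a0 a1 a2 a3 ul uh a b" "C2 b b1 b2"
proof -
  obtain b where b: "extends_param a0 a1 a2 a3 ul uh a b" using assms by (auto simp: param_domain_def)
  then obtain b1 b2 where "C2 b b1 b2" using A1_imp_C2_param unfolding extends_param_def by blast
  then show ?thesis by (rule that[OF b])
qed

lemma C2_extends: "C2 b b1 b2 \<Longrightarrow> extends_param a0 a1 a2 a3 ul uh b b"
  using A1_C2 by (simp add: extends_param_def)

lemma C2_in_D: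
  assumes C: "C2 b b1 b2"
  shows "b \<in> D"
proof -
  have "\<exists>g\<in>L2 S. weak_deriv S i b g" if "i \<le> 2" for i
    using weak_deriv_derivs[OF C refl that] derivs_L2[OF C] by blast
  moreover have "b \<in> L2 S" using derivs_L2[OF C, of 0] by (simp add: derivs_def)
  ultimately show ?thesis using C2_extends[OF C] by (auto simp: param_domain_def sobolev_H_def)
qed

text \<open>Two extensions agree on [\<open>ul\<close>, \<open>uh\<close>], where the velocities
  take their values, so they lead to the same pressure on the space-time rectangle.
  \<open>restrict\<close> fixes the value outside [0, T], as equality of functions demands.\<close>

lemma F_eq:
  assumes e: "extends_param a0 a1 a2 a3 ul uh a b" and s: "solution b p u"
  shows "F a = restrict (\<lambda>t. p t 0 - p t 1) {0..T}"
  unfolding forward_op_def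
proof (rule the_equality)
  show "\<exists>b q v. extends_param a0 a1 a2 a3 ul uh a b \<and> solution b q v \<and>
      restrict (\<lambda>t. p t 0 - p t 1) {0..T} = restrict (\<lambda>t. q t 0 - q t 1) {0..T}"
    using e s by blast
next
  fix d assume "\<exists>b q v. extends_param a0 a1 a2 a3 ul uh a b \<and> solution b q v \<and> d = restrict (\<lambda>t. q t 0 - q t 1) {0..T}"
  then obtain b' q v where e': "extends_param a0 a1 a2 a3 ul uh a b'" and s': "solution b' q v"
    and d: "d = restrict (\<lambda>t. q t 0 - q t 1) {0..T}" by blast
  obtain b1 b2 where C: "C2 b b1 b2" using A1_imp_C2_param e unfolding extends_param_def by blast
  obtain b1' b2' where C': "C2 b' b1' b2'" using A1_imp_C2_param e' unfolding extends_param_def by blast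
  have "b (v t x) = b' (v t x)" if "t \<in> {0..T}" "x \<in> {0..1}" for t x
    using range[OF A1_C2[OF C'] s' that] e e' by (simp add: extends_param_def)
  then have eq: "p t x = q t x" if "t \<in> {0..T}" "x \<in> {0..1}" for t x
    using pressure_unique[OF T a0 C C' s s' _ that] by blast
  show "d = restrict (\<lambda>t. p t 0 - p t 1) {0..T}"
    unfolding d by (rule restrict_ext) (simp add: eq)
qed

text \<open>The chosen weak derivatives of the difference agree almost everywhere with the classical
  derivatives of the extension minus the weak derivatives of \<open>as\<close>.\<close>

lemma norm_H_eq:
  assumes C: "C2 b b1 b2" and eq: "\<And>y. y \<in> {ul..uh} \<Longrightarrow> b y = a y"
  shows "(norm_H 2 S (\<lambda>y. a y - as y))\<^sup>2 = (\<Sum>i\<le>2. (norm_L2 S (\<lambda>y. derivs b b1 b2 i y - wderiv S i as y))\<^sup>2)"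
proof -
  have "norm_L2 S (wderiv S i (\<lambda>y. a y - as y)) = norm_L2 S (\<lambda>y. derivs b b1 b2 i y - wderiv S i as y)" if i: "i \<le> 2" for i
  proof -
    obtain g where g: "g \<in> L2 S" "weak_deriv S i as g" using as i by (auto simp: sobolev_H_def)
    note w = I.weak_deriv_wderiv[OF g(2)]
    have "AE y in lebesgue. y \<in> S \<longrightarrow> g y = wderiv S i as y" using w(2) by eventually_elim simp
    then have L: "wderiv S i as \<in> L2 S" by (rule L2_cong_AE[OF g(1)])
    have d: "weak_deriv S i (\<lambda>y. a y - as y) (\<lambda>y. derivs b b1 b2 i y - wderiv S i as y)"
      by (rule I.weak_deriv_diff[OF weak_deriv_derivs[OF C _ i] w(1)]) (simp add: eq)
    have "AE y in lebesgue. y \<in> S \<longrightarrow> derivs b b1 b2 i y - wderiv S i as y = wderiv S i (\<lambda>y. a y - as y) y"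
      using I.weak_deriv_wderiv(2)[OF d] by eventually_elim simp
    then show ?thesis by (rule norm_L2_cong_AE[symmetric, OF _ L2_diff[OF derivs_L2[OF C] L]])
  qed
  then show ?thesis by (simp add: norm_H_def sum_nonneg)
qed

lemma J_eq:
  assumes e: "extends_param a0 a1 a2 a3 ul uh a b" and C: "C2 b b1 b2" and s: "solution b p u"
  shows "J a = (norm_L2 {0<..<T} (\<lambda>t. (p t 0 - p t 1) - h t))\<^sup>2
    + \<alpha> * (\<Sum>i\<le>2. (norm_L2 S (\<lambda>y. derivs b b1 b2 i y - wderiv S i as y))\<^sup>2)"
proof -
  have "norm_L2 {0<..<T} (\<lambda>t. F a t - h t) = norm_L2 {0<..<T} (\<lambda>t. (p t 0 - p t 1) - h t)"
    unfolding norm_L2_def by (rule arg_cong[where f = sqrt], rule set_lebesgue_integral_cong) (auto simp: F_eq[OF e s])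
  moreover have "b y = a y" if "y \<in> {ul..uh}" for y using e that by (simp add: extends_param_def)
  note norm_H_eq[OF C this]
  ultimately show ?thesis by (simp only: tikhonov_def)
qed

section \<open>Continuity of the functional and the direct method\<close>

lemma J_nonneg: "J a \<ge> 0"
  using \<alpha> by (simp add: tikhonov_def)

text \<open>Parameters and both derivatives converge uniformly on
  [\<open>ul\<close>, \<open>uh\<close>], so the misfit and the penalty both converge. A member of
  the sequence may differ from its extension outside this interval, whereas the limit
  \<open>d\<close> is its own extension.\<close>

lemma J_continuous:
  assumes C: "\<And>n. C2 (b n) (b1 n) (b2 n)" and L: "C2 d d1 d2"
    and lim: "\<And>y. (\<lambda>n. b n y) \<longlonglongrightarrow> d y" "\<And>y. (\<lambda>n. b1 n y) \<longlonglongrightarrow> d1 y" "\<And>y. (\<lambda>n. b2 n y) \<longlonglongrightarrow> d2 y"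
    and e: "\<And>n. extends_param a0 a1 a2 a3 ul uh (a n) (b n)"
  shows "(\<lambda>n. J (a n)) \<longlonglongrightarrow> J d"
proof -
  have ex: "\<exists>p u. solution b p u \<and> continuous_on {0..T} (\<lambda>t. p t 0) \<and> continuous_on {0..T} (\<lambda>t. p t 1)"
    if "C2 b b1 b2" for b b1 b2
    by (rule classical_solution_exists[OF that a0 T g0 g1])
  obtain q v where q: "solution d q v" "continuous_on {0..T} (\<lambda>t. q t 0)" "continuous_on {0..T} (\<lambda>t. q t 1)"
    using ex[OF L] by blast
  \<comment> \<open>The value of \<open>F\<close> does not depend on the solution chosen, so
    solutions with traces continuous in time may be taken, as the trace estimate requires.\<close>
  obtain p u where p: "\<And>n. solution (b n) (p n) (u n)" "\<And>n. continuous_on {0..T} (\<lambda>t. p n t 0)"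
    "\<And>n. continuous_on {0..T} (\<lambda>t. p n t 1)"
    using ex[OF C] by metis
  let ?G = "\<lambda>p t. p t 0 - p t 1 :: real"
  have GL: "?G q \<in> L2 {0<..<T}" "\<And>n. ?G (p n) \<in> L2 {0<..<T}"
    by (intro continuous_L2 continuous_on_diff p q)+
  define K where "K = 2 * (exp T + ((3 + 2 * a1\<^sup>2) * exp T + 2) * T)"
  have K: "K \<ge> 0" using T by (simp add: K_def)
  have stab: "(norm_L2 {0<..<T} (\<lambda>t. ?G (p n) t - ?G q t))\<^sup>2 \<le> K * \<epsilon>\<^sup>2"
    if "\<epsilon> \<ge> 0" "\<forall>y\<in>{ul..uh}. \<bar>b n y - d y\<bar> \<le> \<epsilon>" for n \<epsilon>
    unfolding K_def
  proof (rule trace_stability[OF T a0 that(1) C L p(1) q(1)])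
    fix t x :: real assume "t \<in> {0..T}" "x \<in> {0..1}"
    from range[OF A1_C2[OF L] q(1) this] show "\<bar>b n (v t x) - d (v t x)\<bar> \<le> \<epsilon>" using that(2) by simp
  qed (use p q in auto)
  have "(\<lambda>n. norm_L2 {0<..<T} (\<lambda>t. ?G (p n) t - ?G q t)) \<longlonglongrightarrow> 0"
  proof (rule tendstoI)
    fix r :: real assume r: "r > 0"
    define \<epsilon> where "\<epsilon> = r / (sqrt K + 1)"
    have s: "sqrt K \<ge> 0" using K by simp
    have \<epsilon>: "\<epsilon> > 0" "sqrt K * \<epsilon> < r"
      using r s by (auto simp: \<epsilon>_def field_simps add_pos_nonneg)
    have "\<forall>\<^sub>F n in sequentially. \<forall>y\<in>{ul..uh}. \<bar>b n y - d y\<bar> \<le> \<epsilon>"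
      by (rule uniform_if_pointwise_lipschitz[OF C2_param_lipschitz(1)[OF C a0] lim(1) \<epsilon>(1)])
    then show "\<forall>\<^sub>F n in sequentially. dist (norm_L2 {0<..<T} (\<lambda>t. ?G (p n) t - ?G q t)) 0 < r"
    proof eventually_elim
      case (elim n)
      have "(norm_L2 {0<..<T} (\<lambda>t. ?G (p n) t - ?G q t))\<^sup>2 \<le> (sqrt K * \<epsilon>)\<^sup>2"
        using stab[OF less_imp_le[OF \<epsilon>(1)] elim] K by (simp add: power_mult_distrib)
      then have "norm_L2 {0<..<T} (\<lambda>t. ?G (p n) t - ?G q t) \<le> sqrt K * \<epsilon>"
        by (rule power2_le_imp_le) (use s \<epsilon>(1) in simp)
      then show ?case using \<epsilon>(2) norm_L2_nonneg[of "{0<..<T}" "\<lambda>t. ?G (p n) t - ?G q t"] by (simp add: dist_real_def)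
    qed
  qed
  then have 1: "(\<lambda>n. norm_L2 {0<..<T} (\<lambda>t. ?G (p n) t - h t)) \<longlonglongrightarrow> norm_L2 {0<..<T} (\<lambda>t. ?G q t - h t)"
    by (rule tendsto_norm_L2_distance[where f = "\<lambda>n. ?G (p n)", OF GL(2,1) h])
  have 2: "(\<lambda>n. norm_L2 S (\<lambda>y. derivs (b n) (b1 n) (b2 n) i y - wderiv S i as y))
      \<longlonglongrightarrow> norm_L2 S (\<lambda>y. derivs d d1 d2 i y - wderiv S i as y)" if i: "i \<le> 2" for i
  proof (rule tendsto_norm_L2_distance)
    obtain g where g: "g \<in> L2 S" "weak_deriv S i as g" using as i by (auto simp: sobolev_H_def)
    have "AE y in lebesgue. y \<in> S \<longrightarrow> g y = wderiv S i as y"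
      using I.weak_deriv_wderiv(2)[OF g(2)] by eventually_elim simp
    then show "wderiv S i as \<in> L2 S" by (rule L2_cong_AE[OF g(1)])
    show "(\<lambda>n. norm_L2 S (\<lambda>y. derivs (b n) (b1 n) (b2 n) i y - derivs d d1 d2 i y)) \<longlonglongrightarrow> 0"
    proof (rule tendsto_norm_L2_uniform)
      show "\<bar>derivs (b n) (b1 n) (b2 n) i x - derivs (b n) (b1 n) (b2 n) i y\<bar> \<le> (if i = 0 then a1 else if i = 1 then a2 else a3) * \<bar>x - y\<bar>"
        for n x y
        using C2_param_lipschitz[OF C[of n] a0, of x y] C2_paramD(7)[OF C[of n], of x y] by (simp add: derivs_def)
      show "(\<lambda>n. derivs (b n) (b1 n) (b2 n) i x) \<longlonglongrightarrow> derivs d d1 d2 i x" for x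
        using lim by (simp add: derivs_def)
    qed (use ul_uh in \<open>auto intro: derivs_continuous C L\<close>)
  qed (auto intro: derivs_L2 C L)
  have "(\<lambda>n. (norm_L2 {0<..<T} (\<lambda>t. ?G (p n) t - h t))\<^sup>2
      + \<alpha> * (\<Sum>i\<le>2. (norm_L2 S (\<lambda>y. derivs (b n) (b1 n) (b2 n) i y - wderiv S i as y))\<^sup>2))
    \<longlonglongrightarrow> (norm_L2 {0<..<T} (\<lambda>t. ?G q t - h t))\<^sup>2 + \<alpha> * (\<Sum>i\<le>2. (norm_L2 S (\<lambda>y. derivs d d1 d2 i y - wderiv S i as y))\<^sup>2)"
    by (intro tendsto_intros 1 2) simp
  then show ?thesis by (simp only: J_eq[OF e C p(1)] J_eq[OF C2_extends[OF L] L q(1)])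
qed

theorem minimizer_exists: "\<exists>a\<in>D. \<forall>b\<in>D. J a \<le> J b"
proof -
  define m where "m = Inf (J ` D)"
  \<comment> \<open>A linear function of admissible slope shows that the domain is nonempty, so that
    the infimum is meaningful.\<close>
  have "C2 (\<lambda>y. a0 * y) (\<lambda>_. a0) (\<lambda>_. 0)"
    unfolding C2_param_def using a0 a01 a2 a3 by (auto intro!: derivative_eq_intros)
  then have ne: "J ` D \<noteq> {}" using C2_in_D by blast
  have bd: "bdd_below (J ` D)" by (rule bdd_belowI2[of _ 0]) (rule J_nonneg)
  have "\<exists>a\<in>D. J a < m + 1 / real (Suc n)" for n
  proof -
    have "Inf (J ` D) < m + 1 / real (Suc n)" by (simp add: m_def)
    from cInf_lessD[OF ne this] show ?thesis by blast
  qed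
  then obtain a where a: "\<And>n. a n \<in> D" "\<And>n. J (a n) < m + 1 / real (Suc n)" by metis
  have "\<exists>b b1 b2. extends_param a0 a1 a2 a3 ul uh (a n) b \<and> C2 b b1 b2" for n
    using extension_C2[OF a(1)] by metis
  then obtain b b1 b2 where b: "\<And>n. extends_param a0 a1 a2 a3 ul uh (a n) (b n)" "\<And>n. C2 (b n) (b1 n) (b2 n)"
    by metis
  have "\<exists>k d d1 d2. strict_mono (k :: nat \<Rightarrow> nat) \<and> C2 d d1 d2 \<and> (\<forall>x. (\<lambda>n. b (k n) x) \<longlonglongrightarrow> d x) \<and>
      (\<forall>x. (\<lambda>n. b1 (k n) x) \<longlonglongrightarrow> d1 x) \<and> (\<forall>x. (\<lambda>n. b2 (k n) x) \<longlonglongrightarrow> d2 x)"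
  proof (rule C2_param_compact[of a0 a1 a2 a3 b b1 b2])
    show "C2 (b n) (b1 n) (b2 n)" for n by (rule b(2))
    show "a0 > 0" by (rule a0)
    fix k d d1 d2
    assume "strict_mono (k :: nat \<Rightarrow> nat)" "C2 d d1 d2" "\<And>x. (\<lambda>n. b (k n) x) \<longlonglongrightarrow> d x"
      "\<And>x. (\<lambda>n. b1 (k n) x) \<longlonglongrightarrow> d1 x" "\<And>x. (\<lambda>n. b2 (k n) x) \<longlonglongrightarrow> d2 x"
    then show ?thesis by blast
  qed
  then obtain k d d1 d2 where k: "strict_mono (k :: nat \<Rightarrow> nat)" and L: "C2 d d1 d2"
    and lim: "\<And>x. (\<lambda>n. b (k n) x) \<longlonglongrightarrow> d x" "\<And>x. (\<lambda>n. b1 (k n) x) \<longlonglongrightarrow> d1 x" "\<And>x. (\<lambda>n. b2 (k n) x) \<longlonglongrightarrow> d2 x"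
    by (elim exE conjE) blast
  have "(\<lambda>n. J (a (k n))) \<longlonglongrightarrow> J d"
  proof (rule J_continuous[where b = "\<lambda>n. b (k n)" and ?b1.0 = "\<lambda>n. b1 (k n)" and ?b2.0 = "\<lambda>n. b2 (k n)" and ?d1.0 = d1 and ?d2.0 = d2])
    show "C2 (b (k n)) (b1 (k n)) (b2 (k n))" for n by (rule b(2))
    show "extends_param a0 a1 a2 a3 ul uh (a (k n)) (b (k n))" for n by (rule b(1))
  qed (rule L lim(1) lim(2) lim(3))+
  moreover have "(\<lambda>n. m + 1 / real (Suc (k n))) \<longlonglongrightarrow> m + 0"
    using LIMSEQ_subseq_LIMSEQ[OF LIMSEQ_Suc[OF lim_1_over_n] k] by (intro tendsto_add tendsto_const) (simp add: comp_def)
  ultimately have "J d \<le> m + 0"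
    by (rule LIMSEQ_le) (use a(2) in \<open>auto intro: less_imp_le\<close>)
  moreover have "m \<le> J y" if "y \<in> D" for y
    unfolding m_def by (rule cInf_lower[OF imageI[OF that] bd])
  ultimately show ?thesis using C2_in_D[OF L] by force
qed

end

theorem theorem5p1:
  fixes T a0 a1 a2 a3 c ul uh \<alpha> :: real
    and g0 g1 h as :: "real \<Rightarrow> real"
  defines "D \<equiv> param_domain a0 a1 a2 a3 ul uh"
    and "F \<equiv> forward_op a0 a1 a2 a3 ul uh T c g0 g1"
  assumes "T > 0" and "a0 > 0" and "a1 > 0" and "a2 > 0" and "a3 > 0" and "a0 \<le> a1"
    and "C_k_on 4 T g0" and "C_k_on 4 T g1"
    and "g0 0 = 0" and "g1 0 = 0"
    and "(g0 has_real_derivative 0) (at 0 within {0..T})"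
    and "(g1 has_real_derivative 0) (at 0 within {0..T})"
    and "ul < uh"
    and "\<And>a p u t x. A1 a0 a1 a2 a3 a \<Longrightarrow> classical_solution T c g0 g1 a p u \<Longrightarrow>
           t \<in> {0..T} \<Longrightarrow> x \<in> {0..1} \<Longrightarrow> ul \<le> u t x \<and> u t x \<le> uh"
    and "as \<in> sobolev_H 2 {ul<..<uh}"
    and "\<alpha> > 0"
    and "h \<in> L2 {0<..<T}"
  shows "\<exists>a\<in>D. \<forall>b\<in>D. tikhonov F T ul uh \<alpha> h as a \<le> tikhonov F T ul uh \<alpha> h as b"
proof -
  interpret inverse_problem T a0 a1 a2 a3 c ul uh \<alpha> g0 g1 h as
    by unfold_locales (fact assms(3-))+
  show ?thesis unfolding D_def F_def by (rule minimizer_exists)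
qed

end
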